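(* Let $(M,g,J_{+},J_{-})$ be a connected bihermitian manifold such that $\dim_{\mathbb{C}}M=3$ and $\dim_{\mathbb{C}}M_{0}\leq1$. Then $M_{0}=M^{(0,3)}$ or $M_{0}=M^{(3,0)}$.
   Context: A bihermitian manifold $(M,g,J_+,J_-)$ is a Riemannian manifold $(M,g)$ equipped with two (integrable) complex structures $J_+,J_-$, both $g$-orthogonal, such that $\nabla^{+}J_{+}=0$ and $\nabla^{-}J_{-}=0$, where $\nabla^{\pm}=\nabla^{Levi}\pm\frac12g^{-1}H$ for a closed three-form $H$; here $\nabla^{Levi}$ is the Levi-Civita connection and $(g^{-1}H)_vw=g^{-1}(H(v,w,\cdot))$. $M_0=\{x\in M\mid[J_+,J_-]|_x=0\}$, which is a holomorphic subvariety of both $(M,J_+)$ and $(M,J_-)$. $M^{(m_1,m_{-1})}=\{x\in M\mid\dim_{\mathbb{R}}\operatorname{Ker}(J_++J_-)|_x=2m_1,\ \dim_{\mathbb{R}}\operatorname{Ker}(J_+-J_-)|_x=2m_{-1}\}$. *)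

theory Defs
  imports "HOL-Analysis.Analysis"
begin

section \<open>Smooth maps and smooth manifolds\<close>

text \<open>On an open subset of a finite-dimensional space, being \<open>C\<^sup>k\<close> in the following sense (existence
  and continuity of all iterated directional derivatives of Frechet differentiable maps) is the usual
  notion.\<close>

primrec Ck_on :: "nat \<Rightarrow> 'a::real_normed_vector set \<Rightarrow> ('a \<Rightarrow> 'b::real_normed_vector) \<Rightarrow> bool" where
  "Ck_on 0 S f \<longleftrightarrow> continuous_on S f"
| "Ck_on (Suc k) S f \<longleftrightarrow> (\<forall>x\<in>S. f differentiable (at x)) \<and>
     (\<forall>v. Ck_on k S (\<lambda>x. frechet_derivative f (at x) v))"

definition smooth_on :: "'a::real_normed_vector set \<Rightarrow> ('a \<Rightarrow> 'b::real_normed_vector) \<Rightarrow> bool" where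
  "smooth_on S f \<longleftrightarrow> (\<forall>k. Ck_on k S f)"

text \<open>A chart is a domain together with a coordinate map. All manifolds below have even real dimension
  \<open>2 n\<close>; their real charts take values in \<open>\<complex>\<^sup>n\<close>, viewed as a real Euclidean space of dimension \<open>2 n\<close>.
  No complex structure is implied by this: transition maps are only required to be real smooth.\<close>

type_synonym ('a, 'n) chart = "'a set \<times> ('a \<Rightarrow> complex ^ 'n)"

definition chart_inv :: "('a, 'n) chart \<Rightarrow> complex ^ 'n \<Rightarrow> 'a" where
  "chart_inv c = inv_into (fst c) (snd c)"

definition is_chart :: "('a::topological_space, 'n::finite) chart \<Rightarrow> bool" where
  "is_chart c \<longleftrightarrow> open (fst c) \<and> open (snd c ` fst c) \<and>
     homeomorphism (fst c) (snd c ` fst c) (snd c) (chart_inv c)"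

definition smooth_transition :: "('a::topological_space, 'n::finite) chart \<Rightarrow> ('a, 'n) chart \<Rightarrow> bool" where
  "smooth_transition c d \<longleftrightarrow> smooth_on (snd c ` (fst c \<inter> fst d)) (snd d \<circ> chart_inv c)"

text \<open>A smooth structure is a maximal smooth atlas. The underlying manifold is the union of the chart
  domains, an open subset of the ambient type; that type is required to be Hausdorff and second
  countable by its type class.\<close>

definition smooth_structure ::
  "('a::{t2_space,second_countable_topology}, 'n::finite) chart set \<Rightarrow> bool" where
  "smooth_structure A \<longleftrightarrow>
     (\<forall>c\<in>A. is_chart c) \<and>
     (\<forall>c\<in>A. \<forall>d\<in>A. smooth_transition c d) \<and>
     (\<forall>c. is_chart c \<and> (\<forall>d\<in>A. smooth_transition c d \<and> smooth_transition d c) \<longrightarrow> c \<in> A)"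

definition manifold :: "('a, 'n) chart set \<Rightarrow> 'a set" where
  "manifold A = (\<Union>c\<in>A. fst c)"

definition smooth_in_chart ::
  "('a, 'n::finite) chart \<Rightarrow> ('a \<Rightarrow> 'b::real_normed_vector) \<Rightarrow> bool" where
  "smooth_in_chart c f \<longleftrightarrow> smooth_on (snd c ` fst c) (f \<circ> chart_inv c)"

text \<open>The derivative of \<open>f\<close> at the point \<open>x\<close> in the direction of the tangent vector whose
  coordinates in the chart \<open>c\<close> are \<open>u\<close>.\<close>

definition chart_deriv ::
  "('a, 'n::finite) chart \<Rightarrow> ('a \<Rightarrow> 'b::real_normed_vector) \<Rightarrow> 'a \<Rightarrow> complex ^ 'n \<Rightarrow> 'b" where
  "chart_deriv c f x u = frechet_derivative (f \<circ> chart_inv c) (at (snd c x)) u"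

text \<open>The Jacobian at \<open>x\<close> of the change of coordinates from \<open>c\<close> to \<open>d\<close>; it turns \<open>c\<close>-coordinates of
  tangent vectors at \<open>x\<close> into \<open>d\<close>-coordinates.\<close>

definition jacobian ::
  "('a, 'n::finite) chart \<Rightarrow> ('a, 'n) chart \<Rightarrow> 'a \<Rightarrow> complex ^ 'n \<Rightarrow> complex ^ 'n" where
  "jacobian c d x u = chart_deriv c (snd d) x u"


section \<open>Tensor fields\<close>

text \<open>A tensor field is given by its coordinate expression in every chart of the smooth structure,
  subject to the transformation law. The argument \<open>c\<close> is the chart, \<open>x\<close> a point of its
  domain, and the vector arguments are \<open>c\<close>-coordinates of tangent vectors at \<open>x\<close>. The values for
  \<open>c \<notin> A\<close> or \<open>x \<notin> fst c\<close> are irrelevant.\<close>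

type_synonym ('a, 'n) endo_field =
  "('a, 'n) chart \<Rightarrow> 'a \<Rightarrow> complex ^ 'n \<Rightarrow> complex ^ 'n"
type_synonym ('a, 'n) cov2_field =
  "('a, 'n) chart \<Rightarrow> 'a \<Rightarrow> complex ^ 'n \<Rightarrow> complex ^ 'n \<Rightarrow> real"
type_synonym ('a, 'n) cov3_field =
  "('a, 'n) chart \<Rightarrow> 'a \<Rightarrow> complex ^ 'n \<Rightarrow> complex ^ 'n \<Rightarrow> complex ^ 'n \<Rightarrow> real"
type_synonym ('a, 'n) connection =
  "('a, 'n) chart \<Rightarrow> 'a \<Rightarrow> complex ^ 'n \<Rightarrow> complex ^ 'n \<Rightarrow> complex ^ 'n"

definition endomorphism_field :: "('a, 'n::finite) chart set \<Rightarrow> ('a, 'n) endo_field \<Rightarrow> bool" where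
  "endomorphism_field A J \<longleftrightarrow>
     (\<forall>c\<in>A. \<forall>x\<in>fst c. linear (J c x)) \<and>
     (\<forall>c\<in>A. \<forall>u. smooth_in_chart c (\<lambda>x. J c x u)) \<and>
     (\<forall>c\<in>A. \<forall>d\<in>A. \<forall>x\<in>fst c \<inter> fst d. \<forall>u.
        J d x (jacobian c d x u) = jacobian c d x (J c x u))"

definition riemannian_metric :: "('a, 'n::finite) chart set \<Rightarrow> ('a, 'n) cov2_field \<Rightarrow> bool" where
  "riemannian_metric A g \<longleftrightarrow>
     (\<forall>c\<in>A. \<forall>x\<in>fst c. bilinear (g c x)) \<and>
     (\<forall>c\<in>A. \<forall>u v. smooth_in_chart c (\<lambda>x. g c x u v)) \<and>
     (\<forall>c\<in>A. \<forall>d\<in>A. \<forall>x\<in>fst c \<inter> fst d. \<forall>u v.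
        g d x (jacobian c d x u) (jacobian c d x v) = g c x u v) \<and>
     (\<forall>c\<in>A. \<forall>x\<in>fst c. \<forall>u v. g c x u v = g c x v u) \<and>
     (\<forall>c\<in>A. \<forall>x\<in>fst c. \<forall>u. u \<noteq> 0 \<longrightarrow> g c x u u > 0)"

definition three_form :: "('a, 'n::finite) chart set \<Rightarrow> ('a, 'n) cov3_field \<Rightarrow> bool" where
  "three_form A H \<longleftrightarrow>
     (\<forall>c\<in>A. \<forall>x\<in>fst c. (\<forall>w. bilinear (\<lambda>u v. H c x u v w)) \<and> (\<forall>u v. linear (H c x u v))) \<and>
     (\<forall>c\<in>A. \<forall>u v w. smooth_in_chart c (\<lambda>x. H c x u v w)) \<and>
     (\<forall>c\<in>A. \<forall>d\<in>A. \<forall>x\<in>fst c \<inter> fst d. \<forall>u v w.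
        H d x (jacobian c d x u) (jacobian c d x v) (jacobian c d x w) = H c x u v w) \<and>
     (\<forall>c\<in>A. \<forall>x\<in>fst c. \<forall>u v w. H c x u v w = - H c x v u w \<and> H c x u v w = - H c x u w v)"

text \<open>\<open>dH = 0\<close>, with \<open>dH\<close> evaluated on vector fields with constant coordinates in the chart \<open>c\<close> (so
  that all Lie bracket terms vanish).\<close>

definition closed_three_form :: "('a, 'n::finite) chart set \<Rightarrow> ('a, 'n) cov3_field \<Rightarrow> bool" where
  "closed_three_form A H \<longleftrightarrow> three_form A H \<and>
     (\<forall>c\<in>A. \<forall>x\<in>fst c. \<forall>u v w z.
        chart_deriv c (\<lambda>y. H c y v w z) x u - chart_deriv c (\<lambda>y. H c y u w z) x v
        + chart_deriv c (\<lambda>y. H c y u v z) x w - chart_deriv c (\<lambda>y. H c y u v w) x z = 0)"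


section \<open>Connections\<close>

text \<open>An affine connection is given by its Christoffel symbols: in the chart \<open>c\<close>, for vector fields
  with coordinate expressions \<open>U\<close>, \<open>V\<close>, one has \<open>\<nabla>\<^sub>U V = chart_deriv c V x U + \<Gamma> c x U V\<close>. The last clause
  is the transformation law of Christoffel symbols.\<close>

definition affine_connection :: "('a, 'n::finite) chart set \<Rightarrow> ('a, 'n) connection \<Rightarrow> bool" where
  "affine_connection A \<Gamma> \<longleftrightarrow>
     (\<forall>c\<in>A. \<forall>x\<in>fst c. bilinear (\<Gamma> c x)) \<and>
     (\<forall>c\<in>A. \<forall>u v. smooth_in_chart c (\<lambda>x. \<Gamma> c x u v)) \<and>
     (\<forall>c\<in>A. \<forall>d\<in>A. \<forall>x\<in>fst c \<inter> fst d. \<forall>u v.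
        \<Gamma> d x (jacobian c d x u) (jacobian c d x v) + chart_deriv c (\<lambda>y. jacobian c d y v) x u
          = jacobian c d x (\<Gamma> c x u v))"

text \<open>Torsion-freeness and \<open>\<nabla> g = 0\<close>, which determine \<open>\<Gamma>\<close> uniquely.\<close>

definition levi_civita ::
  "('a, 'n::finite) chart set \<Rightarrow> ('a, 'n) cov2_field \<Rightarrow> ('a, 'n) connection \<Rightarrow> bool" where
  "levi_civita A g \<Gamma> \<longleftrightarrow> affine_connection A \<Gamma> \<and>
     (\<forall>c\<in>A. \<forall>x\<in>fst c. \<forall>u v. \<Gamma> c x u v = \<Gamma> c x v u) \<and>
     (\<forall>c\<in>A. \<forall>x\<in>fst c. \<forall>u v w.
        chart_deriv c (\<lambda>y. g c y v w) x u = g c x (\<Gamma> c x u v) w + g c x v (\<Gamma> c x u w))"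

text \<open>\<open>g\<^sup>-\<^sup>1 \<alpha>\<close> for a covector \<open>\<alpha>\<close>.\<close>

definition raise :: "('a, 'n::finite) cov2_field \<Rightarrow> ('a, 'n) chart \<Rightarrow> 'a \<Rightarrow>
    (complex ^ 'n \<Rightarrow> real) \<Rightarrow> complex ^ 'n" where
  "raise g c x \<alpha> = (THE z. \<forall>w. g c x z w = \<alpha> w)"

text \<open>The connection \<open>\<nabla> + s g\<^sup>-\<^sup>1 H\<close>, where \<open>(g\<^sup>-\<^sup>1 H)\<^sub>v w = g\<^sup>-\<^sup>1 (H(v, w, \<cdot>))\<close>.\<close>

definition torsion_connection ::
  "('a, 'n::finite) cov2_field \<Rightarrow> ('a, 'n) cov3_field \<Rightarrow> ('a, 'n) connection \<Rightarrow> real \<Rightarrow>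
     ('a, 'n) connection" where
  "torsion_connection g H \<Gamma> s c x v w = \<Gamma> c x v w + s *\<^sub>R raise g c x (H c x v w)"

text \<open>\<open>\<nabla> J = 0\<close>, i.e. \<open>\<nabla>\<^sub>u (J v) = J (\<nabla>\<^sub>u v)\<close> for fields \<open>u\<close>, \<open>v\<close> with constant coordinates.\<close>

definition parallel ::
  "('a, 'n::finite) chart set \<Rightarrow> ('a, 'n) connection \<Rightarrow> ('a, 'n) endo_field \<Rightarrow> bool" where
  "parallel A \<Gamma> J \<longleftrightarrow> (\<forall>c\<in>A. \<forall>x\<in>fst c. \<forall>u v.
     chart_deriv c (\<lambda>y. J c y v) x u + \<Gamma> c x u (J c x v) = J c x (\<Gamma> c x u v))"


section \<open>Complex structures and dimension of subvarieties\<close>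

definition almost_complex_structure ::
  "('a, 'n::finite) chart set \<Rightarrow> ('a, 'n) endo_field \<Rightarrow> bool" where
  "almost_complex_structure A J \<longleftrightarrow> endomorphism_field A J \<and>
     (\<forall>c\<in>A. \<forall>x\<in>fst c. \<forall>u. J c x (J c x u) = - u)"

text \<open>Charts in which \<open>J\<close> is multiplication by \<open>\<i>\<close> on \<open>\<complex>\<^sup>n\<close>, i.e. \<open>J\<close>-holomorphic coordinates.\<close>

definition holomorphic_chart :: "('a, 'n::finite) endo_field \<Rightarrow> ('a, 'n) chart \<Rightarrow> bool" where
  "holomorphic_chart J c \<longleftrightarrow> (\<forall>x\<in>fst c. \<forall>u. J c x u = \<i> *s u)"

text \<open>Integrability: \<open>J\<close> is induced by an atlas of holomorphic charts.\<close>

definition complex_structure ::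
  "('a, 'n::finite) chart set \<Rightarrow> ('a, 'n) endo_field \<Rightarrow> bool" where
  "complex_structure A J \<longleftrightarrow> almost_complex_structure A J \<and>
     (\<forall>x\<in>manifold A. \<exists>c\<in>A. x \<in> fst c \<and> holomorphic_chart J c)"

text \<open>\<open>S\<close> is a complex submanifold of dimension \<open>d\<close> in a neighbourhood of \<open>x \<in> S\<close>.\<close>

definition regular_point ::
  "('a, 'n::finite) chart set \<Rightarrow> ('a, 'n) endo_field \<Rightarrow> 'a set \<Rightarrow> nat \<Rightarrow> 'a \<Rightarrow> bool" where
  "regular_point A J S d x \<longleftrightarrow> x \<in> S \<and>
     (\<exists>c\<in>A. x \<in> fst c \<and> holomorphic_chart J c \<and>
        (\<exists>V. vec.subspace V \<and> vec.dim V = d \<and> snd c ` (S \<inter> fst c) = snd c ` fst c \<inter> V))"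

text \<open>The complex dimension of an analytic subset \<open>S\<close> of the complex manifold given by \<open>J\<close>: the
  supremum of the dimensions of \<open>S\<close> at its regular points (which are dense in \<open>S\<close>). In particular
  the empty set has dimension \<open>-\<infinity>\<close>.\<close>

definition complex_dim ::
  "('a, 'n::finite) chart set \<Rightarrow> ('a, 'n) endo_field \<Rightarrow> 'a set \<Rightarrow> ereal" where
  "complex_dim A J S = (SUP d \<in> {d. \<exists>x. regular_point A J S d x}. ereal (real d))"


section \<open>Bihermitian manifolds\<close>

definition orthogonal_endomorphism ::
  "('a, 'n::finite) chart set \<Rightarrow> ('a, 'n) cov2_field \<Rightarrow> ('a, 'n) endo_field \<Rightarrow> bool" where
  "orthogonal_endomorphism A g J \<longleftrightarrow>
     (\<forall>c\<in>A. \<forall>x\<in>fst c. \<forall>u v. g c x (J c x u) (J c x v) = g c x u v)"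

definition bihermitian ::
  "('a::{t2_space,second_countable_topology}, 'n::finite) chart set \<Rightarrow> ('a, 'n) cov2_field \<Rightarrow>
     ('a, 'n) endo_field \<Rightarrow> ('a, 'n) endo_field \<Rightarrow> bool" where
  "bihermitian A g Jp Jm \<longleftrightarrow>
     smooth_structure A \<and> riemannian_metric A g \<and>
     complex_structure A Jp \<and> complex_structure A Jm \<and>
     orthogonal_endomorphism A g Jp \<and> orthogonal_endomorphism A g Jm \<and>
     (\<exists>\<Gamma> H. levi_civita A g \<Gamma> \<and> closed_three_form A H \<and>
        parallel A (torsion_connection g H \<Gamma> (1/2)) Jp \<and>
        parallel A (torsion_connection g H \<Gamma> (-1/2)) Jm)"

definition commuting_locus ::
  "('a, 'n::finite) chart set \<Rightarrow> ('a, 'n) endo_field \<Rightarrow> ('a, 'n) endo_field \<Rightarrow> 'a set" where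
  "commuting_locus A Jp Jm = {x \<in> manifold A. \<forall>c\<in>A. x \<in> fst c \<longrightarrow>
     (\<forall>v. Jp c x (Jm c x v) - Jm c x (Jp c x v) = 0)}"

text \<open>Here \<^term>\<open>dim\<close> is the real dimension; the dimensions do not depend on the chart \<open>c\<close>.\<close>

definition type_locus ::
  "('a, 'n::finite) chart set \<Rightarrow> ('a, 'n) endo_field \<Rightarrow> ('a, 'n) endo_field \<Rightarrow> nat \<Rightarrow> nat \<Rightarrow> 'a set" where
  "type_locus A Jp Jm m\<^sub>1 m\<^sub>2 = {x \<in> manifold A. \<forall>c\<in>A. x \<in> fst c \<longrightarrow>
     dim {v. Jp c x v + Jm c x v = 0} = 2 * m\<^sub>1 \<and>
     dim {v. Jp c x v - Jm c x v = 0} = 2 * m\<^sub>2}"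

end

theory Submission
  imports Defs "HOL-Complex_Analysis.Conformal_Mappings"
begin

text \<open>In a \<open>J\<^sub>+\<close>-holomorphic chart put \<open>J = J\<^sub>+ = \<i>\<close>, \<open>I = J\<^sub>-\<close>, \<open>p = JI + IJ\<close> and \<open>K = JI - IJ\<close>. The complex
  linear map \<open>p\<close> has eigenvalues \<open>2\<epsilon>, t, t\<close> with \<open>\<epsilon> = \<plusminus>1\<close>, and \<open>p = t\<close> on the image of \<open>K\<close>. The sign \<open>\<epsilon>\<close> is a
  polynomial in the conjugation invariants of \<open>p\<close>, hence continuous and chart independent, hence constant
  on the connected manifold. Let \<open>K = 0\<close> at \<open>x\<close>, so that \<open>p\<^sup>2 = 4\<close>. If \<open>t = 2\<epsilon>\<close> there, then \<open>p = 2\<epsilon>\<close> and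
  \<open>I = -\<epsilon> J\<close>. Otherwise \<open>p - t\<close> is nonzero near \<open>x\<close> and annihilates the skew matrix of the bivector
  \<open>K g\<^sup>-\<^sup>1\<close>, so one of its entries controls all of them. As \<open>K g\<^sup>-\<^sup>1\<close> is holomorphic, the commuting locus is
  near \<open>x\<close> the zero set of one holomorphic function, which has regular points of complex dimension at
  least \<open>2\<close>.\<close>

section \<open>Functions of class \<open>C\<^sup>k\<close>\<close>

text \<open>Vanishing of the bivector amounts to three holomorphic equations, one for each
  independent entry of a skew 3 by 3 matrix, and three equations alone would be compatible with
  isolated points. Codimension one comes from a linear relation: read as a vector, the skew matrix
  is parallel to every row of \<open>p - t\<close>. The repeated eigenvalue has its source in the
  odd dimension: \<open>K\<close> is antilinear and skew, so it has a kernel, on which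
  \<open>J I\<close> is an involution; on the remaining plane \<open>K\<close>, unless zero, carries
  an eigenvector of \<open>p\<close> to an orthogonal one with the same eigenvalue. Holomorphy of
  the bivector is where the geometry enters: the two connections differ by the torsion, whose type
  is restricted because a connection with this torsion preserves the constant structure
  \<open>J\<close>. The dimension is a supremum over regular points, so one regular point near
  \<open>x\<close> suffices, and it may differ from \<open>x\<close>. Moving to a zero of least
  vanishing order replaces the general local theory of analytic sets.\<close>

lemma frechet_derivativeI:
  "(f has_derivative f') (at x) \<Longrightarrow> frechet_derivative f (at x) = f'"
  by (metis frechet_derivative_at)

lemma frechet_derivative_cong_open:
  assumes "open S" "x \<in> S" "\<And>y. y \<in> S \<Longrightarrow> f y = g y" "f differentiable (at x)"
  shows "(g has_derivative frechet_derivative f (at x)) (at x)"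
  using assms frechet_derivative_works has_derivative_transform_within_open by blast

lemma Ck_on_cong:
  assumes "open S"
  shows "(\<And>x. x \<in> S \<Longrightarrow> f x = g x) \<Longrightarrow> Ck_on k S f \<Longrightarrow> Ck_on k S g"
proof (induction k arbitrary: f g)
  case 0
  then show ?case by (simp cong: continuous_on_cong)
next
  case (Suc k)
  have d: "(g has_derivative frechet_derivative f (at x)) (at x)" if "x \<in> S" for x
    using frechet_derivative_cong_open[OF assms that Suc.prems(1)] Suc.prems(2) that by simp
  show ?case
  proof (simp, intro conjI ballI allI)
    show "g differentiable at x" if "x \<in> S" for x
      using d[OF that] differentiable_def by blast
    show "Ck_on k S (\<lambda>x. frechet_derivative g (at x) v)" for v
    proof (rule Suc.IH)
      show "Ck_on k S (\<lambda>x. frechet_derivative f (at x) v)"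
        using Suc.prems(2) by simp
      show "frechet_derivative f (at x) v = frechet_derivative g (at x) v" if "x \<in> S" for x
        using frechet_derivativeI[OF d[OF that]] by simp
    qed
  qed
qed

lemma Ck_on_SucI:
  assumes "open S" "\<And>x. x \<in> S \<Longrightarrow> (f has_derivative f' x) (at x)"
    "\<And>v. Ck_on k S (\<lambda>x. f' x v)"
  shows "Ck_on (Suc k) S f"
proof (simp, intro conjI ballI allI)
  show "f differentiable at x" if "x \<in> S" for x
    using assms(2)[OF that] differentiable_def by blast
  show "Ck_on k S (\<lambda>x. frechet_derivative f (at x) v)" for v
    by (rule Ck_on_cong[OF assms(1) _ assms(3)[of v]])
      (use frechet_derivativeI[OF assms(2)] in auto)
qed

lemma Ck_on_Suc_has_derivative:
  "Ck_on (Suc k) S f \<Longrightarrow> x \<in> S \<Longrightarrow> (f has_derivative frechet_derivative f (at x)) (at x)"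
  using frechet_derivative_works by auto

lemma Ck_on_Suc_imp: "Ck_on (Suc k) S f \<Longrightarrow> Ck_on k S f"
proof (induction k arbitrary: f)
  case 0
  then show ?case
    by (auto intro!: continuous_at_imp_continuous_on differentiable_imp_continuous_within)
next
  case (Suc k)
  then show ?case by (metis Ck_on.simps(2))
qed

lemma Ck_on_imp_continuous_on: "Ck_on k S f \<Longrightarrow> continuous_on S f"
  by (induction k) (auto dest: Ck_on_Suc_imp simp del: Ck_on.simps(2))

lemma Ck_on_subset: "T \<subseteq> S \<Longrightarrow> Ck_on k S f \<Longrightarrow> Ck_on k T f"
  by (induction k arbitrary: f) (auto intro: continuous_on_subset)

lemma Ck_on_const: "Ck_on k S (\<lambda>x. c)"
proof (induction k arbitrary: c)
  case (Suc k)
  have "frechet_derivative (\<lambda>x. c) (at x) = (\<lambda>v. 0)" for x :: 'a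
    by (rule frechet_derivativeI) simp
  with Suc show ?case by simp
qed simp

lemma Ck_on_bounded_linear:
  assumes "bounded_linear L"
  shows "Ck_on k S f \<Longrightarrow> open S \<Longrightarrow> Ck_on k S (\<lambda>x. L (f x))"
proof (induction k arbitrary: f)
  case 0
  then show ?case
    using bounded_linear.continuous_on[OF assms] by auto
next
  case (Suc k)
  show ?case
  proof (rule Ck_on_SucI)
    show "((\<lambda>x. L (f x)) has_derivative (\<lambda>v. L (frechet_derivative f (at x) v))) (at x)" if "x \<in> S" for x
      using bounded_linear.has_derivative[OF assms Ck_on_Suc_has_derivative[OF Suc.prems(1) that]] .
    show "Ck_on k S (\<lambda>x. L (frechet_derivative f (at x) v))" for v
      using Suc by simp
  qed (rule Suc.prems)
qed

lemma Ck_on_linear_self: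
  assumes "bounded_linear L" "open S"
  shows "Ck_on k S L"
proof (cases k)
  case 0
  then show ?thesis
    using assms linear_continuous_on by auto
next
  case (Suc m)
  have "Ck_on (Suc m) S L"
    by (rule Ck_on_SucI[OF assms(2), of _ "\<lambda>x. L"])
      (use assms in \<open>auto intro: bounded_linear_imp_has_derivative Ck_on_const\<close>)
  with Suc show ?thesis by simp
qed

lemma Ck_on_add:
  "Ck_on k S f \<Longrightarrow> Ck_on k S g \<Longrightarrow> open S \<Longrightarrow> Ck_on k S (\<lambda>x. f x + g x)"
proof (induction k arbitrary: f g)
  case 0
  then show ?case by (auto intro: continuous_on_add)
next
  case (Suc k)
  show ?case
  proof (rule Ck_on_SucI)
    show "((\<lambda>x. f x + g x) has_derivative
        (\<lambda>v. frechet_derivative f (at x) v + frechet_derivative g (at x) v)) (at x)" if "x \<in> S" for x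
      by (rule has_derivative_add[OF Ck_on_Suc_has_derivative[OF Suc.prems(1) that]
            Ck_on_Suc_has_derivative[OF Suc.prems(2) that]])
    show "Ck_on k S (\<lambda>x. frechet_derivative f (at x) v + frechet_derivative g (at x) v)" for v
      using Suc by simp
  qed (rule Suc.prems)
qed

lemma Ck_on_sum:
  assumes "open S" "\<And>i. i \<in> B \<Longrightarrow> Ck_on k S (f i)"
  shows "Ck_on k S (\<lambda>x. \<Sum>i\<in>B. f i x)"
proof (cases "finite B")
  case True
  then show ?thesis using assms(2)
    by (induction B) (auto intro!: Ck_on_const Ck_on_add assms(1))
qed (auto intro: Ck_on_const)

lemma Ck_on_bilinear:
  assumes "bounded_bilinear pr"
  shows "Ck_on k S f \<Longrightarrow> Ck_on k S g \<Longrightarrow> open S \<Longrightarrow> Ck_on k S (\<lambda>x. pr (f x) (g x))"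
proof (induction k arbitrary: f g)
  case 0
  then show ?case using bounded_bilinear.continuous_on[OF assms] by auto
next
  case (Suc k)
  show ?case
  proof (rule Ck_on_SucI)
    show "((\<lambda>x. pr (f x) (g x)) has_derivative
        (\<lambda>v. pr (f x) (frechet_derivative g (at x) v) + pr (frechet_derivative f (at x) v) (g x))) (at x)"
      if "x \<in> S" for x
      by (rule bounded_bilinear.FDERIV[OF assms Ck_on_Suc_has_derivative[OF Suc.prems(1) that]
            Ck_on_Suc_has_derivative[OF Suc.prems(2) that]])
    show "Ck_on k S (\<lambda>x. pr (f x) (frechet_derivative g (at x) v) + pr (frechet_derivative f (at x) v) (g x))" for v
      by (intro Ck_on_add Suc.IH Ck_on_Suc_imp[OF Suc.prems(1)] Ck_on_Suc_imp[OF Suc.prems(2)] Suc.prems(3))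
        (use Suc.prems in simp_all)
  qed (rule Suc.prems)
qed

lemmas Ck_on_scaleR = Ck_on_bilinear[OF bounded_bilinear_scaleR]

lemma Ck_on_inner_left: "Ck_on k S f \<Longrightarrow> open S \<Longrightarrow> Ck_on k S (\<lambda>x. f x \<bullet> b)"
  by (rule Ck_on_bounded_linear[OF bounded_linear_inner_left])

lemma linear_basis_expansion:
  fixes u :: "'a::euclidean_space"
  assumes "linear f"
  shows "f u = (\<Sum>b\<in>Basis. (u \<bullet> b) *\<^sub>R f b)"
proof -
  interpret linear f by fact
  have "f u = f (\<Sum>b\<in>Basis. (u \<bullet> b) *\<^sub>R b)" by (simp add: euclidean_representation)
  then show ?thesis by (simp add: sum scale)
qed

text \<open>Smoothness of a tensor field is tested on constant vectors. Expanding \<open>a x\<close>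
  in a basis turns \<open>F x (a x)\<close> into a finite sum of products, which extends the test to
  varying vectors without a topology on the space of linear maps.\<close>

lemma Ck_on_family_apply:
  fixes a :: "'a::real_normed_vector \<Rightarrow> 'b::euclidean_space"
    and F :: "'a \<Rightarrow> 'b \<Rightarrow> 'c::real_normed_vector"
  assumes "open S" "\<And>x. x \<in> S \<Longrightarrow> linear (F x)" "\<And>u. Ck_on k S (\<lambda>x. F x u)" "Ck_on k S a"
  shows "Ck_on k S (\<lambda>x. F x (a x))"
proof (rule Ck_on_cong[OF assms(1)])
  show "(\<Sum>b\<in>Basis. (a x \<bullet> b) *\<^sub>R F x b) = F x (a x)" if "x \<in> S" for x
    using linear_basis_expansion[OF assms(2)[OF that]] by metis
  show "Ck_on k S (\<lambda>x. \<Sum>b\<in>Basis. (a x \<bullet> b) *\<^sub>R F x b)"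
    by (intro Ck_on_sum Ck_on_scaleR Ck_on_inner_left assms)
qed

lemma has_derivative_family_apply:
  fixes a :: "'a::real_normed_vector \<Rightarrow> 'b::euclidean_space"
    and F :: "'a \<Rightarrow> 'b \<Rightarrow> 'c::real_normed_vector"
  assumes S: "open S" "x \<in> S" and lin: "\<And>y. y \<in> S \<Longrightarrow> linear (F y)"
    and F: "\<And>u. ((\<lambda>y. F y u) has_derivative F' u) (at x)" and a: "(a has_derivative a') (at x)"
  shows "((\<lambda>y. F y (a y)) has_derivative (\<lambda>v. F' (a x) v + F x (a' v))) (at x)"
proof -
  let ?G = "\<lambda>y. \<Sum>b\<in>Basis. (a y \<bullet> b) *\<^sub>R F y b"
  let ?G' = "\<lambda>v. \<Sum>b\<in>Basis. (a x \<bullet> b) *\<^sub>R F' b v + (a' v \<bullet> b) *\<^sub>R F x b"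
  have e: "?G y = F y (a y)" if "y \<in> S" for y
    using linear_basis_expansion[OF lin[OF that]] by metis
  have 1: "(?G has_derivative ?G') (at x)"
    by (intro has_derivative_sum has_derivative_scaleR F has_derivative_inner_left a)
  have 2: "((\<lambda>y. F y (a y)) has_derivative ?G') (at x)"
    by (rule has_derivative_transform_within_open[OF 1 S e])
  \<comment> \<open>\<open>F'\<close> is given separately for each constant vector; its linear
    dependence on that vector is recovered from uniqueness of the derivative.\<close>
  have "((\<lambda>y. F y (a x)) has_derivative (\<lambda>v. \<Sum>b\<in>Basis. (a x \<bullet> b) *\<^sub>R F' b v)) (at x)"
    by (rule has_derivative_transform_within_open[OF _ S, of "\<lambda>y. \<Sum>b\<in>Basis. (a x \<bullet> b) *\<^sub>R F y b"])
      (use linear_basis_expansion[OF lin] F in \<open>auto intro!: has_derivative_sum has_derivative_scaleR_right\<close>)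
  then have 3: "F' (a x) = (\<lambda>v. \<Sum>b\<in>Basis. (a x \<bullet> b) *\<^sub>R F' b v)"
    using F has_derivative_unique by blast
  have "F x (a' v) = (\<Sum>b\<in>Basis. (a' v \<bullet> b) *\<^sub>R F x b)" for v
    using linear_basis_expansion[OF lin[OF S(2)]] by metis
  then have "?G' = (\<lambda>v. F' (a x) v + F x (a' v))"
    unfolding 3 by (simp add: sum.distrib)
  with 2 show ?thesis by metis
qed

lemma Ck_on_compose:
  fixes g :: "'a::real_normed_vector \<Rightarrow> 'b::euclidean_space" and f :: "'b \<Rightarrow> 'c::real_normed_vector"
  assumes "open S" "open T" "g ` S \<subseteq> T"
  shows "Ck_on k T f \<Longrightarrow> Ck_on k S g \<Longrightarrow> Ck_on k S (f \<circ> g)"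
proof (induction k arbitrary: f)
  case 0
  then show ?case using assms continuous_on_compose continuous_on_subset by (metis Ck_on.simps(1))
next
  case (Suc k)
  show ?case
  proof (rule Ck_on_SucI)
    show "((f \<circ> g) has_derivative (\<lambda>v. frechet_derivative f (at (g x)) (frechet_derivative g (at x) v))) (at x)"
      if "x \<in> S" for x
    proof -
      have "g x \<in> T" using that assms by auto
      then show ?thesis
        using diff_chain_at[OF Ck_on_Suc_has_derivative[OF Suc.prems(2) that]
            Ck_on_Suc_has_derivative[OF Suc.prems(1)]] by (simp add: o_def)
    qed
    show "Ck_on k S (\<lambda>x. frechet_derivative f (at (g x)) (frechet_derivative g (at x) v))" for v
    proof (rule Ck_on_family_apply[OF assms(1)])
      show "linear (frechet_derivative f (at (g x)))" if "x \<in> S" for x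
        using assms(3) Suc.prems(1) that by (auto intro: linear_frechet_derivative)
      show "Ck_on k S (\<lambda>x. frechet_derivative f (at (g x)) u)" for u
        using Suc.IH[of "\<lambda>y. frechet_derivative f (at y) u"] Suc.prems Ck_on_Suc_imp
        by (auto simp: o_def)
    qed (use Suc.prems in auto)
  qed (rule assms)
qed

section \<open>Inverses of families of linear maps\<close>

text \<open>The term of the product rule containing a derivative of \<open>c\<close> would carry the
  factor \<open>g x = 0\<close>, so \<open>c\<close> enters only through its value. This avoids a
  circle when an inverse family is differentiated.\<close>

lemma has_derivative_scaleR_continuous_zero:
  fixes g :: "'a::real_normed_vector \<Rightarrow> 'b::real_normed_vector" and c :: "'a \<Rightarrow> real"
  assumes c: "isCont c x" and g: "(g has_derivative g') (at x)" and z: "g x = 0"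
  shows "((\<lambda>y. c y *\<^sub>R g y) has_derivative (\<lambda>v. c x *\<^sub>R g' v)) (at x)"
proof -
  have bl: "bounded_linear g'" using g by (rule has_derivative_bounded_linear)
  then obtain B where B: "\<And>v. norm (g' v) \<le> norm v * B"
    using bounded_linear.bounded by blast
  have g0: "((\<lambda>y. (g y - g' (y - x)) /\<^sub>R norm (y - x)) \<longlongrightarrow> 0) (at x)"
    using g by (simp add: has_derivative_at_within z)
  have c0: "(c \<longlongrightarrow> c x) (at x)" using c by (simp add: isCont_def)
  \<comment> \<open>The remainder is split into \<open>c y\<close> times the remainder of
    \<open>g\<close>, plus \<open>c y - c x\<close> times the bounded quotient of
    \<open>g' (y - x)\<close> by \<open>norm (y - x)\<close>.\<close>
  have 1: "((\<lambda>y. c y *\<^sub>R ((g y - g' (y - x)) /\<^sub>R norm (y - x))) \<longlongrightarrow> 0) (at x)"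
    using tendsto_scaleR[OF c0 g0] by simp
  have c1: "((\<lambda>y. c y - c x) \<longlongrightarrow> 0) (at x)" using c0 by (simp add: LIM_zero)
  have 2: "((\<lambda>y. (c y - c x) *\<^sub>R (g' (y - x) /\<^sub>R norm (y - x))) \<longlongrightarrow> 0) (at x)"
  proof (rule tendsto_0_le[OF c1, where K = B])
    have "norm (g' (y - x) /\<^sub>R norm (y - x)) \<le> B" if "y \<noteq> x" for y
      using B[of "y - x"] that by (simp add: divide_simps mult.commute)
    then have "norm ((c y - c x) *\<^sub>R (g' (y - x) /\<^sub>R norm (y - x))) \<le> norm (c y - c x) * B" if "y \<noteq> x" for y
      unfolding norm_scaleR[of "c y - c x"] real_norm_def using that by (intro mult_left_mono) auto
    then show "\<forall>\<^sub>F y in at x. norm ((c y - c x) *\<^sub>R (g' (y - x) /\<^sub>R norm (y - x))) \<le> norm (c y - c x) * B"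
      by (simp add: eventually_at_filter)
  qed
  have "((\<lambda>y. (c y *\<^sub>R g y - c x *\<^sub>R g' (y - x)) /\<^sub>R norm (y - x)) \<longlongrightarrow> 0) (at x)"
    using tendsto_add[OF 1 2] by (simp add: algebra_simps)
  then show ?thesis
    using bl by (simp add: has_derivative_at_within z bounded_linear_scaleR_right[THEN bounded_linear_compose])
qed

text \<open>With \<open>a\<^sub>x = L\<^sub>x\<^sup>-\<^sup>1 w\<close>, the inverse is differentiated through \<open>a\<^sub>x = L\<^sub>0\<^sup>-\<^sup>1 (w - (L\<^sub>x - L\<^sub>0) a\<^sub>x)\<close>: as \<open>L\<^sub>x - L\<^sub>0\<close>
  vanishes at the base point, the factor \<open>a\<^sub>x\<close> on the right need only be continuous.\<close>

lemma inverse_family: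
  fixes L :: "'a::real_normed_vector \<Rightarrow> 'b::euclidean_space \<Rightarrow> 'b"
  assumes S: "open S" and lin: "\<And>x. x \<in> S \<Longrightarrow> linear (L x)" and inj: "\<And>x. x \<in> S \<Longrightarrow> inj (L x)"
  shows inverse_family_continuous: "(\<And>u. continuous_on S (\<lambda>x. L x u)) \<Longrightarrow>
      continuous_on S (\<lambda>x. inv (L x) w)"
    and inverse_family_has_derivative: "(\<And>u. continuous_on S (\<lambda>x. L x u)) \<Longrightarrow> x0 \<in> S \<Longrightarrow>
      (\<And>u. ((\<lambda>x. L x u) has_derivative L' u) (at x0)) \<Longrightarrow>
      ((\<lambda>x. inv (L x) w) has_derivative (\<lambda>v. - inv (L x0) (L' (inv (L x0) w) v))) (at x0)"
proof -
  have LM: "L x (inv (L x) w) = w" if "x \<in> S" for x w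
    using linear_injective_imp_surjective[OF lin[OF that] inj[OF that]] surj_f_inv_f by metis
  have MLx: "inv (L x) (L x w) = w" if "x \<in> S" for x w
    by (simp add: inj that)
  show cont: "continuous_on S (\<lambda>x. inv (L x) w)" if C: "\<And>u. continuous_on S (\<lambda>x. L x u)" for w
  proof (intro continuous_at_imp_continuous_on ballI)
    fix x0 assume x0: "x0 \<in> S"
    obtain B where B: "B > 0" "\<And>u. B * norm u \<le> norm (L x0 u)"
      using linear_inj_bounded_below_pos[OF lin[OF x0] inj[OF x0]] by blast
    have Cx: "isCont (\<lambda>x. L x u) x0" for u
      using C S x0 continuous_on_eq_continuous_at by blast
    \<comment> \<open>Once the images of the basis vectors differ in total by less than
      \<open>B / 2\<close>, the operators differ by at most \<open>B / 2\<close>. Half of the lower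
      bound of \<open>L x0\<close> then survives for \<open>L x\<close>, which bounds the inverses
      uniformly near \<open>x0\<close>.\<close>
    have t: "((\<lambda>x. \<Sum>b\<in>Basis. norm (L x b - L x0 b)) \<longlongrightarrow> (\<Sum>b\<in>Basis. norm (L x0 b - L x0 b))) (at x0)"
      using Cx by (intro tendsto_sum tendsto_norm tendsto_diff) (auto simp: isCont_def)
    then have "\<forall>\<^sub>F x in at x0. (\<Sum>b\<in>Basis. norm (L x b - L x0 b)) < B / 2"
      using B(1) by (intro order_tendstoD(2)[OF t]) auto
    moreover have "\<forall>\<^sub>F x in at x0. x \<in> S"
      using S x0 eventually_at_topological by blast
    ultimately have ev: "\<forall>\<^sub>F x in at x0. norm (inv (L x) w - inv (L x0) w) \<le> norm (L x (inv (L x0) w) - w) * (2 / B)"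
    proof eventually_elim
      case (elim x)
      have d: "norm (L x u - L x0 u) \<le> B / 2 * norm u" for u
      proof -
        have "linear (\<lambda>u. L x u - L x0 u)"
          using lin[OF elim(2)] lin[OF x0] by (intro linear_compose_sub)
        from linear_basis_expansion[OF this, of u]
        have "norm (L x u - L x0 u) \<le> (\<Sum>b\<in>Basis. norm ((u \<bullet> b) *\<^sub>R (L x b - L x0 b)))"
          by (simp only: norm_sum)
        also have "\<dots> \<le> (\<Sum>b\<in>Basis. norm (L x b - L x0 b) * norm u)"
          by (intro sum_mono) (simp add: Basis_le_norm mult.commute[of _ "norm u"] mult_right_mono)
        also have "\<dots> \<le> B / 2 * norm u"
          unfolding sum_distrib_right[symmetric] using elim(1) by (intro mult_right_mono) auto
        finally show ?thesis .
      qed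
      have low: "B / 2 * norm u \<le> norm (L x u)" for u
        using B(2)[of u] d[of u] norm_triangle_ineq2[of "L x0 u" "L x u"] by (simp add: norm_minus_commute)
      have "L x (inv (L x) w - inv (L x0) w) = w - L x (inv (L x0) w)"
        by (simp add: linear_diff[OF lin[OF elim(2)]] LM elim)
      with low[of "inv (L x) w - inv (L x0) w"] B(1) show ?case
        by (simp add: norm_minus_commute field_simps)
    qed
    have "((\<lambda>x. norm (L x (inv (L x0) w) - w)) \<longlongrightarrow> norm (L x0 (inv (L x0) w) - w)) (at x0)"
      using Cx by (intro tendsto_norm tendsto_diff) (auto simp: isCont_def)
    then have "((\<lambda>x. norm (L x (inv (L x0) w) - w)) \<longlongrightarrow> 0) (at x0)"
      by (simp add: LM x0)
    then have "((\<lambda>x. inv (L x) w - inv (L x0) w) \<longlongrightarrow> 0) (at x0)"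
      by (rule tendsto_0_le[where K = "2 / B"]) (use ev in simp)
    then show "isCont (\<lambda>x. inv (L x) w) x0"
      by (simp add: isCont_def LIM_zero_iff)
  qed
  assume C: "\<And>u. continuous_on S (\<lambda>x. L x u)" and x0: "x0 \<in> S"
    and D: "\<And>u. ((\<lambda>x. L x u) has_derivative L' u) (at x0)"
  let ?a = "\<lambda>x. inv (L x) w"
  let ?M = "inv (L x0)"
  have linM: "linear ?M"
    by (rule inj_linear_imp_inv_linear[OF lin[OF x0] inj[OF x0]])
  have ca: "isCont ?a x0" using cont[OF C] S x0 continuous_on_eq_continuous_at by blast
  let ?G = "\<lambda>x. \<Sum>b\<in>Basis. (?a x \<bullet> b) *\<^sub>R (L x b - L x0 b)"
  have G: "(?G has_derivative (\<lambda>v. \<Sum>b\<in>Basis. (?a x0 \<bullet> b) *\<^sub>R (L' b v - 0))) (at x0)"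
    by (intro has_derivative_sum has_derivative_scaleR_continuous_zero has_derivative_diff D has_derivative_const)
      (use ca in auto)
  have e: "?M (w - ?G x) = ?a x" if "x \<in> S" for x
  proof -
    have "linear (\<lambda>u. L x u - L x0 u)"
      using lin[OF that] lin[OF x0] by (intro linear_compose_sub)
    from linear_basis_expansion[OF this, of "?a x"] have "?G x = L x (?a x) - L x0 (?a x)" by simp
    then show ?thesis by (simp add: LM MLx that x0)
  qed
  have "((\<lambda>x. ?M (w - ?G x)) has_derivative
     (\<lambda>v. ?M (0 - (\<Sum>b\<in>Basis. (?a x0 \<bullet> b) *\<^sub>R (L' b v - 0))))) (at x0)"
    using linM by (intro bounded_linear.has_derivative[of ?M] has_derivative_diff has_derivative_const G)
      (simp add: linear_conv_bounded_linear)
  from has_derivative_transform_within_open[OF this S x0 e]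
  have R: "(?a has_derivative (\<lambda>v. ?M (0 - (\<Sum>b\<in>Basis. (?a x0 \<bullet> b) *\<^sub>R (L' b v - 0))))) (at x0)" .
  have "((\<lambda>y. L y (?a x0)) has_derivative (\<lambda>v. \<Sum>b\<in>Basis. (?a x0 \<bullet> b) *\<^sub>R L' b v)) (at x0)"
    by (rule has_derivative_transform_within_open[OF _ S x0, of "\<lambda>y. \<Sum>b\<in>Basis. (?a x0 \<bullet> b) *\<^sub>R L y b"])
      (use linear_basis_expansion[OF lin] D in \<open>auto intro!: has_derivative_sum has_derivative_scaleR_right\<close>)
  then have 3: "L' (?a x0) = (\<lambda>v. \<Sum>b\<in>Basis. (?a x0 \<bullet> b) *\<^sub>R L' b v)"
    using D has_derivative_unique by blast
  show "(?a has_derivative (\<lambda>v. - ?M (L' (?a x0) v))) (at x0)"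
    using R by (simp add: 3 linear_neg[OF linM])
qed

text \<open>The derivative of the inverse is built from derivatives of \<open>L\<close> and from the
  inverse itself, undifferentiated; its class therefore rises by one in each step of the
  induction.\<close>

lemma Ck_on_inverse_family:
  fixes L :: "'a::real_normed_vector \<Rightarrow> 'b::euclidean_space \<Rightarrow> 'b"
  assumes S: "open S" and lin: "\<And>x. x \<in> S \<Longrightarrow> linear (L x)" and inj: "\<And>x. x \<in> S \<Longrightarrow> inj (L x)"
  shows "(\<And>u. Ck_on k S (\<lambda>x. L x u)) \<Longrightarrow> Ck_on k S (\<lambda>x. inv (L x) w)"
proof (induction k arbitrary: w)
  case 0
  then show ?case using inverse_family_continuous[OF S lin inj] by simp
next
  case (Suc k)
  have IH: "Ck_on k S (\<lambda>x. inv (L x) w)" for w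
    using Suc Ck_on_Suc_imp by blast
  have linM: "linear (inv (L x))" if "x \<in> S" for x
    by (rule inj_linear_imp_inv_linear[OF lin[OF that] inj[OF that]])
  let ?D = "\<lambda>u x v. frechet_derivative (\<lambda>x. L x u) (at x) v"
  have D: "((\<lambda>x. L x u) has_derivative ?D u x) (at x)" if "x \<in> S" for u x
    using Ck_on_Suc_has_derivative[OF Suc.prems that] .
  show ?case
  proof (rule Ck_on_SucI[OF S])
    show "((\<lambda>x. inv (L x) w) has_derivative (\<lambda>v. - inv (L x) (?D (inv (L x) w) x v))) (at x)"
      if "x \<in> S" for x
      using inverse_family_has_derivative[OF S lin inj Ck_on_imp_continuous_on[OF Suc.prems] that D[OF that]] .
    fix v
    have "Ck_on k S (\<lambda>x. inv (L x) (?D (inv (L x) w) x v))"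
    proof (rule Ck_on_family_apply[OF S linM IH])
      show "Ck_on k S (\<lambda>x. ?D (inv (L x) w) x v)"
      proof (rule Ck_on_family_apply[OF S _ _ IH])
        show "Ck_on k S (\<lambda>x. ?D u x v)" for u
          using Suc.prems by simp
        fix x assume x: "x \<in> S"
        have "((\<lambda>y. L y (a + b)) has_derivative (\<lambda>v. ?D a x v + ?D b x v)) (at x)" for a b
          by (rule has_derivative_transform_within_open[OF _ S x, of "\<lambda>y. L y a + L y b"])
            (auto intro!: has_derivative_add D x simp: linear_add lin)
        moreover have "((\<lambda>y. L y (r *\<^sub>R a)) has_derivative (\<lambda>v. r *\<^sub>R ?D a x v)) (at x)" for r a
          by (rule has_derivative_transform_within_open[OF _ S x, of "\<lambda>y. r *\<^sub>R L y a"])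
            (auto intro!: has_derivative_scaleR_right D x simp: linear_scale lin)
        ultimately show "linear (\<lambda>u. ?D u x v)"
          by (intro linearI) (metis frechet_derivativeI)+
      qed
    qed
    from Ck_on_bounded_linear[OF bounded_linear_minus[OF bounded_linear_ident] this S]
    show "Ck_on k S (\<lambda>x. - inv (L x) (?D (inv (L x) w) x v))" .
  qed
qed

text \<open>Bootstrapping: the derivative of \<open>g\<close> is the inverse of the derivative of
  \<open>f\<close> along \<open>g\<close>, hence as regular as \<open>g\<close> itself. The inverse
  function theorem supplies the first derivative, this lemma all others.\<close>

lemma Ck_on_inverse_function:
  fixes f :: "'a::euclidean_space \<Rightarrow> 'a"
  assumes "open U" "open V" "g ` V \<subseteq> U" "continuous_on V g"
    and f: "smooth_on U f"
    and g: "\<And>y. y \<in> V \<Longrightarrow> (g has_derivative inv (frechet_derivative f (at (g y)))) (at y)"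
    and inj: "\<And>y. y \<in> V \<Longrightarrow> inj (frechet_derivative f (at (g y)))"
  shows "Ck_on k V g"
proof (induction k)
  case 0
  then show ?case using assms by simp
next
  case (Suc k)
  have f1: "Ck_on (Suc k) U f" for k using f by (simp add: smooth_on_def del: Ck_on.simps)
  show ?case
  proof (rule Ck_on_SucI[OF assms(2) g])
    show "Ck_on k V (\<lambda>y. inv (frechet_derivative f (at (g y))) v)" for v
    proof (rule Ck_on_inverse_family[OF assms(2) _ inj])
      show "linear (frechet_derivative f (at (g y)))" if "y \<in> V" for y
        using f1[of 0] that assms(3) by (auto intro: linear_frechet_derivative)
      show "Ck_on k V (\<lambda>y. frechet_derivative f (at (g y)) u)" for u
        using Ck_on_compose[OF assms(2,1,3) _ Suc, of "\<lambda>x. frechet_derivative f (at x) u"] f1[of k]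
        by (auto simp: o_def)
    qed
  qed
qed

section \<open>Smooth functions and symmetry of second derivatives\<close>

lemma smooth_onD: "smooth_on S f \<Longrightarrow> x \<in> S \<Longrightarrow> (f has_derivative frechet_derivative f (at x)) (at x)"
  unfolding smooth_on_def by (metis Ck_on_Suc_has_derivative)

lemma smooth_on_derivative: "smooth_on S f \<Longrightarrow> smooth_on S (\<lambda>x. frechet_derivative f (at x) v)"
  unfolding smooth_on_def by (metis Ck_on.simps(2))

lemma smooth_on_imp_continuous_on: "smooth_on S f \<Longrightarrow> continuous_on S f"
  unfolding smooth_on_def by (metis Ck_on_imp_continuous_on)

text \<open>Mixed second derivatives in either order are limits of the same second difference quotients.\<close>

lemma smooth_on_line_derivative:
  fixes f :: "'a::real_normed_vector \<Rightarrow> real"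
  assumes f: "smooth_on S f" and S: "y + a *\<^sub>R u \<in> S"
  shows "((\<lambda>a. f (y + a *\<^sub>R u)) has_real_derivative frechet_derivative f (at (y + a *\<^sub>R u)) u) (at a)"
proof (rule has_derivative_imp_has_field_derivative)
  have "((\<lambda>a. y + a *\<^sub>R u) has_derivative (\<lambda>h. h *\<^sub>R u)) (at a)"
    by (auto intro!: derivative_eq_intros)
  from diff_chain_at[OF this smooth_onD[OF f S]]
  show "((\<lambda>a. f (y + a *\<^sub>R u)) has_derivative (\<lambda>h. frechet_derivative f (at (y + a *\<^sub>R u)) (h *\<^sub>R u))) (at a)"
    by (simp add: o_def)
  show "h * frechet_derivative f (at (y + a *\<^sub>R u)) u = frechet_derivative f (at (y + a *\<^sub>R u)) (h *\<^sub>R u)" for h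
    using linear_frechet_derivative[OF differentiableI[OF smooth_onD[OF f S]]]
    by (simp add: linear_scale)
qed

text \<open>The mean value theorem is used twice, first along \<open>u\<close> on the difference
  taken along \<open>v\<close>, then along \<open>v\<close> on the derivative. The mixed derivative
  appears exactly, at an unknown point of the parallelogram, so its continuity controls the
  limit.\<close>

lemma second_difference_mean_value:
  fixes f :: "'a::real_normed_vector \<Rightarrow> real"
  assumes f: "smooth_on S f" and s: "0 < s"
    and sub: "\<And>a b. 0 \<le> a \<Longrightarrow> a \<le> s \<Longrightarrow> 0 \<le> b \<Longrightarrow> b \<le> s \<Longrightarrow> x + a *\<^sub>R u + b *\<^sub>R v \<in> S"
  shows "\<exists>a b. 0 \<le> a \<and> a \<le> s \<and> 0 \<le> b \<and> b \<le> s \<and>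
    f (x + s *\<^sub>R u + s *\<^sub>R v) - f (x + s *\<^sub>R u) - f (x + s *\<^sub>R v) + f x =
    s * s * frechet_derivative (\<lambda>y. frechet_derivative f (at y) u) (at (x + a *\<^sub>R u + b *\<^sub>R v)) v"
proof -
  let ?D = "\<lambda>y. frechet_derivative f (at y) u"
  have D1: "((\<lambda>a. f (x + a *\<^sub>R u + b *\<^sub>R v)) has_real_derivative ?D (x + a *\<^sub>R u + b *\<^sub>R v)) (at a)"
    if "0 \<le> a" "a \<le> s" "0 \<le> b" "b \<le> s" for a b
    using smooth_on_line_derivative[OF f, of "x + b *\<^sub>R v" a u] sub[OF that]
    unfolding add.assoc add.commute[of "b *\<^sub>R v"] .
  have D2: "((\<lambda>b. ?D (x + a *\<^sub>R u + b *\<^sub>R v)) has_real_derivative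
      frechet_derivative ?D (at (x + a *\<^sub>R u + b *\<^sub>R v)) v) (at b)"
    if "0 \<le> a" "a \<le> s" "0 \<le> b" "b \<le> s" for a b
    using smooth_on_line_derivative[OF smooth_on_derivative[OF f] sub[OF that]] .
  \<comment> \<open>Writing \<open>0 *\<^sub>R v\<close> makes both terms instances of
    \<open>D1\<close>.\<close>
  let ?g = "\<lambda>a. f (x + a *\<^sub>R u + s *\<^sub>R v) - f (x + a *\<^sub>R u + 0 *\<^sub>R v)"
  have g: "(?g has_real_derivative (?D (x + a *\<^sub>R u + s *\<^sub>R v) - ?D (x + a *\<^sub>R u + 0 *\<^sub>R v))) (at a)"
    if "0 \<le> a" "a \<le> s" for a
    using that s by (intro DERIV_diff D1) auto
  obtain a where a: "0 < a" "a < s"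
    "?g s - ?g 0 = (s - 0) * (?D (x + a *\<^sub>R u + s *\<^sub>R v) - ?D (x + a *\<^sub>R u + 0 *\<^sub>R v))"
    using MVT2[OF s g] by blast
  have h: "((\<lambda>b. ?D (x + a *\<^sub>R u + b *\<^sub>R v)) has_real_derivative
      frechet_derivative ?D (at (x + a *\<^sub>R u + b *\<^sub>R v)) v) (at b)" if "0 \<le> b" "b \<le> s" for b
    using D2[of a b] a that by simp
  obtain b where b: "0 < b" "b < s"
    "?D (x + a *\<^sub>R u + s *\<^sub>R v) - ?D (x + a *\<^sub>R u + 0 *\<^sub>R v) =
      (s - 0) * frechet_derivative ?D (at (x + a *\<^sub>R u + b *\<^sub>R v)) v"
    using MVT2[OF s h] by blast
  show ?thesis
    using a b by (intro exI[of _ a] exI[of _ b]) auto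
qed

lemma symmetric_second_derivative_real:
  fixes f :: "'a::real_normed_vector \<Rightarrow> real"
  assumes S: "open S" "x \<in> S" and f: "smooth_on S f"
  shows "frechet_derivative (\<lambda>y. frechet_derivative f (at y) u) (at x) v =
    frechet_derivative (\<lambda>y. frechet_derivative f (at y) v) (at x) u"
proof -
  let ?A = "\<lambda>y. frechet_derivative (\<lambda>y. frechet_derivative f (at y) u) (at y) v"
  let ?B = "\<lambda>y. frechet_derivative (\<lambda>y. frechet_derivative f (at y) v) (at y) u"
  have cont: "isCont ?A x" "isCont ?B x"
    using f S smooth_on_derivative smooth_on_imp_continuous_on continuous_on_eq_continuous_at by blast+
  obtain r where r: "r > 0" "ball x r \<subseteq> S" using S open_contains_ball by blast
  \<comment> \<open>Points of the parallelogram with sides s u and s v lie within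
    \<open>s * M\<close> of \<open>x\<close>; the summand 1 keeps \<open>M\<close> positive for
    \<open>u = v = 0\<close>.\<close>
  define M where "M = norm u + norm v + 1"
  have M: "M > 0" by (simp add: M_def add_nonneg_pos)
  have near: "dist (x + a *\<^sub>R u + b *\<^sub>R v) x < e" if "0 \<le> a" "a \<le> s" "0 \<le> b" "b \<le> s" "s * M < e" "0 < s" for a b s e
  proof -
    have "dist (x + a *\<^sub>R u + b *\<^sub>R v) x = norm (a *\<^sub>R u + b *\<^sub>R v)" by (simp add: dist_norm add.assoc)
    also have "\<dots> \<le> a * norm u + b * norm v" using that norm_triangle_ineq[of "a *\<^sub>R u" "b *\<^sub>R v"] by simp
    also have "\<dots> \<le> s * norm u + s * norm v" using that by (intro add_mono mult_right_mono) auto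
    also have "\<dots> \<le> s * M" using that by (simp add: M_def algebra_simps)
    finally show ?thesis using that by simp
  qed
  have "dist (?A x) (?B x) < e" if e: "e > 0" for e
  proof -
    obtain d1 where d1: "d1 > 0" "\<And>y. dist y x < d1 \<Longrightarrow> dist (?A y) (?A x) < e / 2"
      using cont(1) e unfolding continuous_at_eps_delta by (metis half_gt_zero)
    obtain d2 where d2: "d2 > 0" "\<And>y. dist y x < d2 \<Longrightarrow> dist (?B y) (?B x) < e / 2"
      using cont(2) e unfolding continuous_at_eps_delta by (metis half_gt_zero)
    define d where "d = min r (min d1 d2)"
    have d: "d > 0" using r d1 d2 by (simp add: d_def)
    define s where "s = d / (2 * M)"
    have s: "s > 0" "s * M < d" using d M by (auto simp: s_def)
    have inS: "y \<in> S" if "dist y x < d" for y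
      using that r by (auto simp: d_def dist_commute)
    obtain a b where ab: "0 \<le> a" "a \<le> s" "0 \<le> b" "b \<le> s"
      "f (x + s *\<^sub>R u + s *\<^sub>R v) - f (x + s *\<^sub>R u) - f (x + s *\<^sub>R v) + f x = s * s * ?A (x + a *\<^sub>R u + b *\<^sub>R v)"
      using second_difference_mean_value[OF f s(1), of x u v] inS near s by blast
    have near': "x + a *\<^sub>R v + b *\<^sub>R u = x + b *\<^sub>R u + a *\<^sub>R v" for a b
      by (simp add: algebra_simps)
    obtain a' b' where ab': "0 \<le> a'" "a' \<le> s" "0 \<le> b'" "b' \<le> s"
      "f (x + s *\<^sub>R v + s *\<^sub>R u) - f (x + s *\<^sub>R v) - f (x + s *\<^sub>R u) + f x = s * s * ?B (x + a' *\<^sub>R v + b' *\<^sub>R u)"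
      using second_difference_mean_value[OF f s(1), of x v u] inS near s near' by metis
    \<comment> \<open>The second difference is symmetric in \<open>u\<close> and \<open>v\<close>,
      so the two mixed derivatives agree, though at different points close to
      \<open>x\<close>.\<close>
    have "s * s * ?A (x + a *\<^sub>R u + b *\<^sub>R v) = s * s * ?B (x + a' *\<^sub>R v + b' *\<^sub>R u)"
      unfolding ab(5)[symmetric] ab'(5)[symmetric] near'[of s s] by simp
    then have "?A (x + a *\<^sub>R u + b *\<^sub>R v) = ?B (x + b' *\<^sub>R u + a' *\<^sub>R v)"
      using s near' by simp
    moreover have "dist (?A (x + a *\<^sub>R u + b *\<^sub>R v)) (?A x) < e / 2"
      using near[OF ab(1-4) s(2,1)] by (intro d1) (simp add: d_def)
    moreover have "dist (?B (x + b' *\<^sub>R u + a' *\<^sub>R v)) (?B x) < e / 2"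
      using near[OF ab'(3,4,1,2) s(2,1)] by (intro d2) (simp add: d_def)
    ultimately show ?thesis
      by (simp add: dist_norm abs_if split: if_splits)
  qed
  then have "dist (?A x) (?B x) = 0" by (metis less_irrefl zero_less_dist_iff dist_eq_0_iff)
  then show ?thesis by simp
qed

lemma smooth_on_bounded_linear:
  "bounded_linear L \<Longrightarrow> smooth_on S f \<Longrightarrow> open S \<Longrightarrow> smooth_on S (\<lambda>x. L (f x))"
  unfolding smooth_on_def using Ck_on_bounded_linear by blast

lemma frechet_derivative_bounded_linear_compose:
  assumes "bounded_linear L" "smooth_on S f" "x \<in> S"
  shows "frechet_derivative (\<lambda>x. L (f x)) (at x) v = L (frechet_derivative f (at x) v)"
  using frechet_derivativeI[OF bounded_linear.has_derivative[OF assms(1) smooth_onD[OF assms(2,3)]]] by simp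

lemma symmetric_second_derivative:
  fixes f :: "'a::real_normed_vector \<Rightarrow> 'b::euclidean_space"
  assumes S: "open S" "x \<in> S" and f: "smooth_on S f"
  shows "frechet_derivative (\<lambda>y. frechet_derivative f (at y) u) (at x) v =
    frechet_derivative (\<lambda>y. frechet_derivative f (at y) v) (at x) u"
proof (rule euclidean_eqI)
  fix b :: 'b
  let ?L = "\<lambda>z::'b. z \<bullet> b"
  have L: "bounded_linear ?L" by (rule bounded_linear_inner_left)
  have "frechet_derivative (\<lambda>y. frechet_derivative f (at y) u) (at x) v \<bullet> b =
    frechet_derivative (\<lambda>y. frechet_derivative (\<lambda>y. ?L (f y)) (at y) u) (at x) v" for u v
  proof -
    have "((\<lambda>y. frechet_derivative (\<lambda>y. ?L (f y)) (at y) u) has_derivative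
      (\<lambda>v. ?L (frechet_derivative (\<lambda>y. frechet_derivative f (at y) u) (at x) v))) (at x)"
      by (rule has_derivative_transform_within_open[OF
            bounded_linear.has_derivative[OF L smooth_onD[OF smooth_on_derivative[OF f] S(2)]] S])
        (simp add: frechet_derivative_bounded_linear_compose[OF L f])
    then show ?thesis using frechet_derivativeI by metis
  qed
  then show "frechet_derivative (\<lambda>y. frechet_derivative f (at y) u) (at x) v \<bullet> b =
    frechet_derivative (\<lambda>y. frechet_derivative f (at y) v) (at x) u \<bullet> b"
    using symmetric_second_derivative_real[OF S smooth_on_bounded_linear[OF L f S(1)]] by simp
qed

section \<open>Zero sets of holomorphic functions of several variables\<close>

text \<open>Real smoothness with the Cauchy-Riemann equations is the form in which the bivector is
  shown to be holomorphic; theorems of one complex variable are applied only on complex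
  lines.\<close>

definition hol_on :: "(complex ^ 'n::finite) set \<Rightarrow> (complex ^ 'n \<Rightarrow> complex) \<Rightarrow> bool" where
  "hol_on U f \<longleftrightarrow> smooth_on U f \<and>
     (\<forall>z\<in>U. \<forall>u. frechet_derivative f (at z) (\<i> *s u) = \<i> * frechet_derivative f (at z) u)"

lemma scaleR_conv_vector_smult: "r *\<^sub>R (u :: complex ^ 'n) = complex_of_real r *s u"
  unfolding vec_eq_iff vector_smult_component vector_scaleR_component by (simp add: scaleR_conv_of_real)

lemma linear_i_imp_complex_linear:
  assumes "linear f" "\<And>u. f (\<i> *s u) = \<i> * f u"
  shows "f (c *s (u :: complex ^ 'n)) = c * f u"
proof -
  have "c *s u = Re c *\<^sub>R u + Im c *\<^sub>R (\<i> *s u)"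
    by (simp add: vec_eq_iff complex_eq_iff)
  then have "f (c *s u) = Re c *\<^sub>R f u + Im c *\<^sub>R (\<i> * f u)"
    by (simp only: linear_add[OF assms(1)] linear_scale[OF assms(1)] assms(2))
  also have "\<dots> = c * f u" by (simp add: complex_eq_iff)
  finally show ?thesis .
qed

lemma norm_vector_smult: "norm (c *s (v :: complex ^ 'n)) = norm c * norm v"
  by (simp add: norm_vec_def norm_mult L2_set_right_distrib)

lemma hol_on_subset: "hol_on U f \<Longrightarrow> V \<subseteq> U \<Longrightarrow> hol_on V f"
  unfolding hol_on_def smooth_on_def using Ck_on_subset by blast

lemma hol_on_has_derivative:
  "hol_on U f \<Longrightarrow> z \<in> U \<Longrightarrow> (f has_derivative frechet_derivative f (at z)) (at z)"
  unfolding hol_on_def using smooth_onD by blast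

lemma hol_on_linear: "hol_on U f \<Longrightarrow> z \<in> U \<Longrightarrow> linear (frechet_derivative f (at z))"
  using hol_on_has_derivative has_derivative_linear by blast

lemma hol_on_smult:
  "hol_on U f \<Longrightarrow> z \<in> U \<Longrightarrow> frechet_derivative f (at z) (c *s u) = c * frechet_derivative f (at z) u"
  by (rule linear_i_imp_complex_linear[OF hol_on_linear]) (auto simp: hol_on_def)

lemma hol_on_continuous_on: "hol_on U f \<Longrightarrow> continuous_on U f"
  unfolding hol_on_def by (metis smooth_on_imp_continuous_on)

text \<open>The Cauchy-Riemann equations are differentiated in the direction \<open>v\<close>;
  symmetry of second derivatives turns the result into Cauchy-Riemann equations for the derivative
  along \<open>v\<close>.\<close>

lemma hol_on_derivative:
  fixes f :: "complex ^ 'n::finite \<Rightarrow> complex"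
  assumes U: "open U" and f: "hol_on U f"
  shows "hol_on U (\<lambda>z. frechet_derivative f (at z) v)"
  unfolding hol_on_def
proof (intro conjI ballI allI)
  have sf: "smooth_on U f" using f by (simp add: hol_on_def)
  show "smooth_on U (\<lambda>z. frechet_derivative f (at z) v)"
    by (rule smooth_on_derivative[OF sf])
  fix z u assume z: "z \<in> U"
  have "((\<lambda>y. frechet_derivative f (at y) (\<i> *s u)) has_derivative
      (\<lambda>w. \<i> * frechet_derivative (\<lambda>y. frechet_derivative f (at y) u) (at z) w)) (at z)"
    by (rule has_derivative_transform_within_open[OF
          has_derivative_mult_right[OF smooth_onD[OF smooth_on_derivative[OF sf] z]] U z])
      (use f in \<open>simp add: hol_on_def\<close>)
  then have "frechet_derivative (\<lambda>y. frechet_derivative f (at y) (\<i> *s u)) (at z) v =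
      \<i> * frechet_derivative (\<lambda>y. frechet_derivative f (at y) u) (at z) v"
    using frechet_derivativeI by metis
  then show "frechet_derivative (\<lambda>z. frechet_derivative f (at z) v) (at z) (\<i> *s u) =
      \<i> * frechet_derivative (\<lambda>z. frechet_derivative f (at z) v) (at z) u"
    by (simp only: symmetric_second_derivative[OF U z sf, of v])
qed

lemma hol_on_line:
  assumes f: "hol_on U f" and y: "y + \<zeta> *s v \<in> U"
  shows "((\<lambda>\<zeta>. f (y + \<zeta> *s v)) has_field_derivative frechet_derivative f (at (y + \<zeta> *s v)) v) (at \<zeta>)"
proof (rule has_derivative_imp_has_field_derivative)
  have "bounded_linear (\<lambda>\<zeta>::complex. \<zeta> *s v)"
    by (intro linear_conv_bounded_linear[THEN iffD1] linearI)
      (auto simp: vec_eq_iff algebra_simps)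
  then have "((\<lambda>\<zeta>::complex. \<zeta> *s v) has_derivative (\<lambda>\<zeta>. \<zeta> *s v)) (at \<zeta>)"
    by (rule bounded_linear_imp_has_derivative)
  then have "((\<lambda>\<zeta>. y + \<zeta> *s v) has_derivative (\<lambda>\<zeta>. \<zeta> *s v)) (at \<zeta>)"
    by (auto intro!: derivative_eq_intros)
  from diff_chain_at[OF this hol_on_has_derivative[OF f y]]
  show "((\<lambda>\<zeta>. f (y + \<zeta> *s v)) has_derivative (\<lambda>h. frechet_derivative f (at (y + \<zeta> *s v)) (h *s v))) (at \<zeta>)"
    by (simp add: o_def)
  show "h * frechet_derivative f (at (y + \<zeta> *s v)) v = frechet_derivative f (at (y + \<zeta> *s v)) (h *s v)" for h
    by (simp add: hol_on_smult[OF f y])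
qed

lemma continuous_on_line: "continuous_on S (\<lambda>\<zeta>. y + \<zeta> *s (v :: complex ^ 'n::finite))"
proof -
  have "bounded_linear (\<lambda>\<zeta>::complex. \<zeta> *s v)"
    by (intro linear_conv_bounded_linear[THEN iffD1] linearI)
      (auto simp: vec_eq_iff algebra_simps)
  then show ?thesis by (intro continuous_intros linear_continuous_on)
qed

text \<open>Restricting to lines in a fixed direction \<open>v\<close>: if \<open>m\<close> is the least order of vanishing in direction \<open>v\<close>
  attained at a zero of \<open>f\<close>, then the derivative of order \<open>m - 1\<close> vanishes on all zeros of \<open>f\<close> and has a
  nonzero differential where the minimum is attained.\<close>

lemma zero_set_contained_in_smooth_hypersurface:
  fixes f :: "complex ^ 'n::finite \<Rightarrow> complex"
  assumes U: "open U" "convex U" and f: "hol_on U f" and x0: "x0 \<in> U" "f x0 = 0"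
    and z1: "z1 \<in> U" "f z1 \<noteq> 0"
  obtains q h v where "q \<in> U" "f q = 0" "hol_on U h" "frechet_derivative h (at q) v \<noteq> 0"
    "\<And>z. z \<in> U \<Longrightarrow> f z = 0 \<Longrightarrow> h z = 0"
proof -
  \<comment> \<open>On the complex line through \<open>x0\<close> and \<open>z1\<close> the function
    is not identically zero, so by the identity theorem some iterated derivative along
    \<open>v\<close> is nonzero at \<open>x0\<close>. The least order below therefore
    exists.\<close>
  define v where "v = z1 - x0"
  define H where "H j = ((\<lambda>f z. frechet_derivative f (at z) v) ^^ j) f" for j
  have H0: "H 0 = f" and HS: "H (Suc j) = (\<lambda>z. frechet_derivative (H j) (at z) v)" for j
    by (auto simp: H_def)
  have holH: "hol_on U (H j)" for j
    by (induction j) (auto simp: H0 HS f hol_on_derivative U)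
  define S where "S = {\<zeta>. x0 + \<zeta> *s v \<in> U}"
  have "S = (\<lambda>\<zeta>. x0 + \<zeta> *s v) -` U" by (auto simp: S_def)
  then have oS: "open S" using continuous_on_line[of UNIV x0 v] U(1)
    by (metis continuous_on_open_vimage open_UNIV Int_UNIV_right)
  have "convex S"
  proof (rule convexI)
    fix a b s t assume *: "a \<in> S" "b \<in> S" "0 \<le> s" "0 \<le> t" "s + t = (1::real)"
    have "s *\<^sub>R (x0 + a *s v) + t *\<^sub>R (x0 + b *s v) \<in> U"
      using convexD[OF U(2)] * by (auto simp: S_def)
    also have "s *\<^sub>R (x0 + a *s v) + t *\<^sub>R (x0 + b *s v) = (s + t) *\<^sub>R x0 + (s *\<^sub>R a + t *\<^sub>R b) *s v"
      by (simp add: vec_eq_iff algebra_simps)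
    finally show "s *\<^sub>R a + t *\<^sub>R b \<in> S" using * by (simp add: S_def)
  qed
  then have cS: "connected S" by (rule convex_connected)
  have S01: "0 \<in> S" "1 \<in> S" using x0 z1 by (auto simp: S_def v_def)
  let ?\<phi> = "\<lambda>\<zeta>. f (x0 + \<zeta> *s v)"
  have line: "((\<lambda>\<zeta>. H j (x0 + \<zeta> *s v)) has_field_derivative H (Suc j) (x0 + \<zeta> *s v)) (at \<zeta>)"
    if "\<zeta> \<in> S" for j \<zeta>
    using hol_on_line[OF holH, of x0 \<zeta> v j] that by (simp add: HS S_def)
  have dd: "(deriv ^^ j) ?\<phi> \<zeta> = H j (x0 + \<zeta> *s v)" if "\<zeta> \<in> S" for j \<zeta>
    using that
  proof (induction j arbitrary: \<zeta>)
    case (Suc j)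
    have "((deriv ^^ j) ?\<phi> has_field_derivative H (Suc j) (x0 + \<zeta> *s v)) (at \<zeta>)"
      by (rule has_field_derivative_transform_within_open[OF line[OF Suc.prems] oS Suc.prems])
        (use Suc.IH in auto)
    then show ?case by (simp add: DERIV_imp_deriv)
  qed (simp add: H0)
  have "\<exists>k. H k x0 \<noteq> 0"
  proof (rule ccontr)
    assume "\<not> (\<exists>k. H k x0 \<noteq> 0)"
    then have z: "(deriv ^^ k) ?\<phi> 0 = 0" for k using dd[OF S01(1)] by simp
    have "?\<phi> holomorphic_on S"
      using line[of _ 0] oS by (auto simp: holomorphic_on_open H0)
    from holomorphic_fun_eq_0_on_connected[OF this oS cS z S01(1) S01(2)]
    show False using z1 by (simp add: v_def)
  qed
  then have ex: "\<exists>k. \<exists>q\<in>U. f q = 0 \<and> H k q \<noteq> 0" using x0 by blast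
  define m where "m = (LEAST k. \<exists>q\<in>U. f q = 0 \<and> H k q \<noteq> 0)"
  obtain q where q: "q \<in> U" "f q = 0" "H m q \<noteq> 0"
    using LeastI_ex[OF ex] unfolding m_def by blast
  \<comment> \<open>\<open>H 0\<close> is \<open>f\<close>, which vanishes at \<open>q\<close>; so
    the least order is positive and a derivative of one order less is available.\<close>
  then have "m \<noteq> 0" by (metis H0)
  then obtain m' where m: "m = Suc m'" by (metis not0_implies_Suc)
  have h_zero: "H m' z = 0" if "z \<in> U" "f z = 0" for z
    using not_less_Least[of m' "\<lambda>k. \<exists>q\<in>U. f q = 0 \<and> H k q \<noteq> 0"] that m unfolding m_def by auto
  show ?thesis
    by (rule that[OF q(1,2) holH[of m'] _ h_zero]) (use q(3) in \<open>simp add: m HS\<close>)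
qed

text \<open>If \<open>f\<close> had no zero on a line through a zero of \<open>h\<close> near \<open>q\<close>, the minimum modulus principle would bound
  \<open>f\<close> away from \<open>0\<close> there, contradicting \<open>f q = 0\<close>.\<close>

lemma zero_set_eq_smooth_hypersurface:
  fixes f :: "complex ^ 'n::finite \<Rightarrow> complex"
  assumes U: "open U" and f: "hol_on U f" and h: "hol_on U h" and q: "q \<in> U" "f q = 0"
    and v: "frechet_derivative h (at q) v \<noteq> 0"
    and sub: "\<And>z. z \<in> U \<Longrightarrow> f z = 0 \<Longrightarrow> h z = 0"
  obtains W where "open W" "q \<in> W" "W \<subseteq> U" "\<And>z. z \<in> W \<Longrightarrow> f z = 0 \<longleftrightarrow> h z = 0"
proof -
  define c where "c = frechet_derivative h (at q) v"
  have c: "norm c > 0" using v by (simp add: c_def)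
  have "isCont (\<lambda>z. frechet_derivative h (at z) v) q"
    using hol_on_continuous_on[OF hol_on_derivative[OF U h]] U q(1) continuous_on_eq_continuous_at by blast
  then obtain e1 where e1: "e1 > 0"
    "\<And>z. dist z q < e1 \<Longrightarrow> dist (frechet_derivative h (at z) v) c < norm c / 2"
    using c unfolding continuous_at_eps_delta c_def by (metis half_gt_zero)
  obtain e2 where e2: "e2 > 0" "cball q e2 \<subseteq> U" using U q open_contains_cball by blast
  define e where "e = min e1 e2"
  have e: "e > 0" "ball q e \<subseteq> U" "cball q e \<subseteq> U" using e1 e2 by (auto simp: e_def)
  \<comment> \<open>On the ball the slope of \<open>h\<close> along \<open>v\<close> stays within
    \<open>norm c / 2\<close> of \<open>c\<close>, so \<open>h\<close> has at most one zero on each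
    line in this direction.\<close>
  have nz: "h (y + \<zeta> *s v) \<noteq> 0" if y: "y \<in> ball q e" "h y = 0" and \<zeta>: "y + \<zeta> *s v \<in> ball q e" "\<zeta> \<noteq> 0" for y \<zeta>
  proof -
    let ?T = "closed_segment 0 \<zeta>"
    have inb: "y + t *s v \<in> ball q e" if "t \<in> ?T" for t
    proof -
      obtain s where s: "0 \<le> s" "s \<le> 1" "t = s *\<^sub>R \<zeta>"
        using \<open>t \<in> ?T\<close> by (auto simp: in_segment)
      have "(1 - s) *\<^sub>R y + s *\<^sub>R (y + \<zeta> *s v) \<in> ball q e"
        using convexD[OF convex_ball y(1) \<zeta>(1), of "1 - s" s] s by simp
      also have "(1 - s) *\<^sub>R y + s *\<^sub>R (y + \<zeta> *s v) = y + t *s v"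
        by (simp add: s vec_eq_iff algebra_simps)
      finally show ?thesis .
    qed
    let ?g = "\<lambda>t. h (y + t *s v) - c * t"
    have "norm (?g \<zeta> - ?g 0) \<le> norm c / 2 * norm (\<zeta> - 0)"
    proof (rule field_differentiable_bound[where S = ?T])
      fix t assume t: "t \<in> ?T"
      show "(?g has_field_derivative (frechet_derivative h (at (y + t *s v)) v - c)) (at t within ?T)"
        using inb[OF t] e by (intro DERIV_subset[OF DERIV_diff[OF hol_on_line[OF h]] subset_UNIV])
          (auto intro!: derivative_eq_intros)
      show "norm (frechet_derivative h (at (y + t *s v)) v - c) \<le> norm c / 2"
        using e1(2)[of "y + t *s v"] inb[OF t] by (auto simp: e_def dist_norm norm_minus_commute)
    qed auto
    then have "norm (h (y + \<zeta> *s v) - c * \<zeta>) \<le> norm c / 2 * norm \<zeta>" by (simp add: y)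
    moreover have "norm c / 2 * norm \<zeta> < norm (c * \<zeta>)" using c \<zeta>(2) by (simp add: norm_mult)
    ultimately show ?thesis by auto
  qed
  \<comment> \<open>For parameters of modulus at most \<open>r\<close> the shift along
    \<open>v\<close> has length at most \<open>e / 4\<close>, so points within \<open>e / 2\<close>
    of \<open>q\<close> stay in \<open>ball q e\<close>; the summand 1 keeps the denominator
    positive.\<close>
  define r where "r = e / (4 * (norm v + 1))"
  have nv: "norm v + 1 > 0" by (simp add: add_nonneg_pos)
  have r: "r > 0" using e nv by (simp add: r_def)
  have rv: "norm (\<zeta> *s v) < e / 2" if "norm \<zeta> \<le> r" for \<zeta>
  proof -
    have "norm (\<zeta> *s v) \<le> r * (norm v + 1)"
      unfolding norm_vector_smult using that r by (intro mult_mono) auto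
    also have "\<dots> = e / 4" using nv by (simp add: r_def divide_simps)
    finally show ?thesis using e by simp
  qed
  have inb: "y + \<zeta> *s v \<in> ball q e" if "dist y q < e / 2" "norm \<zeta> \<le> r" for y \<zeta>
  proof -
    have "dist (y + \<zeta> *s v) q \<le> dist y q + norm (\<zeta> *s v)"
      by (simp add: dist_norm) (metis add_diff_eq add.commute norm_triangle_ineq diff_add_eq)
    then show ?thesis using that rv[OF that(2)] by (simp add: dist_commute)
  qed
  have contf: "continuous_on (cball q e) f"
    using hol_on_continuous_on[OF f] e continuous_on_subset by blast
  have "compact ((\<lambda>\<zeta>. norm (f (q + \<zeta> *s v))) ` sphere 0 r)"
    using inb[of q] e by (intro compact_continuous_image continuous_on_norm
        continuous_on_compose2[OF contf continuous_on_line] compact_sphere) (auto simp: subset_iff less_imp_le)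
  moreover have "f (q + \<zeta> *s v) \<noteq> 0" if "norm \<zeta> = r" for \<zeta>
  proof -
    have "h (q + \<zeta> *s v) \<noteq> 0" using nz[of q \<zeta>] inb[of q \<zeta>] sub q e r that by auto
    then show ?thesis using sub inb[of q \<zeta>] e that by auto
  qed
  moreover have "sphere (0::complex) r \<noteq> {}" using r by simp
  ultimately obtain \<delta> where \<delta>: "\<delta> > 0" "\<And>\<zeta>. norm \<zeta> = r \<Longrightarrow> norm (f (q + \<zeta> *s v)) \<ge> \<delta>"
  proof -
    assume a: "compact ((\<lambda>\<zeta>. norm (f (q + \<zeta> *s v))) ` sphere 0 r)"
      and b: "\<And>\<zeta>. norm \<zeta> = r \<Longrightarrow> f (q + \<zeta> *s v) \<noteq> 0" and n: "sphere (0::complex) r \<noteq> {}"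
    obtain s where s: "s \<in> (\<lambda>\<zeta>. norm (f (q + \<zeta> *s v))) ` sphere 0 r"
      "\<forall>t\<in>(\<lambda>\<zeta>. norm (f (q + \<zeta> *s v))) ` sphere 0 r. s \<le> t"
      using compact_attains_inf[OF a] n by blast
    show ?thesis
      by (rule that[of s]) (use s b in auto)
  qed
  \<comment> \<open>The bound \<open>\<delta> / 2\<close> serves twice: on the circle about a nearby
    \<open>y\<close> the modulus of \<open>f\<close> stays at least \<open>\<delta> / 2\<close>,
    whereas \<open>f q = 0\<close> keeps the modulus of \<open>f y\<close> below it.\<close>
  have "uniformly_continuous_on (cball q e) f"
    by (rule compact_uniformly_continuous[OF contf compact_cball])
  then obtain d where d: "d > 0"
    "\<And>x y. x \<in> cball q e \<Longrightarrow> y \<in> cball q e \<Longrightarrow> dist y x < d \<Longrightarrow> dist (f y) (f x) < \<delta> / 2"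
    using \<delta>(1) unfolding uniformly_continuous_on_def by (metis half_gt_zero)
  define W where "W = ball q (min d (e / 2))"
  show ?thesis
  proof (rule that[of W])
    show "open W" "q \<in> W" "W \<subseteq> U" using d e by (auto simp: W_def)
    fix y assume y: "y \<in> W"
    have y': "dist y q < e / 2" "dist y q < d" using y by (auto simp: W_def dist_commute)
    have yU: "y \<in> U" using y \<open>W \<subseteq> U\<close> by blast
    show "f y = 0 \<longleftrightarrow> h y = 0"
    proof
      assume hy: "h y = 0"
      show "f y = 0"
      proof (rule ccontr)
        assume fy: "f y \<noteq> 0"
        have fnz: "f (y + \<zeta> *s v) \<noteq> 0" if "norm \<zeta> \<le> r" for \<zeta>
        proof (cases "\<zeta> = 0")
          case False
          have "h (y + \<zeta> *s v) \<noteq> 0"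
            using nz[of y \<zeta>] inb[OF y'(1) that] y'(1) e(1) hy False by (auto simp: dist_commute)
          then show ?thesis using sub inb[OF y'(1) that] e by auto
        qed (use fy in simp)
        let ?\<psi> = "\<lambda>\<zeta>. inverse (f (y + \<zeta> *s v))"
        have der: "\<exists>D. (?\<psi> has_field_derivative D) (at \<zeta>)" if "norm \<zeta> \<le> r" for \<zeta>
          using DERIV_inverse_fun[OF hol_on_line[OF f] fnz[OF that]] inb[OF y'(1) that] e by blast
        have lowb: "norm (f (y + \<zeta> *s v)) \<ge> \<delta> / 2" if "norm \<zeta> = r" for \<zeta>
        proof -
          have "dist (f (y + \<zeta> *s v)) (f (q + \<zeta> *s v)) < \<delta> / 2"
            using inb[OF y'(1), of \<zeta>] inb[of q \<zeta>] that e y' by (intro d(2)) (auto simp: less_imp_le)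
          then show ?thesis
            using \<delta>(2)[OF that] norm_triangle_ineq2[of "f (q + \<zeta> *s v)" "f (y + \<zeta> *s v)"]
            by (simp add: dist_norm norm_minus_commute)
        qed
        have "norm (?\<psi> 0) \<le> 2 / \<delta>"
        proof (rule maximum_modulus_frontier[where f = ?\<psi> and S = "cball 0 r" and \<xi> = 0])
          show "?\<psi> holomorphic_on interior (cball 0 r)"
            using der by (auto simp: holomorphic_on_open)
          have "continuous_on (cball 0 r) ?\<psi>"
            using der by (intro continuous_at_imp_continuous_on ballI) (auto intro: DERIV_isCont)
          then show "continuous_on (closure (cball 0 r)) ?\<psi>" by simp
          show "norm (?\<psi> \<zeta>) \<le> 2 / \<delta>" if "\<zeta> \<in> frontier (cball 0 r)" for \<zeta>
          proof -
            have "inverse (norm (f (y + \<zeta> *s v))) \<le> inverse (\<delta> / 2)"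
              using that \<delta>(1) r by (intro le_imp_inverse_le lowb) auto
            then show ?thesis by (simp add: norm_inverse)
          qed
        qed (use r in auto)
        then have "inverse (norm (f y)) \<le> 2 / \<delta>" by (simp add: norm_inverse)
        moreover have "norm (f y) > 0" using fy by simp
        ultimately have "norm (f y) \<ge> \<delta> / 2" using \<delta>(1) by (simp add: field_simps)
        moreover have "dist (f y) (f q) < \<delta> / 2" using y' e by (intro d(2)) (auto simp: dist_commute)
        ultimately show False by (simp add: q)
      qed
    qed (use sub yU in blast)
  qed
qed

text \<open>The map slides each point along \<open>w\<close> until its \<open>k\<close>-th
  coordinate is \<open>h\<close>, where \<open>w\<close> is the multiple of \<open>v\<close> with
  \<open>w $ k = 1\<close>. Sliding along \<open>v\<close> rather than along an axis makes the
  nonzero derivative along \<open>v\<close> just what injectivity needs: the \<open>k\<close>-th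
  coordinate shows that a kernel vector is annihilated by the differential of \<open>h\<close>, and
  then it is a multiple of \<open>w\<close>.\<close>

lemma straighten_smooth_hypersurface:
  fixes h :: "complex ^ 'n::finite \<Rightarrow> complex"
  assumes U: "open U" and h: "hol_on U h" and q: "q \<in> U"
    and v: "frechet_derivative h (at q) v \<noteq> 0"
  obtains k and \<Phi> \<Psi> :: "complex ^ 'n \<Rightarrow> complex ^ 'n" and U' V where "open U'" "q \<in> U'" "U' \<subseteq> U" "open V" "homeomorphism U' V \<Phi> \<Psi>"
    "smooth_on U' \<Phi>" "smooth_on V \<Psi>"
    "\<And>z u. z \<in> U' \<Longrightarrow> frechet_derivative \<Phi> (at z) (\<i> *s u) = \<i> *s frechet_derivative \<Phi> (at z) u"
    "\<And>z. \<Phi> z $ k = h z"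
proof -
  have "v \<noteq> 0" using v linear_0[OF hol_on_linear[OF h q]] by auto
  then obtain k where k: "v $ k \<noteq> 0" by (metis vec_eq_iff zero_index)
  define w where "w = (1 / v $ k) *s v"
  have wk: "w $ k = 1" using k by (simp add: w_def)
  have Dw: "frechet_derivative h (at q) w \<noteq> 0"
    using v k by (simp add: w_def hol_on_smult[OF h q])
  define \<Phi> where "\<Phi> z = z + (h z - z $ k) *s w" for z
  have blw: "bounded_linear (\<lambda>\<zeta>::complex. \<zeta> *s w)"
    by (intro linear_conv_bounded_linear[THEN iffD1] linearI) (auto simp: vec_eq_iff algebra_simps)
  have D: "(\<Phi> has_derivative (\<lambda>u. u + (frechet_derivative h (at z) u - u $ k) *s w)) (at z)"
    if "z \<in> U" for z
    unfolding \<Phi>_def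
    by (intro has_derivative_add has_derivative_ident bounded_linear.has_derivative[OF blw]
        has_derivative_diff hol_on_has_derivative[OF h that] bounded_linear_imp_has_derivative bounded_linear_vec_nth)
  have DF: "frechet_derivative \<Phi> (at z) u = u + (frechet_derivative h (at z) u - u $ k) *s w" if "z \<in> U" for z u
    using frechet_derivativeI[OF D[OF that]] by simp
  have smooth: "smooth_on U \<Phi>"
    unfolding smooth_on_def
  proof
    fix m
    have "Ck_on m U (\<lambda>z. h z + (- 1) *\<^sub>R (z $ k))"
      using h U unfolding hol_on_def smooth_on_def
      by (intro Ck_on_add Ck_on_scaleR Ck_on_const Ck_on_linear_self[OF bounded_linear_vec_nth]) blast+
    then have "Ck_on m U (\<lambda>z. (h z - z $ k) *s w)"
      using Ck_on_bounded_linear[OF blw _ U, of m "\<lambda>z. h z - z $ k"] by simp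
    then show "Ck_on m U \<Phi>"
      unfolding \<Phi>_def by (intro Ck_on_add[OF Ck_on_linear_self[OF bounded_linear_ident U] _ U])
  qed
  have cl: "frechet_derivative \<Phi> (at z) (\<i> *s u) = \<i> *s frechet_derivative \<Phi> (at z) u" if "z \<in> U" for z u
    using that by (simp add: DF hol_on_smult[OF h that] vec_eq_iff algebra_simps)
  define f' where "f' z = Blinfun (frechet_derivative \<Phi> (at z))" for z
  have f': "blinfun_apply (f' z) = frechet_derivative \<Phi> (at z)" if "z \<in> U" for z
    unfolding f'_def using smooth_onD[OF smooth that] has_derivative_bounded_linear
    by (intro bounded_linear_Blinfun_apply) blast
  have linq: "linear (frechet_derivative \<Phi> (at q))"
    using smooth_onD[OF smooth q] has_derivative_linear by blast
  have injq: "inj (frechet_derivative \<Phi> (at q))"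
    unfolding linear_injective_0[OF linq]
  proof (intro allI impI)
    fix u assume "frechet_derivative \<Phi> (at q) u = 0"
    then have *: "u + (frechet_derivative h (at q) u - u $ k) *s w = 0" by (simp add: DF q)
    then have "(u + (frechet_derivative h (at q) u - u $ k) *s w) $ k = 0" by simp
    then have h0: "frechet_derivative h (at q) u = 0" by (simp add: wk)
    have u: "u = u $ k *s w"
    proof (subst vec_eq_iff, intro allI)
      fix i
      have "(u + (0 - u $ k) *s w) $ i = 0" using * unfolding h0 by simp
      then have "u $ i - u $ k * w $ i = 0" by simp
      then show "u $ i = (u $ k *s w) $ i" unfolding vector_smult_component by (rule right_minus_eq[THEN iffD1])
    qed
    then have "u $ k * frechet_derivative h (at q) w = 0" using h0 hol_on_smult[OF h q] by metis
    then show "u = 0" using Dw u by simp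
  qed
  obtain g where g: "linear g" "g \<circ> frechet_derivative \<Phi> (at q) = id"
    using linear_injective_left_inverse[OF linq injq] by blast
  have invf: "Blinfun g o\<^sub>L f' q = id_blinfun"
  proof (rule blinfun_eqI)
    show "blinfun_apply (Blinfun g o\<^sub>L f' q) i = blinfun_apply id_blinfun i" for i
      using g by (simp add: f'[OF q] bounded_linear_Blinfun_apply linear_conv_bounded_linear pointfree_idE)
  qed
  have contf: "continuous_on U f'"
  proof (rule continuous_on_blinfun_componentwise)
    show "continuous_on U (\<lambda>z. blinfun_apply (f' z) i)" for i
      using smooth_on_imp_continuous_on[OF smooth_on_derivative[OF smooth]]
      by (simp add: f' cong: continuous_on_cong)
  qed
  have der: "(\<Phi> has_derivative blinfun_apply (f' z)) (at z)" if "z \<in> U" for z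
    using smooth_onD[OF smooth that] by (simp add: f' that)
  show ?thesis
  proof (rule inverse_function_theorem[OF U der contf q invf])
    fix U' V \<Psi> g'
    assume *: "open U'" "U' \<subseteq> U" "q \<in> U'" "open V" "\<Phi> q \<in> V" "homeomorphism U' V \<Phi> \<Psi>"
      "\<And>y. y \<in> V \<Longrightarrow> (\<Psi> has_derivative g' y) (at y)"
      "\<And>y. y \<in> V \<Longrightarrow> g' y = inv (blinfun_apply (f' (\<Psi> y)))"
      "\<And>y. y \<in> V \<Longrightarrow> bij (blinfun_apply (f' (\<Psi> y)))"
    have im: "\<Psi> ` V = U'" and cont: "continuous_on V \<Psi>"
      using *(6) by (auto simp: homeomorphism_def)
    have inU: "\<Psi> y \<in> U" if "y \<in> V" for y using im *(2) that by blast
    have smU': "smooth_on U' \<Phi>"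
      using smooth *(2) Ck_on_subset unfolding smooth_on_def by blast
    have "smooth_on V \<Psi>"
      unfolding smooth_on_def
    proof
      show "Ck_on m V \<Psi>" for m
      proof (rule Ck_on_inverse_function[OF *(1,4) _ cont smU'])
        show "\<Psi> ` V \<subseteq> U'" using im by simp
        show "(\<Psi> has_derivative inv (frechet_derivative \<Phi> (at (\<Psi> y)))) (at y)" if "y \<in> V" for y
          using *(7,8)[OF that] f'[OF inU[OF that]] by simp
        show "inj (frechet_derivative \<Phi> (at (\<Psi> y)))" if "y \<in> V" for y
          using *(9)[OF that] f'[OF inU[OF that]] by (simp add: bij_is_inj)
      qed
    qed
    with * smU' show ?thesis
      by (intro that[of U' V \<Phi> \<Psi> k]) (auto simp: cl subset_iff \<Phi>_def wk)
  qed
qed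

section \<open>Charts and regular points\<close>

lemma chart_inv_left: "is_chart c \<Longrightarrow> x \<in> fst c \<Longrightarrow> chart_inv c (snd c x) = x"
  by (auto simp: is_chart_def homeomorphism_def)

lemma chart_inv_right: "is_chart c \<Longrightarrow> z \<in> snd c ` fst c \<Longrightarrow> snd c (chart_inv c z) = z"
  by (auto simp: is_chart_def homeomorphism_def)

lemma chart_inv_in: "is_chart c \<Longrightarrow> z \<in> snd c ` fst c \<Longrightarrow> chart_inv c z \<in> fst c"
  by (auto simp: chart_inv_left)

lemma chart_open_image:
  assumes c: "is_chart c" and W: "open W" "W \<subseteq> fst c"
  shows "open (snd c ` W)"
proof -
  have h: "homeomorphism (fst c) (snd c ` fst c) (snd c) (chart_inv c)" and o: "open (snd c ` fst c)"
    using c by (auto simp: is_chart_def)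
  have "openin (top_of_set (fst c)) W"
    using W by (simp add: open_subset)
  from homeomorphism_imp_open_map[OF h this] have "openin (top_of_set (snd c ` fst c)) (snd c ` W)" .
  with o show ?thesis using openin_open_trans by blast
qed

lemma smooth_structureD:
  assumes "smooth_structure A" "c \<in> A"
  shows "is_chart c" "d \<in> A \<Longrightarrow> smooth_transition c d"
  using assms by (auto simp: smooth_structure_def)

lemma transition_has_derivative_jacobian:
  assumes A: "smooth_structure A" "c \<in> A" "d \<in> A" and x: "x \<in> fst c \<inter> fst d"
  shows "((snd d \<circ> chart_inv c) has_derivative jacobian c d x) (at (snd c x))"
proof -
  have "smooth_on (snd c ` (fst c \<inter> fst d)) (snd d \<circ> chart_inv c)"
    using smooth_structureD[OF A(1,2)] A(3) by (simp add: smooth_transition_def)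
  then have "((snd d \<circ> chart_inv c) has_derivative
      frechet_derivative (snd d \<circ> chart_inv c) (at (snd c x))) (at (snd c x))"
    by (rule smooth_onD) (use x in blast)
  then show ?thesis by (simp add: jacobian_def[abs_def] chart_deriv_def)
qed

lemma jacobian_linear:
  assumes "smooth_structure A" "c \<in> A" "d \<in> A" "x \<in> fst c \<inter> fst d"
  shows "linear (jacobian c d x)"
  using transition_has_derivative_jacobian[OF assms] by (rule has_derivative_linear)

lemma jacobian_inverse:
  assumes A: "smooth_structure A" "c \<in> A" "d \<in> A" and x: "x \<in> fst c \<inter> fst d"
  shows "jacobian d c x (jacobian c d x u) = u"
proof -
  have c: "is_chart c" and d: "is_chart d" using smooth_structureD(1) A by blast+
  have sx: "(snd d \<circ> chart_inv c) (snd c x) = snd d x" using x by (simp add: chart_inv_left[OF c])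
  have "((snd c \<circ> chart_inv d) has_derivative jacobian d c x) (at ((snd d \<circ> chart_inv c) (snd c x)))"
    unfolding sx using transition_has_derivative_jacobian[OF A(1,3,2)] x by blast
  from diff_chain_at[OF transition_has_derivative_jacobian[OF A x] this]
  have 1: "(((snd c \<circ> chart_inv d) \<circ> (snd d \<circ> chart_inv c)) has_derivative
      (jacobian d c x \<circ> jacobian c d x)) (at (snd c x))" .
  have "open (fst c \<inter> fst d)" using c d by (auto simp: is_chart_def)
  then have o: "open (snd c ` (fst c \<inter> fst d))" by (rule chart_open_image[OF c]) simp
  have "((\<lambda>z. z) has_derivative (jacobian d c x \<circ> jacobian c d x)) (at (snd c x))"
    by (rule has_derivative_transform_within_open[OF 1 o])
      (use x in \<open>auto simp: chart_inv_left[OF c] chart_inv_left[OF d]\<close>)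
  then have "jacobian d c x \<circ> jacobian c d x = (\<lambda>h. h)"
    using has_derivative_ident has_derivative_unique by blast
  then show ?thesis by (metis comp_apply)
qed

lemma smooth_in_chart_continuous_on:
  assumes "is_chart c" "smooth_in_chart c f"
  shows "continuous_on (fst c) f"
proof -
  have "continuous_on (snd c ` fst c) (f \<circ> chart_inv c)"
    using assms(2) smooth_on_imp_continuous_on unfolding smooth_in_chart_def by blast
  moreover have "continuous_on (fst c) (snd c)"
    using assms(1) by (auto simp: is_chart_def homeomorphism_def)
  ultimately have "continuous_on (fst c) ((f \<circ> chart_inv c) \<circ> snd c)"
    by (rule continuous_on_compose[rotated])
  then show ?thesis
    by (rule continuous_on_eq) (simp add: chart_inv_left[OF assms(1)])
qed

text \<open>Maximality of the atlas enters here: composing a chart with a diffeomorphism keeps the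
  transitions to and from all other charts smooth, so the result already belongs to
  \<open>A\<close>.\<close>

lemma chart_change:
  fixes A :: "('a::{t2_space,second_countable_topology}, 'n::finite) chart set"
  assumes A: "smooth_structure A" "c \<in> A" and U: "open U" "U \<subseteq> snd c ` fst c" and V: "open V"
    and hom: "homeomorphism U V \<Phi> \<Psi>" and smooth: "smooth_on U \<Phi>" "smooth_on V \<Psi>"
  defines "d \<equiv> (chart_inv c ` U, \<Phi> \<circ> snd c)"
  shows chart_change_in_atlas: "d \<in> A"
    and chart_change_image: "snd d ` fst d = V"
    and chart_change_jacobian: "z \<in> U \<Longrightarrow> jacobian c d (chart_inv c z) = frechet_derivative \<Phi> (at z)"
proof -
  have c: "is_chart c" using smooth_structureD[OF A] by blast
  have homc: "homeomorphism (fst c) (snd c ` fst c) (snd c) (chart_inv c)"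
    and opc: "open (fst c)" "open (snd c ` fst c)" using c by (auto simp: is_chart_def)
  have \<Phi>\<Psi>: "\<Phi> ` U = V" "\<Psi> ` V = U" "\<And>z. z \<in> U \<Longrightarrow> \<Psi> (\<Phi> z) = z" "\<And>z. z \<in> V \<Longrightarrow> \<Phi> (\<Psi> z) = z"
    "continuous_on U \<Phi>" "continuous_on V \<Psi>"
    using hom by (auto simp: homeomorphism_def)
  have sc: "snd c ` (chart_inv c ` U) = U"
  proof -
    have "snd c (chart_inv c z) = z" if "z \<in> U" for z
      using chart_inv_right[OF c] U(2) that by blast
    then show ?thesis by (simp add: image_image)
  qed
  have sub: "fst d \<subseteq> fst c" using U(2) chart_inv_in[OF c] by (auto simp: d_def)
  have scU: "snd c x \<in> U" if "x \<in> fst d" for x using that sc by (auto simp: d_def)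
  show im: "snd d ` fst d = V"
    unfolding d_def fst_conv snd_conv image_comp[symmetric] sc using \<Phi>\<Psi>(1) .
  have "fst d = fst c \<inter> snd c -` U"
  proof
    show "fst d \<subseteq> fst c \<inter> snd c -` U" using sub scU by blast
    show "fst c \<inter> snd c -` U \<subseteq> fst d"
    proof
      fix x assume "x \<in> fst c \<inter> snd c -` U"
      then have "x = chart_inv c (snd c x)" "snd c x \<in> U" using chart_inv_left[OF c, of x] by auto
      then show "x \<in> fst d" unfolding d_def fst_conv by (rule image_eqI)
    qed
  qed
  moreover have "open (fst c \<inter> snd c -` U)"
    using homc opc U(1) by (intro continuous_open_preimage) (auto simp: homeomorphism_def)
  ultimately have opd: "open (fst d)" by simp
  have sd: "snd d x = \<Phi> (snd c x)" for x by (simp add: d_def)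
  have injd: "inj_on (snd d) (fst d)"
  proof (rule inj_onI)
    fix x y assume *: "x \<in> fst d" "y \<in> fst d" "snd d x = snd d y"
    then have "snd c x = snd c y" using \<Phi>\<Psi>(3) scU by (metis sd)
    then show "x = y" using * sub chart_inv_left[OF c] by (metis subset_iff)
  qed
  have invd: "chart_inv d z = chart_inv c (\<Psi> z)" if "z \<in> V" for z
    unfolding chart_inv_def[of d]
  proof (rule inv_into_f_eq[OF injd])
    have "\<Psi> z \<in> U" using \<Phi>\<Psi>(2) that by blast
    then show "chart_inv c (\<Psi> z) \<in> fst d" by (simp add: d_def)
    show "snd d (chart_inv c (\<Psi> z)) = z"
      using \<open>\<Psi> z \<in> U\<close> U(2) chart_inv_right[OF c] \<Phi>\<Psi>(4)[OF that] by (auto simp: sd subset_iff)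
  qed
  have "is_chart d"
    unfolding is_chart_def
  proof (intro conjI)
    show "open (fst d)" by (rule opd)
    show "open (snd d ` fst d)" using im V by simp
    show "homeomorphism (fst d) (snd d ` fst d) (snd d) (chart_inv d)"
      unfolding homeomorphism_def
    proof (intro conjI ballI)
      show "continuous_on (fst d) (snd d)"
        unfolding d_def snd_conv
        using \<Phi>\<Psi>(5) sc homc sub
        by (intro continuous_on_compose) (auto simp: homeomorphism_def d_def intro: continuous_on_subset)
      show "continuous_on (snd d ` fst d) (chart_inv d)"
        unfolding im
      proof (rule continuous_on_eq)
        show "continuous_on V (chart_inv c \<circ> \<Psi>)"
          using \<Phi>\<Psi>(2,6) homc U(2)
          by (intro continuous_on_compose) (auto simp: homeomorphism_def intro: continuous_on_subset)
      qed (simp add: invd)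
      show inv1: "chart_inv d (snd d x) = x" if "x \<in> fst d" for x
        using that injd by (simp add: chart_inv_def)
      show "snd d (chart_inv d y) = y" if "y \<in> snd d ` fst d" for y
        using that inv1 by auto
      show "chart_inv d ` snd d ` fst d = fst d"
        using inv1 by (force simp: image_iff)
    qed simp
  qed
  have tr: "smooth_transition d e \<and> smooth_transition e d" if e: "e \<in> A" for e
  proof
    have ech: "is_chart e" using smooth_structureD[OF A(1) e] by blast
    have ope: "open (fst e)" using ech by (simp add: is_chart_def)
    have ce: "smooth_on (snd c ` (fst c \<inter> fst e)) (snd e \<circ> chart_inv c)"
      and ec: "smooth_on (snd e ` (fst e \<inter> fst c)) (snd c \<circ> chart_inv e)"
      using smooth_structureD[OF A(1)] A(2) e by (auto simp: smooth_transition_def)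
    have o1: "open (snd c ` (fst c \<inter> fst e))" by (rule chart_open_image[OF c]) (use opc ope in auto)
    have o2: "open (snd d ` (fst d \<inter> fst e))" by (rule chart_open_image[OF \<open>is_chart d\<close>]) (use opd ope in auto)
    have o3: "open (snd e ` (fst e \<inter> fst d))" by (rule chart_open_image[OF ech]) (use opd ope in auto)
    have subV: "snd d ` (fst d \<inter> fst e) \<subseteq> V" using im by blast
    have \<Psi>im: "\<Psi> ` (snd d ` (fst d \<inter> fst e)) \<subseteq> snd c ` (fst c \<inter> fst e)"
      using sub scU \<Phi>\<Psi>(3) by (auto simp: sd)
    show "smooth_transition d e"
      unfolding smooth_transition_def smooth_on_def
    proof
      fix k
      have "Ck_on k (snd d ` (fst d \<inter> fst e)) ((snd e \<circ> chart_inv c) \<circ> \<Psi>)"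
        using ce smooth(2) Ck_on_subset[OF subV] unfolding smooth_on_def
        by (intro Ck_on_compose[OF o2 o1 \<Psi>im]) blast+
      then show "Ck_on k (snd d ` (fst d \<inter> fst e)) (snd e \<circ> chart_inv d)"
        by (rule Ck_on_cong[OF o2, rotated]) (use subV in \<open>auto simp: invd subset_iff\<close>)
    qed
    have sub2: "snd e ` (fst e \<inter> fst d) \<subseteq> snd e ` (fst e \<inter> fst c)" using sub by blast
    have im2: "(snd c \<circ> chart_inv e) ` (snd e ` (fst e \<inter> fst d)) \<subseteq> U"
      using scU by (auto simp: chart_inv_left[OF ech])
    show "smooth_transition e d"
      unfolding smooth_transition_def smooth_on_def
    proof
      fix k
      have "Ck_on k (snd e ` (fst e \<inter> fst d)) (\<Phi> \<circ> (snd c \<circ> chart_inv e))"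
        using ec smooth(1) Ck_on_subset[OF sub2] unfolding smooth_on_def
        by (intro Ck_on_compose[OF o3 U(1) im2]) blast+
      then show "Ck_on k (snd e ` (fst e \<inter> fst d)) (snd d \<circ> chart_inv e)"
        by (simp add: d_def o_assoc)
    qed
  qed
  show "d \<in> A"
    using A(1) \<open>is_chart d\<close> tr unfolding smooth_structure_def by blast
  show "jacobian c d (chart_inv c z) = frechet_derivative \<Phi> (at z)" if z: "z \<in> U" for z
  proof -
    have "((snd d \<circ> chart_inv c) has_derivative frechet_derivative \<Phi> (at z)) (at z)"
      by (rule has_derivative_transform_within_open[OF smooth_onD[OF smooth(1) z] U(1) z])
        (use U(2) chart_inv_right[OF c] in \<open>auto simp: sd\<close>)
    from frechet_derivativeI[OF this] show ?thesis
      using z U(2) chart_inv_right[OF c] by (auto simp: jacobian_def[abs_def] chart_deriv_def subset_iff)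
  qed
qed

lemma chart_change_holomorphic:
  fixes A :: "('a::{t2_space,second_countable_topology}, 'n::finite) chart set"
  assumes A: "smooth_structure A" "c \<in> A" and J: "endomorphism_field A J" "holomorphic_chart J c"
    and U: "open U" "U \<subseteq> snd c ` fst c" and V: "open V"
    and hom: "homeomorphism U V \<Phi> \<Psi>" and smooth: "smooth_on U \<Phi>" "smooth_on V \<Psi>"
    and hol: "\<And>z u. z \<in> U \<Longrightarrow> frechet_derivative \<Phi> (at z) (\<i> *s u) = \<i> *s frechet_derivative \<Phi> (at z) u"
  shows "holomorphic_chart J (chart_inv c ` U, \<Phi> \<circ> snd c)"
  unfolding holomorphic_chart_def
proof (intro ballI allI)
  let ?d = "(chart_inv c ` U, \<Phi> \<circ> snd c)"
  note cc = chart_change_in_atlas[OF A U V hom smooth] chart_change_jacobian[OF A U V hom smooth]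
  have c: "is_chart c" using smooth_structureD[OF A] by blast
  fix x u assume "x \<in> fst ?d"
  then obtain z where z: "z \<in> U" "x = chart_inv c z" by auto
  have x: "x \<in> fst c \<inter> fst ?d" using z U(2) chart_inv_in[OF c] by auto
  define w where "w = jacobian ?d c x u"
  have u: "u = frechet_derivative \<Phi> (at z) w"
    using jacobian_inverse[OF A(1) cc(1) A(2), of x u] x z cc(2)[OF z(1)] by (simp add: w_def)
  have "J ?d x (jacobian c ?d x w) = jacobian c ?d x (J c x w)"
    using J(1) A(2) cc(1) x unfolding endomorphism_field_def by blast
  then show "J ?d x u = \<i> *s u"
    using J(2) x cc(2)[OF z(1)] hol[OF z(1)] by (simp add: u z(2) holomorphic_chart_def)
qed

lemma vec_dim_coordinate_hyperplane: "vec.dim {z :: complex ^ 'n::finite. z $ k = 0} = CARD('n) - 1"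
proof -
  let ?V = "{z :: complex ^ 'n. z $ k = 0}"
  let ?B = "(\<lambda>j. axis j (1::complex)) ` (UNIV - {k})"
  have sub: "?B \<subseteq> ?V" by (auto simp: axis_def)
  have ind: "vec.independent ?B"
    by (rule vec.independent_mono[OF independent_cart_basis]) (auto simp: cart_basis_def)
  have "?V \<subseteq> vec.span ?B"
  proof
    fix z :: "complex ^ 'n" assume z: "z \<in> ?V"
    have "z = (\<Sum>j\<in>UNIV. z $ j *s axis j 1)" by (simp add: basis_expansion)
    also have "\<dots> = (\<Sum>j\<in>UNIV - {k}. z $ j *s axis j 1)"
      using z by (simp add: sum.remove[of UNIV k])
    also have "\<dots> \<in> vec.span ?B"
      by (intro vec.span_sum vec.span_scale vec.span_base) auto
    finally show "z \<in> vec.span ?B" .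
  qed
  then have "vec.dim ?V = card ?B"
    using vec.dim_eq_card_independent[OF ind] vec.dim_unique[OF sub _ ind] by blast
  also have "\<dots> = CARD('n) - 1"
    by (subst card_image) (auto simp: inj_on_def axis_eq_axis)
  finally show ?thesis .
qed

text \<open>If \<open>f\<close> vanishes identically, the chart restricted to \<open>U\<close>
  exhibits an open subset, of full dimension; otherwise a straightened hypersurface near some zero
  has codimension one. The point found need not lie over \<open>z0\<close>. The bound
  \<open>CARD('n) \<le> d + 1\<close> covers both cases without truncated subtraction.\<close>

lemma regular_point_of_zero_set:
  fixes A :: "('a::{t2_space,second_countable_topology}, 'n::finite) chart set"
  assumes A: "smooth_structure A" "c \<in> A" and J: "endomorphism_field A J" "holomorphic_chart J c"
    and U: "open U" "U \<subseteq> snd c ` fst c" and conv: "convex U"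
    and f: "hol_on U f" and z0: "z0 \<in> U" "f z0 = 0"
    and S: "\<And>z. z \<in> U \<Longrightarrow> chart_inv c z \<in> S \<longleftrightarrow> f z = 0"
  shows "\<exists>x d. regular_point A J S d x \<and> CARD('n) \<le> d + 1"
proof -
  have c: "is_chart c" using smooth_structureD[OF A] by blast
  have reg: "regular_point A J S (vec.dim E) (chart_inv c q)"
    if U': "open U'" "U' \<subseteq> U" "open V" "homeomorphism U' V \<Phi> \<Psi>" "smooth_on U' \<Phi>" "smooth_on V \<Psi>"
      and hol: "\<And>z u. z \<in> U' \<Longrightarrow> frechet_derivative \<Phi> (at z) (\<i> *s u) = \<i> *s frechet_derivative \<Phi> (at z) u"
      and q: "q \<in> U'" "f q = 0" and E: "vec.subspace E" "\<And>z. z \<in> U' \<Longrightarrow> f z = 0 \<longleftrightarrow> \<Phi> z \<in> E"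
    for U' V E and \<Phi> \<Psi> :: "complex ^ 'n \<Rightarrow> complex ^ 'n" and q
  proof -
    let ?d = "(chart_inv c ` U', \<Phi> \<circ> snd c)"
    have sub: "U' \<subseteq> snd c ` fst c" using U' U by blast
    note cc = chart_change_in_atlas[OF A U'(1) sub U'(3-6)] chart_change_image[OF A U'(1) sub U'(3-6)]
    have hd: "holomorphic_chart J ?d"
      by (rule chart_change_holomorphic[OF A J U'(1) sub U'(3-6) hol])
    have \<Phi>: "\<Phi> ` U' = V" using U'(4) by (simp add: homeomorphism_def)
    have "snd ?d ` (S \<inter> fst ?d) = \<Phi> ` {z \<in> U'. f z = 0}"
    proof -
      have "S \<inter> fst ?d = chart_inv c ` {z \<in> U'. f z = 0}" using S U'(2) by auto
      then have "snd ?d ` (S \<inter> fst ?d) = (\<lambda>z. \<Phi> (snd c (chart_inv c z))) ` {z \<in> U'. f z = 0}"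
        by (simp add: image_image)
      also have "\<dots> = \<Phi> ` {z \<in> U'. f z = 0}"
        using sub chart_inv_right[OF c] by (intro image_cong) (auto simp: subset_iff)
      finally show ?thesis .
    qed
    also have "\<dots> = V \<inter> E" using \<Phi> E(2) by auto
    finally have "snd ?d ` (S \<inter> fst ?d) = snd ?d ` fst ?d \<inter> E" using cc(2) by simp
    moreover have "chart_inv c q \<in> S" using S q U'(2) by auto
    moreover have "chart_inv c q \<in> fst ?d" using q by simp
    ultimately show ?thesis
      unfolding regular_point_def using cc(1) hd E(1) by blast
  qed
  show ?thesis
  proof (cases "\<exists>z\<in>U. f z \<noteq> 0")
    case False
    have id: "frechet_derivative (\<lambda>z. z) (at z) u = u" for z u :: "complex ^ 'n"
      using frechet_derivativeI[OF has_derivative_ident] by metis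
    have "regular_point A J S (vec.dim (UNIV :: (complex ^ 'n) set)) (chart_inv c z0)"
    proof (rule reg[of U U "\<lambda>z. z" "\<lambda>z. z"])
      show "homeomorphism U U (\<lambda>z. z) (\<lambda>z. z)" by (simp add: homeomorphism_def)
      show "smooth_on U (\<lambda>z. z)"
        unfolding smooth_on_def using Ck_on_linear_self[OF bounded_linear_ident U(1)] by blast
      then show "smooth_on U (\<lambda>z. z)" .
    qed (use False U z0 in \<open>auto simp: id\<close>)
    then show ?thesis by (intro exI conjI) (auto simp: vec.dim_UNIV card_cart_basis)
  next
    case True
    then obtain z1 where z1: "z1 \<in> U" "f z1 \<noteq> 0" by blast
    obtain q h v where q: "q \<in> U" "f q = 0" and h: "hol_on U h" "frechet_derivative h (at q) v \<noteq> 0"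
      "\<And>z. z \<in> U \<Longrightarrow> f z = 0 \<Longrightarrow> h z = 0"
      using zero_set_contained_in_smooth_hypersurface[OF U(1) conv f z0 z1] by blast
    obtain W where W: "open W" "q \<in> W" "W \<subseteq> U" "\<And>z. z \<in> W \<Longrightarrow> f z = 0 \<longleftrightarrow> h z = 0"
      using zero_set_eq_smooth_hypersurface[OF U(1) f h(1) q h(2,3)] by blast
    show ?thesis
    proof (rule straighten_smooth_hypersurface[OF W(1) hol_on_subset[OF h(1) W(3)] W(2) h(2)])
      fix k U' V and \<Phi> \<Psi> :: "complex ^ 'n \<Rightarrow> complex ^ 'n"
      assume s: "open U'" "q \<in> U'" "U' \<subseteq> W" "open V" "homeomorphism U' V \<Phi> \<Psi>"
        "smooth_on U' \<Phi>" "smooth_on V \<Psi>"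
        and hol: "\<And>z u. z \<in> U' \<Longrightarrow> frechet_derivative \<Phi> (at z) (\<i> *s u) = \<i> *s frechet_derivative \<Phi> (at z) u"
        and \<Phi>k: "\<And>z. \<Phi> z $ k = h z"
      have "regular_point A J S (vec.dim {z :: complex ^ 'n. z $ k = 0}) (chart_inv c q)"
      proof (rule reg[OF s(1) _ s(4-7) hol s(2)])
        show "U' \<subseteq> U" using s(3) W(3) by blast
        show "vec.subspace {z :: complex ^ 'n. z $ k = 0}" by (auto simp: vec.subspace_def)
        show "f z = 0 \<longleftrightarrow> \<Phi> z \<in> {z. z $ k = 0}" if "z \<in> U'" for z
          using \<Phi>k W(4) s(3) that by auto
      qed (use q(2) in simp_all)
      then show ?thesis by (intro exI conjI) (auto simp: vec_dim_coordinate_hyperplane)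
    qed
  qed
qed

section \<open>A pair of orthogonal complex structures in complex dimension three\<close>

text \<open>For eigenvalues \<open>2\<epsilon>, t, t\<close> with \<open>\<epsilon> = \<plusminus>1\<close> and \<open>w = \<epsilon>t\<close>, half the trace is \<open>\<epsilon>(1 + w)\<close>, half the determinant is
  \<open>\<epsilon>w\<^sup>2\<close>, and \<open>w\<close> is a polynomial in the second symmetric function and the trace; so \<open>\<epsilon>\<close> can be read off from
  \<open>w\<^sup>2 - (w - 1)(w + 1) = 1\<close>.\<close>

definition pair_sign :: "complex ^ 3 ^ 3 \<Rightarrow> complex" where
  "pair_sign P = det P / 2 -
     ((((trace P)\<^sup>2 - trace (P ** P)) / 2 - (trace P)\<^sup>2 / 4 + 1) / 2 - 1) * (trace P / 2)"

lemma invariants_similar: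
  fixes P Q T :: "complex ^ 3 ^ 3"
  assumes "P ** T = T ** Q" "invertible T"
  shows "trace P = trace Q" "pair_sign P = pair_sign Q"
proof -
  obtain T' where T': "T ** T' = mat 1" "T' ** T = mat 1"
    using assms(2) by (auto simp: invertible_def)
  have P: "P = T ** (Q ** T')"
    using arg_cong[OF assms(1), of "\<lambda>X. X ** T'"] by (simp add: matrix_mul_assoc[symmetric] T')
  have tr: "trace (T ** (X ** T')) = trace X" for X
    by (subst trace_mul_sym) (simp add: matrix_mul_assoc[symmetric] T')
  show t: "trace P = trace Q" by (simp add: P tr)
  have "P ** P = T ** ((Q ** (T' ** T) ** Q) ** T')" by (simp add: P matrix_mul_assoc)
  then have t2: "trace (P ** P) = trace (Q ** Q)" by (simp add: tr T')
  have "det T * det T' = 1" using arg_cong[OF T'(1), of det] by (simp add: det_mul)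
  then have "det P = det Q" by (simp add: P det_mul)
  with t t2 show "pair_sign P = pair_sign Q" by (simp add: pair_sign_def)
qed

definition diag3 :: "complex \<Rightarrow> complex \<Rightarrow> complex \<Rightarrow> complex ^ 3 ^ 3" where
  "diag3 r s t = vector [vector [r, 0, 0], vector [0, s, 0], vector [0, 0, t]]"

lemma invariants_diag3:
  "trace (diag3 r s t) = r + s + t" "det (diag3 r s t) = r * s * t"
  "diag3 r s t ** diag3 r s t = diag3 (r * r) (s * s) (t * t)"
  by (simp_all add: diag3_def trace_def det_3 sum_3 matrix_matrix_mult_def vec_eq_iff forall_3)

lemma pair_sign_diag3:
  "pair_sign (diag3 2 s s) = 1" "pair_sign (diag3 (- 2) s s) = - 1"
  unfolding pair_sign_def invariants_diag3 by algebra+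

lemma complex_linear_vec:
  fixes f :: "complex ^ 'n \<Rightarrow> complex ^ 'm"
  assumes "linear f" "\<And>u. f (\<i> *s u) = \<i> *s f u"
  shows "f (c *s u) = c *s f u"
proof -
  have "f (c *s u) $ i = c * f u $ i" for i
  proof (rule linear_i_imp_complex_linear)
    show "linear (\<lambda>u. f u $ i)"
      using assms(1) by (auto simp: linear_iff)
  qed (simp add: assms(2))
  then show ?thesis by (simp add: vec_eq_iff)
qed

lemma complex_matrix_works:
  fixes f :: "complex ^ 'n \<Rightarrow> complex ^ 'm::finite"
  assumes "linear f" "\<And>u. f (\<i> *s u) = \<i> *s f u"
  shows "matrix f *v u = f u"
proof (rule matrix_works)
  show "Vector_Spaces.linear (*s) (*s) f"
    using complex_linear_vec[OF assms] linear_add[OF assms(1)]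
    by (intro Vector_Spaces.linear_iff[THEN iffD2]) (auto intro: vec.vector_space_axioms)
qed

lemma linear_kernel_nontrivial:
  fixes f :: "'a::euclidean_space \<Rightarrow> 'b::euclidean_space"
  assumes "linear f" "DIM('b) < DIM('a)"
  obtains x where "x \<noteq> 0" "f x = 0"
proof -
  have "\<not> inj f"
  proof
    assume "inj f"
    then have "dim (range f) = DIM('a)"
      using dim_image_eq[OF assms(1), of UNIV] by (simp add: inj_on_subset)
    with assms(2) dim_subset_UNIV[of "range f"] show False by simp
  qed
  then show ?thesis using that linear_injective_0[OF assms(1)] by blast
qed

text \<open>The complex structures are multiplication by \<open>\<i>\<close> and \<open>I\<close>.\<close>

definition pair_sum :: "(complex ^ 'n \<Rightarrow> complex ^ 'n) \<Rightarrow> complex ^ 'n \<Rightarrow> complex ^ 'n" where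
  "pair_sum I u = \<i> *s I u + I (\<i> *s u)"

definition pair_commutator :: "(complex ^ 'n \<Rightarrow> complex ^ 'n) \<Rightarrow> complex ^ 'n \<Rightarrow> complex ^ 'n" where
  "pair_commutator I u = \<i> *s I u - I (\<i> *s u)"

text \<open>For eigenvalues 2\<epsilon>, t, t half the trace minus the sign is t, so this is p - t.
  Expressing t by conjugation invariants makes it continuous even where eigenvalues collide.\<close>

definition pair_defect :: "(complex ^ 3 \<Rightarrow> complex ^ 3) \<Rightarrow> complex ^ 3 ^ 3" where
  "pair_defect I = matrix (pair_sum I) -
     mat (trace (matrix (pair_sum I)) / 2 - pair_sign (matrix (pair_sum I)))"

section \<open>Linear algebra in a single tangent space\<close>

locale orthogonal_complex_structure =
  fixes g :: "complex ^ 3 \<Rightarrow> complex ^ 3 \<Rightarrow> real" and I :: "complex ^ 3 \<Rightarrow> complex ^ 3"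
  assumes bilin: "bilinear g" and sym: "g u v = g v u" and pos: "u \<noteq> 0 \<Longrightarrow> g u u > 0"
    and gi: "g (\<i> *s u) (\<i> *s v) = g u v"
    and linI: "linear I" and II: "I (I u) = - u" and gI: "g (I u) (I v) = g u v"
begin

abbreviation J :: "complex ^ 3 \<Rightarrow> complex ^ 3" where "J u \<equiv> \<i> *s u"

abbreviation p :: "complex ^ 3 \<Rightarrow> complex ^ 3" where "p \<equiv> pair_sum I"

abbreviation K :: "complex ^ 3 \<Rightarrow> complex ^ 3" where "K \<equiv> pair_commutator I"

lemma JJ: "J (J u) = - u" by (simp add: vec_eq_iff)

lemma J_add: "J (u + v) = J u + J v" and J_diff: "J (u - v) = J u - J v" and J_minus: "J (- u) = - J u"
  and J_scale: "J (r *\<^sub>R u) = r *\<^sub>R J u"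
  by (simp_all add: vec_eq_iff algebra_simps)

lemmas I_simps = linear_add[OF linI] linear_diff[OF linI] linear_neg[OF linI] linear_scale[OF linI]
  linear_0[OF linI]

lemmas g_simps = bilinear_ladd[OF bilin] bilinear_radd[OF bilin] bilinear_lsub[OF bilin]
  bilinear_rsub[OF bilin] bilinear_lneg[OF bilin] bilinear_rneg[OF bilin]
  bilinear_lzero[OF bilin] bilinear_rzero[OF bilin] bilinear_lmul[OF bilin] bilinear_rmul[OF bilin]

lemmas J_simps = J_add J_diff J_minus JJ

lemma g_J: "g (J u) v = - g u (J v)"
  using gi[of u "J v"] by (simp add: JJ g_simps)

lemma g_I: "g (I u) v = - g u (I v)"
  using gI[of u "I v"] by (simp add: II g_simps)

lemma g_JJ: "g u (J u) = 0"
  using g_J[of u u] sym[of u "J u"] by simp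

lemma lin_p: "linear p" and lin_K: "linear K"
  by (auto simp: linear_iff pair_sum_def pair_commutator_def I_simps J_add J_scale algebra_simps)

lemma p_J: "p (J u) = J (p u)" and K_J: "K (J u) = - J (K u)"
  and K_I: "K (I u) = - I (K u)"
  by (simp_all add: pair_sum_def pair_commutator_def I_simps J_simps II)

lemma p_K: "p (K u) = K (p u)"
  by (simp add: pair_sum_def pair_commutator_def I_simps J_simps II)

lemma K_K: "K (K u) = p (p u) - 4 *\<^sub>R u"
  by (simp add: pair_sum_def pair_commutator_def I_simps J_simps II) (simp add: vec_eq_iff scaleR_conv_of_real)

lemma g_p: "g (p u) v = g u (p v)" and g_K: "g (K u) v = - g u (K v)"
  by (simp_all add: pair_sum_def pair_commutator_def g_simps g_J g_I)

lemma g_nondeg: "(\<And>v. g u v = 0) \<Longrightarrow> u = 0"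
  using pos[of u] by (metis less_irrefl)

lemma smult_expand: "c *s u = Re c *\<^sub>R u + Im c *\<^sub>R J u"
  by (simp add: vec_eq_iff complex_eq_iff)

text \<open>Orthogonality for the hermitian form with real part \<open>g\<close>, hence stable under
  complex multiples.\<close>

definition perp :: "complex ^ 3 \<Rightarrow> complex ^ 3 \<Rightarrow> bool" where
  "perp u v \<longleftrightarrow> g u v = 0 \<and> g u (J v) = 0"

lemma perp_sym: "perp u v \<Longrightarrow> perp v u"
  using g_J[of v u] by (auto simp: perp_def sym[of v u] sym[of "J v" u])

lemma perp_smult_left: "perp u v \<Longrightarrow> perp (c *s u) v"
  unfolding smult_expand[of c u] by (simp add: perp_def g_simps g_J JJ)

lemma perp_add_left: "perp u v \<Longrightarrow> perp u' v \<Longrightarrow> perp (u + u') v"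
  by (simp add: perp_def g_simps)

lemma perp_self: "perp u u \<Longrightarrow> u = 0"
  using pos by (metis perp_def less_irrefl)

text \<open>Four real linear conditions on a real space of dimension six.\<close>

lemma ex_perp: obtains w where "w \<noteq> 0" "perp w u" "perp w v"
proof -
  have "linear (\<lambda>w. (g w u, g w (J u), g w v, g w (J v)))"
    by (auto simp: linear_iff g_simps)
  then show ?thesis
    by (rule linear_kernel_nontrivial) (use that in \<open>auto simp: perp_def zero_prod_def\<close>)
qed

text \<open>On the kernel of \<open>K\<close> the two structures commute, so \<open>J I\<close> is
  an involution there: \<open>u + J (I u)\<close> is fixed by it, and if this vector is zero,
  \<open>u\<close> is negated. The explicit shape of \<open>l\<close> is recorded so that
  orthogonality of \<open>u\<close> to earlier vectors passes to \<open>l\<close>.\<close>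

lemma eigenvector_from_kernel:
  assumes "u \<noteq> 0" "K u = 0"
  obtains l a where "l \<noteq> 0" "l = u \<or> l = u + J (I u)" "a = 1 \<or> a = - 1" "I l = - (a *\<^sub>R J l)"
proof (cases "u + J (I u) = 0")
  case True
  then have "J (u + J (I u)) = 0" by simp
  then have "I u = J u" by (simp add: J_simps)
  then show ?thesis using that[of u "- 1"] assms(1) by simp
next
  case False
  have "I (J (I u)) = - J u" using assms(2) I_simps II by (metis pair_commutator_def right_minus_eq K_I JJ minus_minus)
  then show ?thesis using that[of "u + J (I u)" 1] False by (simp add: J_simps I_simps)
qed

lemma eigenvector_values:
  assumes "I l = - (a *\<^sub>R J l)" "a = 1 \<or> a = - 1"
  shows "p l = (2 * a) *\<^sub>R l" "K l = 0"
proof -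
  have 1: "J (I l) = a *\<^sub>R l" by (simp add: assms(1) J_simps J_scale)
  have "I (I l) = - (a *\<^sub>R I (J l))" by (subst assms(1)) (simp add: I_simps)
  then have "l = a *\<^sub>R I (J l)" by (simp add: II)
  from arg_cong[OF this, of "\<lambda>z. a *\<^sub>R z"] have "a *\<^sub>R l = (a * a) *\<^sub>R I (J l)"
    unfolding scaleR_scaleR .
  moreover have "a * a = 1" using assms(2) by auto
  ultimately have 2: "I (J l) = a *\<^sub>R l" by simp
  show "p l = (2 * a) *\<^sub>R l" "K l = 0" by (simp_all add: pair_sum_def pair_commutator_def 1 2 scaleR_2[symmetric])
qed

text \<open>A skew form in odd dimension is degenerate. As \<open>K\<close> is antilinear and skew
  for \<open>g\<close>, the real form \<open>g (K u) v\<close> is the real part of a complex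
  bilinear skew form \<omega>, whose 3 by 3 matrix has determinant zero.\<close>

lemma kernel_nontrivial: obtains u where "u \<noteq> 0" "K u = 0"
proof -
  define \<omega> where "\<omega> u v = Complex (g (K u) v) (- g (K u) (J v))" for u v
  have lin: "linear (\<lambda>v. \<omega> u v)" for u
    by (auto simp: linear_iff \<omega>_def complex_eq_iff g_simps J_add J_scale)
  have om_i: "\<omega> u (J v) = \<i> * \<omega> u v" for u v
    by (simp add: \<omega>_def complex_eq_iff JJ g_simps)
  have skew: "\<omega> u v = - \<omega> v u" for u v
  proof -
    have "g (K u) v = - g (K v) u" using g_K[of u v] sym[of u "K v"] by simp
    moreover have "g (K u) (J v) = - g (K v) (J u)"
      using g_K[of u "J v"] g_J[of u "K v"] sym[of "J u" "K v"] by (simp add: K_J g_simps)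
    ultimately show ?thesis by (simp add: \<omega>_def complex_eq_iff)
  qed
  define M :: "complex ^ 3 ^ 3" where "M = (\<chi> j k. \<omega> (axis j 1) (axis k 1))"
  have Mskew: "M $ j $ k = - M $ k $ j" for j k by (simp add: M_def) (rule skew)
  have M0: "M $ j $ j = 0" for j
    using arg_cong[OF Mskew[of j j], of "\<lambda>z. z + M $ j $ j"] by simp
  have "det M = 0"
    unfolding det_3 using Mskew[of 2 1] Mskew[of 3 1] Mskew[of 3 2] by (simp add: M0)
  then have "\<not> (\<exists>B. B ** M = mat 1)"
    using invertible_det_nz[of M] invertible_left_inverse[of M] by simp
  then obtain x where x: "x \<noteq> 0" "M *v x = 0"
    using matrix_left_invertible_ker[of M] by blast
  have "\<omega> (axis j 1) x = 0" for j
  proof -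
    have "\<omega> (axis j 1) x = \<omega> (axis j 1) (\<Sum>k\<in>UNIV. x $ k *s axis k 1)"
      by (simp add: basis_expansion)
    also have "\<dots> = (\<Sum>k\<in>UNIV. x $ k * \<omega> (axis j 1) (axis k 1))"
      by (simp add: linear_sum[OF lin] linear_i_imp_complex_linear[OF lin om_i])
    also have "\<dots> = (M *v x) $ j"
      by (simp add: matrix_vector_mult_def M_def mult.commute)
    finally show ?thesis using x by simp
  qed
  then have 0: "\<omega> x (axis j 1) = 0" for j using skew by (metis neg_equal_0_iff_equal)
  have "\<omega> x u = 0" for u
  proof -
    have "\<omega> x u = \<omega> x (\<Sum>k\<in>UNIV. u $ k *s axis k 1)"
      by (simp add: basis_expansion)
    also have "\<dots> = 0"
      by (simp add: linear_sum[OF lin] linear_i_imp_complex_linear[OF lin om_i] 0)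
    finally show ?thesis .
  qed
  then have "g (K x) v = 0" for v by (metis \<omega>_def complex.sel(1) zero_complex.sel(1))
  then show ?thesis using that x(1) g_nondeg by blast
qed

lemma perp_combination:
  assumes perp: "perp l v" "perp l w" "perp v w" and nz: "l \<noteq> 0" "v \<noteq> 0" "w \<noteq> 0"
  shows "invertible (transpose (vector [l, v, w] :: complex ^ 3 ^ 3))"
    and "transpose (vector [l, v, w]) *v (x :: complex ^ 3) = x $ 1 *s l + x $ 2 *s v + x $ 3 *s w"
proof -
  let ?T = "transpose (vector [l, v, w] :: complex ^ 3 ^ 3)"
  have T: "?T *v x = x $ 1 *s l + x $ 2 *s v + x $ 3 *s w" for x
    by (simp add: vec_eq_iff matrix_vector_mult_def sum_3 transpose_def vector_3 mult.commute)
  then show "?T *v x = x $ 1 *s l + x $ 2 *s v + x $ 3 *s w" .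
  have z: "c = 0" if "c *s u + y = 0" "perp y u" "u \<noteq> 0" for c u y
  proof -
    have "g (c *s u) x = - g y x" for x
      using arg_cong[OF that(1), of "\<lambda>z. g z x"] by (simp add: g_simps)
    then have "g (c *s u) u = 0" "g (c *s u) (J u) = 0" using that(2) by (simp_all add: perp_def)
    moreover have "g u u > 0" using pos that(3) by blast
    ultimately show ?thesis
      by (simp add: smult_expand[of c u] g_simps gi g_J[of u u] g_JJ complex_eq_iff)
  qed
  have "x = 0" if "?T *v x = 0" for x
  proof -
    have e: "x $ 1 *s l + x $ 2 *s v + x $ 3 *s w = 0" using that T by simp
    have "x $ 1 = 0"
      by (rule z[of _ l "x $ 2 *s v + x $ 3 *s w"])
        (use e nz perp in \<open>auto simp: add.assoc intro: perp_add_left perp_smult_left perp_sym\<close>)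
    moreover have "x $ 2 = 0"
      by (rule z[of _ v "x $ 1 *s l + x $ 3 *s w"])
        (use e nz perp in \<open>auto simp: add_ac intro: perp_add_left perp_smult_left perp_sym\<close>)
    moreover have "x $ 3 = 0"
      by (rule z[of _ w "x $ 1 *s l + x $ 2 *s v"])
        (use e nz perp in \<open>auto simp: add_ac intro: perp_add_left perp_smult_left perp_sym\<close>)
    ultimately show ?thesis by (simp add: vec_eq_iff forall_3)
  qed
  then show "invertible ?T"
    using matrix_left_invertible_ker[of ?T] invertible_left_inverse[of ?T] by blast
qed

lemma perp_all_imp_zero:
  assumes "perp l v" "perp l w" "perp v w" "l \<noteq> 0" "v \<noteq> 0" "w \<noteq> 0"
    and z: "perp z l" "perp z v" "perp z w"
  shows "z = 0"
proof -
  let ?T = "transpose (vector [l, v, w] :: complex ^ 3 ^ 3)"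
  note T = perp_combination[OF assms(1-6)]
  obtain T' where T': "?T ** T' = mat 1" using T(1) by (auto simp: invertible_def)
  have "?T *v (T' *v z) = z" by (simp add: matrix_vector_mul_assoc T')
  then obtain x :: "complex ^ 3" where "z = x $ 1 *s l + x $ 2 *s v + x $ 3 *s w" using T(2) by metis
  then have "perp z z" using z by (metis perp_add_left perp_smult_left perp_sym)
  then show ?thesis by (rule perp_self)
qed

section \<open>Orthogonal eigenvectors and the eigenvalues of \<open>p\<close>\<close>

lemma perp_K_self: "perp (K v) v"
  using g_K[of v v] g_K[of v "J v"] g_J[of v "K v"] sym[of v "K v"] sym[of "K v" "J v"]
  by (auto simp: perp_def K_J g_simps)

lemma perp_p: "p u = r *\<^sub>R u \<Longrightarrow> perp v u \<Longrightarrow> perp (p v) u"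
  by (simp add: perp_def g_p g_simps p_J J_scale)

lemma perp_K: "K u = 0 \<Longrightarrow> perp (K v) u"
  by (simp add: perp_def g_K g_simps K_J)

lemma perp_I:
  assumes "I l = - (a *\<^sub>R J l)" "a = 1 \<or> a = - 1" "perp u l"
  shows "perp (I u) l"
proof -
  have "I (J l) = J (I l)" using eigenvector_values(2)[OF assms(1,2)] by (simp add: pair_commutator_def)
  then have "I (J l) = a *\<^sub>R l" by (simp add: assms(1) J_simps J_scale)
  with assms(1,3) show ?thesis by (simp add: perp_def g_I g_simps)
qed

text \<open>Some line \<open>\<complex> l\<close> satisfies \<open>I = \<plusminus> J\<close>. If \<open>K v \<noteq> 0\<close> for some \<open>v\<close> orthogonal to \<open>l\<close>, then \<open>v\<close> and \<open>K v\<close> are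
  orthogonal eigenvectors of \<open>p\<close> with the same eigenvalue.\<close>

lemma diagonalisation:
  obtains l v w a s t where
    "perp l v" "perp l w" "perp v w" "l \<noteq> 0" "v \<noteq> 0" "w \<noteq> 0"
    "p l = (2 * a) *\<^sub>R l" "p v = s *\<^sub>R v" "p w = t *\<^sub>R w" "a = 1 \<or> a = - 1"
    "s = t \<and> (\<forall>u. perp (K u) l) \<or> (\<forall>u. K u = 0) \<and> (s = 2 \<or> s = - 2) \<and> (t = 2 \<or> t = - 2)"
proof -
  obtain u0 where u0: "u0 \<noteq> 0" "K u0 = 0" by (rule kernel_nontrivial)
  obtain l a where l: "l \<noteq> 0" "a = 1 \<or> a = - 1" "I l = - (a *\<^sub>R J l)"
    by (rule eigenvector_from_kernel[OF u0])
  note pl2 = eigenvector_values[OF l(3,2)]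
  obtain v0 where v0: "v0 \<noteq> 0" "perp v0 l" by (rule ex_perp[of l l])
  show ?thesis
  proof (cases "K v0 = 0")
    case False
    let ?w = "K v0"
    \<comment> \<open>The Rayleigh quotient is the only candidate for the eigenvalue; the difference
      is then tested against the orthogonal basis \<open>l\<close>, \<open>v0\<close>,
      \<open>K v0\<close>.\<close>
    define t where "t = g (p v0) v0 / g v0 v0"
    have o: "perp l v0" "perp l ?w" "perp v0 ?w"
      using v0(2) perp_K[OF pl2(2)] perp_K_self perp_sym by blast+
    have "p v0 - t *\<^sub>R v0 = 0"
    proof (rule perp_all_imp_zero[OF o l(1) v0(1) False])
      have pl2: "perp (p v0) l" by (rule perp_p[OF pl2(1) v0(2)])
      show "perp (p v0 - t *\<^sub>R v0) l"
        using pl2 v0(2) by (auto simp: perp_def g_simps)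
      have "g v0 v0 > 0" using pos v0(1) by blast
      moreover have "g (p v0) (J v0) = 0"
        using g_p[of v0 "J v0"] g_J[of v0 "p v0"] sym[of "p v0" "J v0"] by (simp add: p_J)
      ultimately show "perp (p v0 - t *\<^sub>R v0) v0"
        by (auto simp: perp_def g_simps t_def g_JJ)
      \<comment> \<open>\<open>p\<close> is symmetric, \<open>K\<close> is skew and they commute, so
        this number equals its negative.\<close>
      have 1: "g (p v0) (K v0) = 0"
        using g_K[of v0 "p v0"] g_p[of v0 "K v0"] sym[of "p v0" "K v0"] by (simp add: p_K)
      have 2: "g (p v0) (J (K v0)) = 0"
        using g_K[of v0 "J (p v0)"] g_p[of v0 "J (K v0)"] g_J[of "K v0" "p v0"] sym[of "p v0" "J (K v0)"]
          by (simp add: p_K p_J K_J g_simps)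
      show "perp (p v0 - t *\<^sub>R v0) (K v0)"
        using o(3) 1 2 by (auto simp: perp_def g_simps)
    qed
    then have pv: "p v0 = t *\<^sub>R v0" by simp
    then have "p ?w = t *\<^sub>R ?w" by (simp add: p_K linear_scale[OF lin_K])
    then show ?thesis
      using that[OF o l(1) v0(1) False pl2(1) pv _ l(2)] perp_K[OF pl2(2)] by blast
  next
    case True
    obtain v b where v: "v \<noteq> 0" "v = v0 \<or> v = v0 + J (I v0)" "b = 1 \<or> b = - 1" "I v = - (b *\<^sub>R J v)"
      by (rule eigenvector_from_kernel[OF v0(1) True])
    note pv = eigenvector_values[OF v(4,3)]
    have ov: "perp v l"
      using v(2) v0(2) perp_I[OF l(3,2) v0(2)] by (auto intro: perp_add_left perp_smult_left)
    obtain w0 where w0: "w0 \<noteq> 0" "perp w0 l" "perp w0 v" by (rule ex_perp)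
    \<comment> \<open>\<open>K w0\<close> is orthogonal to \<open>l\<close> and \<open>v\<close>,
      which lie in the kernel of the skew map \<open>K\<close>, and to \<open>w0\<close> by
      \<open>perp_K_self\<close>.\<close>
    have Kw: "K w0 = 0"
      by (rule perp_all_imp_zero[of l v w0])
        (use ov w0 v(1) l(1) perp_sym perp_K[OF pl2(2)] perp_K[OF pv(2)] perp_K_self in blast)+
    have K0: "K u = 0" for u
      by (rule perp_all_imp_zero[of l v w0])
        (use ov w0 v(1) l(1) perp_sym perp_K[OF pl2(2)] perp_K[OF pv(2)] perp_K[OF Kw] in blast)+
    obtain w c where w: "w \<noteq> 0" "w = w0 \<or> w = w0 + J (I w0)" "c = 1 \<or> c = - 1" "I w = - (c *\<^sub>R J w)"
      by (rule eigenvector_from_kernel[OF w0(1) Kw])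
    note pw = eigenvector_values[OF w(4,3)]
    have ow: "perp w l" "perp w v"
      using w(2) w0(2,3) perp_I[OF l(3,2) w0(2)] perp_I[OF v(4,3) w0(3)] by (auto intro: perp_add_left perp_smult_left)
    show ?thesis
      using that[OF perp_sym[OF ov] perp_sym[OF ow(1)] perp_sym[OF ow(2)] l(1) v(1) w(1)
          pl2(1) pv(1) pw(1) l(2)] K0 v(3) w(3) by auto
  qed
qed

lemma matrix_p: "matrix p *v u = p u"
  by (rule complex_matrix_works[OF lin_p p_J])

lemma p_smult: "p (c *s u) = c *s p u"
  by (rule complex_linear_vec[OF lin_p p_J])

lemma invariants_matrix_p:
  assumes "perp l v" "perp l w" "perp v w" "l \<noteq> 0" "v \<noteq> 0" "w \<noteq> 0"
    and "p l = r *\<^sub>R l" "p v = s *\<^sub>R v" "p w = t *\<^sub>R w"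
  shows "trace (matrix p) = r + s + t" "pair_sign (matrix p) = pair_sign (diag3 r s t)"
proof -
  let ?T = "transpose (vector [l, v, w] :: complex ^ 3 ^ 3)"
  note T = perp_combination[OF assms(1-6)]
  have D: "diag3 r s t *v x = vector [r * x $ 1, s * x $ 2, t * x $ 3]" for x
    by (simp add: diag3_def vec_eq_iff forall_3 matrix_vector_mult_def sum_3)
  have "matrix p ** ?T = ?T ** diag3 r s t"
    unfolding matrix_eq matrix_vector_mul_assoc[symmetric] D
    by (simp add: T(2) matrix_p linear_add[OF lin_p] p_smult assms(7-9) scaleR_conv_vector_smult vec_eq_iff mult.commute mult.left_commute
        del: transpose_matrix_vector)
  from invariants_similar[OF this T(1)]
  show "trace (matrix p) = r + s + t" "pair_sign (matrix p) = pair_sign (diag3 r s t)"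
    by (simp_all add: invariants_diag3)
qed

lemma pair_sign_cases: "pair_sign (matrix p) = 1 \<or> pair_sign (matrix p) = - 1"
  and p_K_eigen: "p (K u) = (trace (matrix p) / 2 - pair_sign (matrix p)) *s K u"
proof -
  obtain l v w a s t where d: "perp l v" "perp l w" "perp v w" "l \<noteq> 0" "v \<noteq> 0" "w \<noteq> 0"
    "p l = (2 * a) *\<^sub>R l" "p v = s *\<^sub>R v" "p w = t *\<^sub>R w" and a: "a = 1 \<or> a = - 1"
    and alt: "s = t \<and> (\<forall>u. perp (K u) l) \<or> (\<forall>u. K u = 0) \<and> (s = 2 \<or> s = - 2) \<and> (t = 2 \<or> t = - 2)"
    by (rule diagonalisation)
  note inv = invariants_matrix_p[OF d]
  \<comment> \<open>If \<open>K = 0\<close>, all three eigenvalues are 2 or -2, so two coincide and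
    the remaining one plays the role of 2\<epsilon>. By symmetry of \<open>pair_sign\<close> the
    equal pair may be moved to the end.\<close>
  have diag: "pair_sign (diag3 2 x 2) = pair_sign (diag3 x 2 2)" "pair_sign (diag3 2 2 x) = pair_sign (diag3 x 2 2)"
    "pair_sign (diag3 (- 2) x (- 2)) = pair_sign (diag3 x (- 2) (- 2))"
    "pair_sign (diag3 (- 2) (- 2) x) = pair_sign (diag3 x (- 2) (- 2))" for x
    unfolding pair_sign_def invariants_diag3 by algebra+
  show "pair_sign (matrix p) = 1 \<or> pair_sign (matrix p) = - 1"
    using alt a by (auto simp: inv(2) pair_sign_diag3 diag)
  show "p (K u) = (trace (matrix p) / 2 - pair_sign (matrix p)) *s K u"
  proof (cases "K u = 0")
    case True
    then show ?thesis using linear_0[OF lin_p] by simp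
  next
    case False
    with alt have st: "s = t" and pl2: "perp (K u) l" by auto
    have "pair_sign (matrix p) = a" using a by (auto simp: inv(2) st pair_sign_diag3)
    then have t: "trace (matrix p) / 2 - pair_sign (matrix p) = t" by (simp add: inv(1) st field_simps)
    \<comment> \<open>The test vectors \<open>v\<close> and \<open>w\<close> have eigenvalue
      \<open>t\<close>, while the plane orthogonal to \<open>l\<close> contains \<open>K u\<close>
      and is stable under \<open>p\<close>.\<close>
    have "p (K u) - t *s K u = 0"
    proof (rule perp_all_imp_zero[OF d(1-6)])
      have *: "perp (p (K u) - t *s K u) x" if "p x = t *\<^sub>R x" for x
        using that by (simp add: perp_def g_simps g_p p_J J_scale scaleR_conv_vector_smult[symmetric])
      show "perp (p (K u) - t *s K u) v" "perp (p (K u) - t *s K u) w" using * d(8,9) st by auto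
      show "perp (p (K u) - t *s K u) l"
        using pl2 perp_p[OF d(7) pl2] by (simp add: perp_def g_simps scaleR_conv_vector_smult[symmetric])
    qed
    then show ?thesis by (simp add: t)
  qed
qed

text \<open>With \<open>K = 0\<close> the square of \<open>p\<close> is 4 and
  \<open>p = 2 J I\<close>; a vanishing defect makes \<open>p\<close> a scalar, so
  \<open>J I\<close> is plus or minus the identity.\<close>

lemma kernel_type:
  assumes K0: "\<And>u. K u = 0" and N: "pair_defect I = 0"
  shows "pair_sign (matrix p) = 1 \<and> (\<forall>u. I u = - J u) \<or> pair_sign (matrix p) = - 1 \<and> (\<forall>u. I u = J u)"
proof -
  define c where "c = trace (matrix p) / 2 - pair_sign (matrix p)"
  have N0: "matrix p = mat c" using N by (simp add: pair_defect_def c_def)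
  have p: "p u = c *s u" for u
    using matrix_p[of u] unfolding N0 by (simp add: matrix_vector_mult_def mat_def vec_eq_iff if_distrib if_distribR cong: if_cong)
  have "4 *\<^sub>R axis 1 1 = p (p (axis 1 1 :: complex ^ 3))" using K_K[of "axis 1 1"] K0 linear_0[OF lin_K] by simp
  then have "c * c = 4" by (simp add: p vec_eq_iff axis_def scaleR_conv_of_real split: if_splits) 
  then have "(c - 2) * (c + 2) = 0" by (simp add: algebra_simps)
  then have c: "c = 2 \<or> c = - 2" by (auto simp: eq_neg_iff_add_eq_0)
  have "mat c = diag3 c c c" by (simp add: diag3_def mat_def vec_eq_iff forall_3)
  then have sg: "pair_sign (matrix p) = (if c = 2 then 1 else - 1)"
    using c N0 pair_sign_diag3 by auto
  have "2 *\<^sub>R J (I u) = c *s u" for u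
    using K0[of u] p[of u] by (simp add: pair_sum_def pair_commutator_def scaleR_2)
  then have *: "J (2 *\<^sub>R J (I u)) = J (c *s u)" for u by simp
  have "2 *\<^sub>R I u = - (c *s J u)" for u
    using *[of u] by (simp add: J_scale JJ vec_eq_iff algebra_simps)
      (metis add.inverse_inverse)
  then have "2 * I u $ i = - (c * (J u $ i))" for u i
    by (simp add: vec_eq_iff scaleR_conv_of_real)
  with c sg show ?thesis
    by (auto simp: vec_eq_iff)
qed

text \<open>The bivector \<open>K g\<^sup>-\<^sup>1\<close> in complex coordinates: \<open>a k\<close> is the dual of the real part of the \<open>k\<close>-th coordinate.\<close>

lemma bivector_skew:
  assumes a: "\<And>k w. g (a k) w = Re (w $ k)"
  shows "K (a k) $ m = - K (a m) $ k"
proof -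
  have re: "Re (K (a k) $ m) = - Re (K (a m) $ k)"
    using g_K[of "a m" "a k"] sym by (simp add: a[symmetric])
  have im: "Im (K (a k) $ m) = - Im (K (a m) $ k)"
  proof -
    have *: "Im (w $ k) = - Re (J w $ k)" for w :: "complex ^ 3" and k by simp
    have "g (a m) (J (K (a k))) = - g (a k) (J (K (a m)))"
      using g_J[of "a m" "K (a k)"] g_K[of "J (a m)" "a k"] sym[of "a k" "K (J (a m))"] sym[of "K (a k)" "J (a m)"]
       g_K[of "a k" "J (a m)"]
      by (simp add: K_J g_simps)
    then show ?thesis unfolding * a[symmetric] by simp
  qed
  from re im show ?thesis unfolding complex_eq_iff uminus_complex.sel vector_uminus_component by blast
qed

lemma bivector_zero_imp:
  assumes a: "\<And>k w. g (a k) w = Re (w $ k)" and z: "\<And>k. K (a k) = 0"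
  shows "K u = 0"
proof -
  have "Re (K u $ k) = 0" for k u
    using g_K[of "a k" u] by (simp add: a[symmetric] z g_simps)
  from this[of u] this[of "J u"] show ?thesis
    by (simp add: K_J vec_eq_iff complex_eq_iff)
qed

text \<open>The bivector is annihilated by each row of \<open>pair_defect I\<close>, so a single entry, complementary to a nonzero entry
  of a row, controls all of it.\<close>

lemma bivector_entry_zero_imp:
  assumes a: "\<And>k w. g (a k) w = Re (w $ k)"
    and N: "pair_defect I $ r $ i \<noteq> 0"
    and ijk: "UNIV = {i, j, k}" "i \<noteq> j" "i \<noteq> k" "j \<noteq> (k::3)" and z: "K (a k) $ j = 0"
  shows "K u = 0"
proof (rule bivector_zero_imp[OF a])
  note skew = bivector_skew[OF a]
  let ?N = "pair_defect I"
  have "mat d *v y = d *s y" for d and y :: "complex ^ 3"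
    by (simp add: matrix_vector_mult_def mat_def vec_eq_iff if_distrib if_distribR cong: if_cong)
  then have "?N *v K u = 0" for u
    by (simp add: pair_defect_def matrix_vector_mult_diff_rdistrib matrix_p p_K_eigen)
  then have row: "?N $ r $ i * K u $ i + ?N $ r $ j * K u $ j + ?N $ r $ k * K u $ k = 0" for u
    using ijk(2-4) by (simp add: vec_eq_iff matrix_vector_mult_def ijk(1) add.assoc)
  have d: "K (a m) $ m = 0" for m
    using arg_cong[OF skew[of m m], of "\<lambda>z. z + K (a m) $ m"] by simp
  have jk: "K (a j) $ k = 0" using skew[of k j] z by simp
  have ji: "K (a j) $ i = 0" using row[of "a j"] d[of j] jk N by simp
  have ki: "K (a k) $ i = 0" using row[of "a k"] d[of k] z N by simp
  have ij: "K (a i) $ j = 0" and ik: "K (a i) $ k = 0" using skew[of i j] skew[of i k] ji ki by simp_all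
  have "K (a m) $ n = 0" for m n
  proof -
    have "m \<in> {i, j, k}" "n \<in> {i, j, k}" using ijk(1) by auto
    then show ?thesis using d z jk ji ki ij ik by auto
  qed
  then show "K (a m) = 0" for m by (simp add: vec_eq_iff)
qed

text \<open>\<open>G\<close> and \<open>G - h\<close> are the connection forms of \<open>\<nabla>\<^sup>+\<close> and \<open>\<nabla>\<^sup>-\<close>; the torsion \<open>h\<close> of \<open>\<nabla>\<^sup>+\<close> is of type
  \<open>(2,1) + (1,2)\<close> because \<open>J\<close> is constant.\<close>

lemma bivector_derivative_J_linear:
  assumes G_add: "\<And>u. linear (G u)" and GJ: "\<And>u v. G u (J v) = J (G u v)"
    and Gh: "\<And>u v. G u v - G v u = h u v"
    and hH: "\<And>u v w. g (h u v) w = H u v w"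
    and H: "\<And>u v w. H u v w = - H u w v"
  defines "Q \<equiv> \<lambda>u a b. g a (G u (K b)) - g (G u (K a)) b
    - (H u a (I (J b)) + H u (I a) (J b) + H u (J a) (I b) + H u (I (J a)) b)"
  shows "Q (J u) a b = - Q u a (J b)"
proof -
  have R: "G (J u) v - J (G u v) = h (J u) v - J (h u v)" for v
    using Gh[of "J u" v] Gh[of u v] GJ[of v u] by (simp add: J_diff[symmetric] algebra_simps)
  \<comment> \<open>Taking \<open>R\<close> at \<open>v\<close> and at \<open>J v\<close>, with the
    second slot of \<open>G\<close> complex linear, eliminates \<open>G\<close> and leaves a
    condition on the torsion alone.\<close>
  have R': "h (J u) (J v) - J (h u (J v)) = J (h (J u) v) + h u v" for v
    using R[of v] R[of "J v"] by (simp add: GJ J_diff[symmetric] JJ) (metis J_diff JJ diff_minus_eq_add)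
  have type: "H (J u) (J v) w + H (J u) v (J w) = H u v w - H u (J v) (J w)" for v w
    using arg_cong[OF R'[of v], of "\<lambda>z. g z w"] by (simp add: g_simps g_J hH)
  have GK: "g (G (J u) v) w + g (G u v) (J w) = H (J u) v w + H u v (J w)" for v w
    using arg_cong[OF R[of v], of "\<lambda>z. g z w"] by (simp add: g_simps g_J hH)
  have H_diff: "H u (v - v') w = H u v w - H u v' w" and H_minus: "H u v (- w) = - H u v w" for u v v' w
  proof -
    show m: "H u v (- w) = - H u v w" for v w by (simp add: hH[symmetric] g_simps)
    have "H u w (v - v') = H u w v - H u w v'" by (simp add: hH[symmetric] g_simps)
    then show "H u (v - v') w = H u v w - H u v' w" using H[of u _ w] by simp
  qed
  \<comment> \<open>In the sum of both sides the connection form occurs only in combinations that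
    \<open>GK\<close> rewrites as torsion.\<close>
  have "g a (G (J u) (K b)) + g a (G u (K (J b))) = H (J u) (K b) a + H u (K b) (J a)"
  proof -
    have "g a (G u (K (J b))) = g (G u (K b)) (J a)"
      using sym[of a "J (G u (K b))"] by (simp add: K_J linear_neg[OF G_add] GJ g_simps g_J)
    then show ?thesis using GK[of "K b" a] sym[of a] by simp
  qed
  moreover note GK[of "K a" b]
  ultimately have "Q (J u) a b + Q u a (J b) =
     H (J u) (K b) a + H u (K b) (J a) - (H (J u) (K a) b + H u (K a) (J b))
     - (H (J u) a (I (J b)) + H (J u) (I a) (J b) + H (J u) (J a) (I b) + H (J u) (I (J a)) b)
     - (H u a (I (J (J b))) + H u (I a) (J (J b)) + H u (J a) (I (J b)) + H u (I (J a)) (J b))"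
    by (simp add: Q_def)
  \<comment> \<open>The remaining terms cancel by the type condition for the pairs
    \<open>I a\<close>, \<open>b\<close> and \<open>a\<close>, \<open>I b\<close>, after exchanges
    of the last two slots.\<close>
  also have "\<dots> = 0"
    unfolding pair_commutator_def H_diff JJ H_minus I_simps
    using type[of "I a" b] type[of a "I b"] H[of "J u" "J (I b)" a] H[of "J u" "I (J b)" a]
      H[of u "J (I b)" "J a"] H[of u "I (J b)" "J a"]
    by linarith
  finally show ?thesis by simp
qed

end

section \<open>Holomorphy of the bivector\<close>

text \<open>The isomorphism from vectors to covectors, with covectors turned into vectors by the
  standard inner product. It presents the inverse metric as the inverse of a family of
  endomorphisms, to which \<open>Ck_on_inverse_family\<close> applies.\<close>

definition metric_map :: "('a::euclidean_space \<Rightarrow> 'a \<Rightarrow> real) \<Rightarrow> 'a \<Rightarrow> 'a" where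
  "metric_map G z = (\<Sum>b\<in>Basis. G z b *\<^sub>R b)"

lemma metric_map_inner:
  assumes "bilinear G"
  shows "metric_map G z \<bullet> w = G z w"
proof -
  have "G z w = (\<Sum>b\<in>Basis. (w \<bullet> b) *\<^sub>R G z b)"
    using assms by (intro linear_basis_expansion) (simp add: bilinear_def)
  then show ?thesis
    by (simp add: metric_map_def inner_sum_left inner_commute[of w] mult.commute)
qed

lemma metric_map_linear:
  assumes "bilinear G"
  shows "linear (metric_map G)"
  by (simp add: linear_iff metric_map_def bilinear_ladd[OF assms] bilinear_lmul[OF assms]
      scaleR_add_left sum.distrib scaleR_sum_right)

lemma metric_map_inj:
  assumes "bilinear G" "\<And>u. u \<noteq> 0 \<Longrightarrow> G u u > 0"
  shows "inj (metric_map G)"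
  unfolding linear_injective_0[OF metric_map_linear[OF assms(1)]]
  using assms(2) metric_map_inner[OF assms(1)] by (metis inner_zero_left less_irrefl)

lemma metric_map_inv:
  assumes "bilinear G" "\<And>u. u \<noteq> 0 \<Longrightarrow> G u u > 0"
  shows "G (inv (metric_map G) y) w = y \<bullet> w"
proof -
  have "metric_map G (inv (metric_map G) y) = y"
    using linear_injective_imp_surjective[OF metric_map_linear metric_map_inj] assms surj_f_inv_f by metis
  then show ?thesis using metric_map_inner[OF assms(1)] by metis
qed

lemma raise_eq:
  assumes b: "bilinear (g c x)" and pos: "\<And>u. u \<noteq> 0 \<Longrightarrow> g c x u u > 0" and \<alpha>: "linear \<alpha>"
  shows "g c x (raise g c x \<alpha>) w = \<alpha> w"
proof -
  define y where "y = (\<Sum>b\<in>Basis. \<alpha> b *\<^sub>R b)"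
  have y: "y \<bullet> w = \<alpha> w" for w
    using linear_basis_expansion[OF \<alpha>, of w]
    by (simp add: y_def inner_sum_left inner_commute[of w] mult.commute)
  have "\<exists>!z. \<forall>w. g c x z w = \<alpha> w"
  proof (rule ex1I)
    show "\<forall>w. g c x (inv (metric_map (g c x)) y) w = \<alpha> w"
      using metric_map_inv[OF b pos] y by auto
    fix z assume "\<forall>w. g c x z w = \<alpha> w"
    then have "metric_map (g c x) z = y"
      using metric_map_inner[OF b] y by (metis inner_commute vector_eq_ldot)
    then show "z = inv (metric_map (g c x)) y"
      using metric_map_inj[OF b pos] by (metis inv_f_f)
  qed
  from theI'[OF this] show ?thesis by (simp add: raise_def)
qed

lemma bihermitian_pointwise:
  fixes A :: "('a::{t2_space,second_countable_topology}, 3) chart set"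
  assumes B: "bihermitian A g Jp Jm" and c: "c \<in> A" "holomorphic_chart Jp c" "x \<in> fst c"
  shows "orthogonal_complex_structure (g c x) (Jm c x)"
proof (rule orthogonal_complex_structure.intro)
  have J: "Jp c x u = \<i> *s u" for u using c by (simp add: holomorphic_chart_def)
  show "bilinear (g c x)" "\<And>u v. g c x u v = g c x v u" "\<And>u. u \<noteq> 0 \<Longrightarrow> 0 < g c x u u"
    using B c by (auto simp: bihermitian_def riemannian_metric_def)
  have "g c x (Jp c x u) (Jp c x v) = g c x u v" for u v
    using B c unfolding bihermitian_def orthogonal_endomorphism_def by blast
  then show "\<And>u v. g c x (\<i> *s u) (\<i> *s v) = g c x u v" by (simp add: J)
  show "\<And>u. Jm c x (Jm c x u) = - u"
    using B c unfolding bihermitian_def complex_structure_def almost_complex_structure_def by blast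
  have "linear (Jm c x)"
    using B c unfolding bihermitian_def complex_structure_def almost_complex_structure_def
      endomorphism_field_def by blast
  show "linear (Jm c x)" by fact
  show "\<And>u v. g c x (Jm c x u) (Jm c x v) = g c x u v"
    using B c unfolding bihermitian_def orthogonal_endomorphism_def by blast
qed

text \<open>The derivative of the bivector is made algebraic: parallelism removes the derivative of
  \<open>Jm\<close>, metric compatibility that of \<open>a\<close>, and \<open>Jp\<close> is
  constant in the chart. The Cauchy-Riemann equations then reduce to
  \<open>bivector_derivative_J_linear\<close>.\<close>

lemma bivector_holomorphic:
  fixes A :: "('a::{t2_space,second_countable_topology}, 3) chart set"
  assumes B: "bihermitian A g Jp Jm" and c: "c \<in> A" and hc: "holomorphic_chart Jp c"
  defines "a \<equiv> \<lambda>k x. inv (metric_map (g c x)) (axis k 1)"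
  shows bivector_dual: "x \<in> fst c \<Longrightarrow> g c x (a k x) w = Re (w $ k)"
    and "hol_on (snd c ` fst c)
      (\<lambda>z. pair_commutator (Jm c (chart_inv c z)) (a k (chart_inv c z)) $ m)"
proof -
  note OCS = bihermitian_pointwise[OF B c hc]
  have bil: "bilinear (g c x)" and gpos: "\<And>u. u \<noteq> 0 \<Longrightarrow> g c x u u > 0" if "x \<in> fst c" for x
    using B c that by (auto simp: bihermitian_def riemannian_metric_def)
  show ga: "g c x (a k x) w = Re (w $ k)" if "x \<in> fst c" for x k w
    using metric_map_inv[OF bil[OF that] gpos[OF that], of "axis k 1" w]
    by (simp add: a_def inner_axis' inner_complex_def)
  let ?U = "snd c ` fst c"
  have ch: "is_chart c" using B c smooth_structureD(1) unfolding bihermitian_def by blast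
  have U: "open ?U" using ch by (simp add: is_chart_def)
  define gz where "gz z = g c (chart_inv c z)" for z
  define Iz where "Iz z = Jm c (chart_inv c z)" for z
  define az where "az z = inv (metric_map (gz z)) (axis k 1)" for z
  have inU: "chart_inv c z \<in> fst c" if "z \<in> ?U" for z using chart_inv_in[OF ch that] .
  have sg: "Ck_on n ?U (\<lambda>z. gz z u v)" for n u v
    using B c unfolding bihermitian_def riemannian_metric_def smooth_in_chart_def smooth_on_def gz_def o_def
    by blast
  have sI: "Ck_on n ?U (\<lambda>z. Iz z v)" for n v
    using B c unfolding bihermitian_def complex_structure_def almost_complex_structure_def
      endomorphism_field_def smooth_in_chart_def smooth_on_def Iz_def o_def
    by blast
  have saz: "Ck_on n ?U az" for n
    unfolding az_def
  proof (rule Ck_on_inverse_family[OF U])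
    show "linear (metric_map (gz z))" "inj (metric_map (gz z))" if "z \<in> ?U" for z
      using metric_map_linear metric_map_inj bil gpos inU[OF that] unfolding gz_def by blast+
    show "Ck_on n ?U (\<lambda>z. metric_map (gz z) u)" for u
      unfolding metric_map_def by (intro Ck_on_sum U Ck_on_scaleR sg Ck_on_const)
  qed
  have linI: "linear (Iz z)" if "z \<in> ?U" for z
    using orthogonal_complex_structure.linI[OF OCS[OF inU[OF that]]] by (simp add: Iz_def)
  have linK: "linear (pair_commutator (Iz z))" if "z \<in> ?U" for z
    using orthogonal_complex_structure.lin_K[OF OCS[OF inU[OF that]]] by (simp add: Iz_def)
  have blJ: "bounded_linear (\<lambda>u::complex^3. \<i> *s u)"
    by (intro linear_conv_bounded_linear[THEN iffD1] linearI) (auto simp: vec_eq_iff algebra_simps)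
  have sK: "Ck_on n ?U (\<lambda>z. pair_commutator (Iz z) u)" for n u
  proof -
    have "Ck_on n ?U (\<lambda>z. \<i> *s Iz z u + - Iz z (\<i> *s u))"
      by (intro Ck_on_add Ck_on_bounded_linear[OF blJ] Ck_on_bounded_linear[OF bounded_linear_minus[OF bounded_linear_ident]] sI U)
    then show ?thesis by (simp add: pair_commutator_def)
  qed
  have sF: "Ck_on n ?U (\<lambda>z. pair_commutator (Iz z) (az z))" for n
    by (rule Ck_on_family_apply[OF U linK sK saz])
  have key: "frechet_derivative (\<lambda>z. pair_commutator (Iz z) (az z)) (at z) (\<i> *s u) =
      \<i> *s frechet_derivative (\<lambda>z. pair_commutator (Iz z) (az z)) (at z) u" if z: "z \<in> ?U" for z u
  proof -
    define x where "x = chart_inv c z"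
    have x: "x \<in> fst c" and sx: "snd c x = z"
      using inU[OF z] chart_inv_right[OF ch z] by (auto simp: x_def)
    interpret orthogonal_complex_structure "gz z" "Iz z"
      using OCS[OF x] by (simp add: gz_def Iz_def x_def)
    obtain \<Gamma> H where LC: "levi_civita A g \<Gamma>" and H: "three_form A H"
      and par: "parallel A (torsion_connection g H \<Gamma> (1/2)) Jp"
        "parallel A (torsion_connection g H \<Gamma> (-1/2)) Jm"
      using B unfolding bihermitian_def closed_three_form_def by blast
    define h where "h u v = raise g c x (H c x u v)" for u v
    define G where "G u v = torsion_connection g H \<Gamma> (1/2) c x u v" for u v
    have H3: "\<And>w. bilinear (\<lambda>u v. H c x u v w)" "\<And>u v. linear (H c x u v)"
      "\<And>u v w. H c x u v w = - H c x v u w" "\<And>u v w. H c x u v w = - H c x u w v"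
      using H c x unfolding three_form_def by blast+
    have hH: "gz z (h u v) w = H c x u v w" for u v w
      using raise_eq[of g c x, OF bil[OF x] gpos[OF x] H3(2)] by (simp add: h_def gz_def x_def)
    have eqI: "y = y'" if "\<And>w. gz z y w = gz z y' w" for y y'
      using g_nondeg[of "y - y'"] that by (simp add: g_simps)
    have linh: "linear (h u)" for u
      by (rule linearI; rule eqI)
        (simp_all add: g_simps hH bilinear_radd[OF H3(1)] bilinear_rmul[OF H3(1)])
    have hskew: "h u v = - h v u" for u v
      by (rule eqI) (simp add: g_simps hH, rule H3(3))
    have \<Gamma>: "bilinear (\<Gamma> c x)" "\<And>u v. \<Gamma> c x u v = \<Gamma> c x v u"
      using LC c x unfolding levi_civita_def affine_connection_def by blast+
    have G: "G u v = \<Gamma> c x u v + (1/2) *\<^sub>R h u v" for u v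
      by (simp add: G_def torsion_connection_def h_def)
    have linG: "linear (G u)" for u
      using linear_add[OF linh] linear_scale[OF linh]
      by (simp add: linear_iff G bilinear_radd[OF \<Gamma>(1)] bilinear_rmul[OF \<Gamma>(1)] algebra_simps)
    have Gh: "G u v - G v u = h u v" for u v
      using hskew[of v u] \<Gamma>(2)[of u v] by (simp add: G scaleR_2[symmetric] flip: scaleR_left_distrib)
    have GJ: "G u (J v) = J (G u v)" for u v
    proof -
      \<comment> \<open>In this chart \<open>Jp\<close> is constantly multiplication by
        \<open>\<i>\<close>, so its parallelism says that the connection form commutes with
        \<open>\<i>\<close>.\<close>
      have "((\<lambda>y. Jp c y v) \<circ> chart_inv c has_derivative (\<lambda>_. 0)) (at z)"
        by (rule has_derivative_transform_within_open[OF has_derivative_const[of "J v"] U z])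
          (use hc inU in \<open>auto simp: holomorphic_chart_def\<close>)
      then have "chart_deriv c (\<lambda>y. Jp c y v) x u = 0"
        by (simp add: chart_deriv_def sx frechet_derivativeI)
      moreover have "chart_deriv c (\<lambda>y. Jp c y v) x u + G u (Jp c x v) = Jp c x (G u v)"
        using par(1) c x unfolding parallel_def G_def by blast
      moreover have "Jp c x v = J v" for v using hc x by (simp add: holomorphic_chart_def)
      ultimately show ?thesis by simp
    qed
    define X where "X u v = frechet_derivative (\<lambda>z. Iz z v) (at z) u" for u v
    have X: "X u v = I' (G u v) - I' (h u v) - (G u (I' v) - h u (I' v))" if "I' = Iz z" for u v I'
    proof -
      have "X u v = chart_deriv c (\<lambda>y. Jm c y v) x u"
        by (simp add: X_def chart_deriv_def sx Iz_def o_def)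
      moreover have "chart_deriv c (\<lambda>y. Jm c y v) x u + torsion_connection g H \<Gamma> (-1/2) c x u (Jm c x v) =
          Jm c x (torsion_connection g H \<Gamma> (-1/2) c x u v)"
        using par(2) c x unfolding parallel_def by blast
      \<comment> \<open>Half of \<open>h\<close> was added to the Levi-Civita form in
        \<open>G\<close>, and half is subtracted here.\<close>
      moreover have tor: "torsion_connection g H \<Gamma> (-1/2) c x u v = G u v - h u v" for v
      proof -
        have "(1/2) *\<^sub>R h u v - h u v = (-1/2) *\<^sub>R h u v"
          using scaleR_left_diff_distrib[of "1/2" 1 "h u v"] by simp
        then show ?thesis
          unfolding G torsion_connection_def h_def[symmetric] add_diff_eq[symmetric] by simp
      qed
      moreover have "Jm c x = I'" by (simp add: that Iz_def x_def)
      ultimately have "X u v + (G u (I' v) - h u (I' v)) = I' (G u v - h u v)" by simp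
      then show ?thesis
        using that by (simp add: I_simps eq_diff_eq)
    qed
    define a' where "a' = frechet_derivative az (at z)"
    have Daz: "(az has_derivative a') (at z)"
      using Ck_on_Suc_has_derivative[OF saz z] by (simp add: a'_def)
    have DI: "((\<lambda>z. Iz z v) has_derivative (\<lambda>u. X u v)) (at z)" for v
      using Ck_on_Suc_has_derivative[OF sI z] by (simp add: X_def)
    have DK: "((\<lambda>z. pair_commutator (Iz z) v) has_derivative (\<lambda>u. J (X u v) - X u (J v))) (at z)" for v
      unfolding pair_commutator_def
      by (intro has_derivative_diff DI bounded_linear.has_derivative[OF blJ])
    have DF: "frechet_derivative (\<lambda>z. pair_commutator (Iz z) (az z)) (at z) u =
        J (X u (az z)) - X u (J (az z)) + K (a' u)" for u
      using frechet_derivativeI[OF has_derivative_family_apply[OF U z linK DK Daz]] by simp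
    define DG where "DG u v w = frechet_derivative (\<lambda>z. gz z v w) (at z) u" for u v w
    have Dg: "((\<lambda>z. gz z v w) has_derivative (\<lambda>u. DG u v w)) (at z)" for v w
      using Ck_on_Suc_has_derivative[OF sg z] by (simp add: DG_def)
    have DGG: "DG u v w = gz z (G u v) w + gz z v (G u w)" for u v w
    proof -
      have "DG u v w = chart_deriv c (\<lambda>y. g c y v w) x u"
        by (simp add: DG_def chart_deriv_def sx gz_def o_def)
      also have "\<dots> = g c x (\<Gamma> c x u v) w + g c x v (\<Gamma> c x u w)"
        using LC c x unfolding levi_civita_def by blast
      finally have 1: "DG u v w = gz z (\<Gamma> c x u v) w + gz z v (\<Gamma> c x u w)"
        by (simp add: gz_def x_def)
      \<comment> \<open>The torsion term is skew for \<open>g\<close>, so adding it to the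
        Levi-Civita form keeps the metric parallel.\<close>
      have "gz z (h u v) w + gz z v (h u w) = 0"
        using sym[of v "h u w"] H3(4)[of u v w] by (simp add: hH)
      with 1 show ?thesis by (simp add: G g_simps)
    qed
    have Da: "gz z (a' u) w = - (gz z (G u (az z)) w + gz z (az z) (G u w))" for u w
    proof -
      have lin: "linear (\<lambda>v. gz y v w)" if "y \<in> ?U" for y
        using bil[OF inU[OF that]] by (simp add: gz_def bilinear_def)
      have "((\<lambda>y. gz y (az y) w) has_derivative (\<lambda>u. DG u (az z) w + gz z (a' u) w)) (at z)"
        by (rule has_derivative_family_apply[OF U z lin Dg Daz])
      \<comment> \<open>The pairing of \<open>az\<close> with a constant vector is the constant
        \<open>Re (w $ k)\<close>, so the derivative of \<open>az\<close> is determined by that of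
        the metric.\<close>
      moreover have "((\<lambda>y. gz y (az y) w) has_derivative (\<lambda>_. 0)) (at z)"
        by (rule has_derivative_transform_within_open[OF has_derivative_const[of "Re (w $ k)"] U z])
          (use ga inU in \<open>auto simp: gz_def az_def a_def\<close>)
      ultimately have "(\<lambda>u. DG u (az z) w + gz z (a' u) w) = (\<lambda>_. 0)"
        by (rule has_derivative_unique)
      then have "DG u (az z) w + gz z (a' u) w = 0" by metis
      then show ?thesis by (simp add: DGG)
    qed
    \<comment> \<open>This will be the derivative of the bivector in direction \<open>u\<close>,
      paired with \<open>b\<close>.\<close>
    define Q where "Q u b = gz z (az z) (G u (K b)) - gz z (G u (K (az z))) b
      - (H c x u (az z) (Iz z (J b)) + H c x u (Iz z (az z)) (J b) + H c x u (J (az z)) (Iz z b)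
         + H c x u (Iz z (J (az z))) b)" for u b
    have FQ: "gz z (J (X u (az z)) - X u (J (az z)) + K (a' u)) b = Q u b" for u b
    proof -
      let ?a = "az z"
      have "gz z (K (a' u)) b = gz z (G u ?a) (K b) + gz z ?a (G u (K b))"
        by (simp add: g_K Da)
      moreover have "gz z (G u ?a) (K b) = - gz z (K (G u ?a)) b" by (simp add: g_K)
      moreover have "gz z (J (X u ?a) - X u (J ?a)) b = gz z (K (G u ?a)) b - gz z (G u (K ?a)) b
        - (H c x u ?a (Iz z (J b)) + H c x u (Iz z ?a) (J b) + H c x u (J ?a) (Iz z b)
         + H c x u (Iz z (J ?a)) b)"
        by (simp add: X[OF refl] pair_commutator_def g_simps g_J g_I hH GJ linear_diff[OF linG] J_diff)
      ultimately show ?thesis by (simp add: g_simps Q_def)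
    qed
    have "Q (J u) b = - Q u (J b)" for b
      unfolding Q_def
      by (rule bivector_derivative_J_linear[OF linG GJ Gh hH H3(4)])
    then show ?thesis
      unfolding DF by (intro eqI) (simp only: FQ g_J)
  qed
  have bln: "bounded_linear (\<lambda>v::complex^3. v $ m)" by (rule bounded_linear_vec_nth)
  have sFm: "smooth_on ?U (\<lambda>z. pair_commutator (Iz z) (az z))"
    using sF by (simp add: smooth_on_def)
  have "hol_on ?U (\<lambda>z. pair_commutator (Iz z) (az z) $ m)"
    unfolding hol_on_def
  proof (intro conjI ballI allI)
    show "smooth_on ?U (\<lambda>z. pair_commutator (Iz z) (az z) $ m)"
      by (rule smooth_on_bounded_linear[OF bln sFm U])
    show "frechet_derivative (\<lambda>z. pair_commutator (Iz z) (az z) $ m) (at z) (\<i> *s u) =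
        \<i> * frechet_derivative (\<lambda>z. pair_commutator (Iz z) (az z) $ m) (at z) u" if "z \<in> ?U" for z u
      by (simp add: frechet_derivative_bounded_linear_compose[OF bln sFm that] key[OF that])
  qed
  then show "hol_on ?U (\<lambda>z. pair_commutator (Jm c (chart_inv c z)) (a k (chart_inv c z)) $ m)"
    by (simp add: Iz_def az_def gz_def a_def)
qed

section \<open>The commuting locus\<close>

text \<open>The loci quantify over all charts, whereas the pointwise algebra takes place in one
  holomorphic chart; the transformation law carries the relation over. The factors 1 and -1 give the
  two types.\<close>

lemma endomorphism_field_relation_transport:
  assumes A: "smooth_structure A" "c \<in> A" "d \<in> A" and x: "x \<in> fst c" "x \<in> fst d"
    and J: "endomorphism_field A J" "endomorphism_field A J'"
    and r: "\<And>u. J c x u = s *\<^sub>R J' c x u"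
  shows "J d x u = s *\<^sub>R J' d x u"
proof -
  have xx: "x \<in> fst c \<inter> fst d" "x \<in> fst d \<inter> fst c" using x by auto
  define w where "w = jacobian d c x u"
  have u: "u = jacobian c d x w" using jacobian_inverse[OF A(1,3,2) xx(2)] by (simp add: w_def)
  have T: "J d x (jacobian c d x w) = jacobian c d x (J c x w)"
    "J' d x (jacobian c d x w) = jacobian c d x (J' c x w)"
    using J A xx unfolding endomorphism_field_def by blast+
  then show ?thesis
    by (simp add: u r linear_scale[OF jacobian_linear[OF A xx(1)]])
qed

lemma commuting_transport:
  assumes A: "smooth_structure A" "c \<in> A" "d \<in> A" and x: "x \<in> fst c" "x \<in> fst d"
    and J: "endomorphism_field A J" "endomorphism_field A J'"
    and r: "\<And>u. J c x (J' c x u) = J' c x (J c x u)"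
  shows "J d x (J' d x u) = J' d x (J d x u)"
proof -
  have xx: "x \<in> fst c \<inter> fst d" "x \<in> fst d \<inter> fst c" using x by auto
  define w where "w = jacobian d c x u"
  have u: "u = jacobian c d x w" using jacobian_inverse[OF A(1,3,2) xx(2)] by (simp add: w_def)
  have "J d x (jacobian c d x w) = jacobian c d x (J c x w)"
    "J' d x (jacobian c d x w) = jacobian c d x (J' c x w)" for w
    using J A xx unfolding endomorphism_field_def by blast+
  then show ?thesis by (simp add: u r)
qed

lemma bihermitian_endomorphism_fields:
  assumes "bihermitian A g Jp Jm"
  shows "smooth_structure A" "endomorphism_field A Jp" "endomorphism_field A Jm"
  using assms by (auto simp: bihermitian_def complex_structure_def almost_complex_structure_def)

lemma commuting_locus_iff:
  fixes A :: "('a::{t2_space,second_countable_topology}, 'n::finite) chart set"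
  assumes B: "bihermitian A g Jp Jm" and c: "c \<in> A" "holomorphic_chart Jp c" "x \<in> fst c"
  shows "x \<in> commuting_locus A Jp Jm \<longleftrightarrow> (\<forall>u. pair_commutator (Jm c x) u = 0)"
proof -
  note E = bihermitian_endomorphism_fields[OF B]
  have J: "Jp c x u = \<i> *s u" for u using c by (simp add: holomorphic_chart_def)
  have M: "x \<in> manifold A" using c by (auto simp: manifold_def)
  show ?thesis
  proof
    assume "x \<in> commuting_locus A Jp Jm"
    then show "\<forall>u. pair_commutator (Jm c x) u = 0"
      using c by (auto simp: commuting_locus_def pair_commutator_def J)
  next
    assume "\<forall>u. pair_commutator (Jm c x) u = 0"
    then have "Jp c x (Jm c x u) = Jm c x (Jp c x u)" for u
      by (simp add: pair_commutator_def J)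
    then have "Jp d x (Jm d x u) = Jm d x (Jp d x u)" if "d \<in> A" "x \<in> fst d" for d u
      using commuting_transport[OF E(1) c(1) that(1) c(3) that(2) E(2,3)] by blast
    then show "x \<in> commuting_locus A Jp Jm"
      using M by (auto simp: commuting_locus_def)
  qed
qed

section \<open>Continuity and constancy of the sign\<close>

abbreviation pair_matrix :: "('a, 3) endo_field \<Rightarrow> ('a, 3) chart \<Rightarrow> 'a \<Rightarrow> complex ^ 3 ^ 3" where
  "pair_matrix J c x \<equiv> matrix (pair_sum (J c x))"

lemma continuous_on_pair_matrix:
  fixes A :: "('a::{t2_space,second_countable_topology}, 3) chart set"
  assumes A: "smooth_structure A" "c \<in> A" and J: "endomorphism_field A J"
  shows "continuous_on (fst c) (\<lambda>x. pair_matrix J c x $ i $ j)"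
proof -
  have "continuous_on (fst c) (\<lambda>x. J c x u)" for u
    using smooth_in_chart_continuous_on[OF smooth_structureD(1)[OF A]] J A(2)
    unfolding endomorphism_field_def by blast
  then show ?thesis
    unfolding matrix_def pair_sum_def vec_lambda_beta vector_add_component vector_smult_component
    by (intro continuous_intros)
qed

lemma continuous_on_pair_invariants:
  fixes A :: "('a::{t2_space,second_countable_topology}, 3) chart set"
  assumes A: "smooth_structure A" "c \<in> A" and J: "endomorphism_field A J"
  shows "continuous_on (fst c) (\<lambda>x. pair_sign (pair_matrix J c x))"
    and "continuous_on (fst c) (\<lambda>x. pair_defect (J c x) $ r $ i)"
proof -
  note m = continuous_on_pair_matrix[OF assms]
  have tr: "continuous_on (fst c) (\<lambda>x. trace (pair_matrix J c x))"
    unfolding trace_def by (intro continuous_intros m)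
  have tr2: "continuous_on (fst c) (\<lambda>x. trace (pair_matrix J c x ** pair_matrix J c x))"
    unfolding trace_def matrix_matrix_mult_def vec_lambda_beta by (intro continuous_intros m)
  have dt: "continuous_on (fst c) (\<lambda>x. det (pair_matrix J c x))"
    unfolding det_3 by (intro continuous_on_add continuous_on_diff continuous_on_mult m)
  show sg: "continuous_on (fst c) (\<lambda>x. pair_sign (pair_matrix J c x))"
    unfolding pair_sign_def by (intro continuous_intros tr tr2 dt) auto
  have "continuous_on (fst c) (\<lambda>x. (trace (pair_matrix J c x) / 2 - pair_sign (pair_matrix J c x)))"
    by (intro continuous_intros tr sg) auto
  then have "continuous_on (fst c) (\<lambda>x. mat (trace (pair_matrix J c x) / 2 - pair_sign (pair_matrix J c x)) $ r $ i)"
    by (cases "r = i") (simp_all add: mat_def)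
  then show "continuous_on (fst c) (\<lambda>x. pair_defect (J c x) $ r $ i)"
    unfolding pair_defect_def vector_minus_component by (intro continuous_on_diff m)
qed

text \<open>Between two \<open>Jp\<close>-holomorphic charts the Jacobian is complex linear, so it
  conjugates the complex matrices of \<open>pair_sum\<close>.\<close>

lemma pair_sign_chart_independent:
  fixes A :: "('a::{t2_space,second_countable_topology}, 3) chart set"
  assumes B: "bihermitian A g Jp Jm"
    and c: "c \<in> A" "holomorphic_chart Jp c" "x \<in> fst c"
    and d: "d \<in> A" "holomorphic_chart Jp d" "x \<in> fst d"
  shows "pair_sign (pair_matrix Jm d x) = pair_sign (pair_matrix Jm c x)"
proof -
  note E = bihermitian_endomorphism_fields[OF B]
  have cd: "x \<in> fst c \<inter> fst d" and dc: "x \<in> fst d \<inter> fst c" using c d by auto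
  let ?j = "jacobian c d x" and ?k = "jacobian d c x"
  have ji: "?j (\<i> *s u) = \<i> *s ?j u" and ki: "?k (\<i> *s u) = \<i> *s ?k u" for u
  proof -
    have "Jp d x (?j u) = ?j (Jp c x u)" "Jp c x (?k u) = ?k (Jp d x u)"
      using E(2) c d cd dc unfolding endomorphism_field_def by blast+
    then show "?j (\<i> *s u) = \<i> *s ?j u" "?k (\<i> *s u) = \<i> *s ?k u"
      using c d by (simp_all add: holomorphic_chart_def)
  qed
  have lj: "linear ?j" and lk: "linear ?k" using jacobian_linear[OF E(1)] c d cd dc by blast+
  have mj: "matrix ?j *v u = ?j u" and mk: "matrix ?k *v u = ?k u" for u
    using complex_matrix_works[OF lj ji] complex_matrix_works[OF lk ki] by blast+
  have mc: "pair_matrix Jm c x *v u = pair_sum (Jm c x) u" for u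
    by (rule orthogonal_complex_structure.matrix_p[OF bihermitian_pointwise[OF B c]])
  have md: "pair_matrix Jm d x *v u = pair_sum (Jm d x) u" for u
    by (rule orthogonal_complex_structure.matrix_p[OF bihermitian_pointwise[OF B d]])
  have Jj: "Jm d x (?j u) = ?j (Jm c x u)" for u
    using E(3) c d cd unfolding endomorphism_field_def by blast
  have "pair_matrix Jm d x ** matrix ?j = matrix ?j ** pair_matrix Jm c x"
    unfolding matrix_eq matrix_vector_mul_assoc[symmetric]
    by (simp add: mj mc md pair_sum_def Jj ji[symmetric] linear_add[OF lj])
  moreover have "matrix ?k ** matrix ?j = mat 1"
    unfolding matrix_eq matrix_vector_mul_assoc[symmetric]
    using jacobian_inverse[OF E(1) c(1) d(1) cd] by (simp add: mj mk)
  then have "invertible (matrix ?j)" using invertible_left_inverse by blast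
  ultimately show ?thesis by (rule invariants_similar(2))
qed

text \<open>A continuous function with values 1 and -1 is constant on a connected set. A holomorphic
  chart is selected at every point; chart independence permits one fixed chart near each point,
  where continuity can be read off.\<close>

lemma pair_sign_constant:
  fixes A :: "('a::{t2_space,second_countable_topology}, 3) chart set"
  assumes B: "bihermitian A g Jp Jm" and con: "connected (manifold A)"
  obtains e where "\<And>c x. c \<in> A \<Longrightarrow> holomorphic_chart Jp c \<Longrightarrow> x \<in> fst c \<Longrightarrow> pair_sign (pair_matrix Jm c x) = e"
proof -
  note E = bihermitian_endomorphism_fields[OF B]
  define ch where "ch x = (SOME c. c \<in> A \<and> holomorphic_chart Jp c \<and> x \<in> fst c)" for x
  have ch: "ch x \<in> A" "holomorphic_chart Jp (ch x)" "x \<in> fst (ch x)" if "x \<in> manifold A" for x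
  proof -
    have "\<exists>c. c \<in> A \<and> holomorphic_chart Jp c \<and> x \<in> fst c"
      using B that unfolding bihermitian_def complex_structure_def by blast
    from someI_ex[OF this] show "ch x \<in> A" "holomorphic_chart Jp (ch x)" "x \<in> fst (ch x)"
      by (auto simp: ch_def)
  qed
  define f where "f x = pair_sign (pair_matrix Jm (ch x) x)" for x
  have f: "f x = pair_sign (pair_matrix Jm c x)" if "c \<in> A" "holomorphic_chart Jp c" "x \<in> fst c" for c x
  proof -
    have "x \<in> manifold A" using that by (auto simp: manifold_def)
    then show ?thesis unfolding f_def using pair_sign_chart_independent[OF B that ch] by blast
  qed
  have "isCont f x" if x: "x \<in> manifold A" for x
  proof -
    have "open (fst (ch x))" using smooth_structureD(1)[OF E(1)] ch(1)[OF x] by (auto simp: is_chart_def)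
    moreover have "continuous_on (fst (ch x)) f"
      by (rule continuous_on_eq[OF continuous_on_pair_invariants(1)[OF E(1) ch(1)[OF x] E(3)]])
        (rule f[OF ch(1,2)[OF x], symmetric])
    ultimately show ?thesis using ch(3)[OF x] continuous_on_eq_continuous_at by blast
  qed
  then have "continuous_on (manifold A) f" by (simp add: continuous_at_imp_continuous_on)
  moreover have "f ` manifold A \<subseteq> {1, - 1}"
    using orthogonal_complex_structure.pair_sign_cases[OF bihermitian_pointwise[OF B ch]]
    by (auto simp: f_def)
  then have "finite (f ` manifold A)" using finite_subset by blast
  ultimately have "f constant_on manifold A"
    using continuous_finite_range_constant con by blast
  then obtain e where "\<And>x. x \<in> manifold A \<Longrightarrow> f x = e" by (auto simp: constant_on_def)
  then show ?thesis using that[of e] f by (metis UN_I manifold_def)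
qed

section \<open>The dimension bound and the type of commuting points\<close>

lemma exists_complementary_indices:
  obtains j k :: 3 where "UNIV = {i, j, k}" "i \<noteq> j" "i \<noteq> k" "j \<noteq> k"
proof -
  have "i = 1 \<or> i = 2 \<or> i = 3" by (rule exhaust_3)
  then consider "i = 1" | "i = 2" | "i = 3" by blast
  then show ?thesis
  proof cases
    case 1
    have "(UNIV :: 3 set) = {1, 2, 3}" by (rule UNIV_3)
    then show ?thesis using 1 by (intro that[of 2 3]) simp_all
  next
    case 2
    have "(UNIV :: 3 set) = {2, 1, 3}" unfolding UNIV_3 by (rule insert_commute)
    then show ?thesis using 2 by (intro that[of 1 3]) simp_all
  next
    case 3
    have "(UNIV :: 3 set) = {3, 1, 2}" unfolding UNIV_3 by blast
    then show ?thesis using 3 by (intro that[of 1 2]) simp_all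
  qed
qed

lemma pair_defect_zero:
  fixes A :: "('a::{t2_space,second_countable_topology}, 3) chart set"
  assumes B: "bihermitian A g Jp Jm" and dim: "complex_dim A Jp (commuting_locus A Jp Jm) \<le> 1"
    and c: "c \<in> A" "holomorphic_chart Jp c" "x \<in> fst c" and x: "x \<in> commuting_locus A Jp Jm"
  shows "pair_defect (Jm c x) = 0"
proof (rule ccontr)
  assume "pair_defect (Jm c x) \<noteq> 0"
  then obtain r i where ri: "pair_defect (Jm c x) $ r $ i \<noteq> 0" by (metis vec_eq_iff zero_index)
  obtain j k where ijk: "UNIV = {i, j, k}" "i \<noteq> j" "i \<noteq> k" "j \<noteq> k"
    by (rule exists_complementary_indices)
  note E = bihermitian_endomorphism_fields[OF B]
  have ch: "is_chart c" by (rule smooth_structureD(1)[OF E(1) c(1)])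
  \<comment> \<open>One fixed entry of the defect stays nonzero on \<open>W\<close>, so the same
    complementary entry of the bivector is decisive at all points of \<open>W\<close>.\<close>
  define W where "W = fst c \<inter> (\<lambda>x. pair_defect (Jm c x) $ r $ i) -` (- {0})"
  have "open W"
    unfolding W_def using ch
    by (intro continuous_open_preimage continuous_on_pair_invariants(2)[OF E(1) c(1) E(3)])
      (auto simp: is_chart_def)
  then have "open (snd c ` W)" by (rule chart_open_image[OF ch]) (simp add: W_def)
  moreover have "snd c x \<in> snd c ` W" using c(3) ri by (auto simp: W_def)
  ultimately obtain \<rho> where \<rho>: "\<rho> > 0" "ball (snd c x) \<rho> \<subseteq> snd c ` W"
    using open_contains_ball by blast
  \<comment> \<open>A ball is taken because \<open>regular_point_of_zero_set\<close> works on
    complex lines in a convex domain.\<close>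
  let ?U = "ball (snd c x) \<rho>"
  define a where "a k x = inv (metric_map (g c x)) (axis k 1)" for k :: 3 and x
  define f where "f z = pair_commutator (Jm c (chart_inv c z)) (a k (chart_inv c z)) $ j" for z
  have inW: "chart_inv c z \<in> W" if "z \<in> ?U" for z
    using \<rho>(2) that chart_inv_left[OF ch] by (auto simp: W_def)
  have fiff: "chart_inv c z \<in> commuting_locus A Jp Jm \<longleftrightarrow> f z = 0" if z: "z \<in> ?U" for z
  proof -
    let ?y = "chart_inv c z"
    have y: "?y \<in> fst c" "pair_defect (Jm c ?y) $ r $ i \<noteq> 0" using inW[OF z] by (auto simp: W_def)
    note O = bihermitian_pointwise[OF B c(1,2) y(1)]
    have dual: "g c ?y (a k ?y) w = Re (w $ k)" for k w
      unfolding a_def by (rule bivector_dual[OF B c(1,2) y(1)])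
    have "(\<forall>u. pair_commutator (Jm c ?y) u = 0) \<longleftrightarrow> f z = 0"
      using orthogonal_complex_structure.bivector_entry_zero_imp[OF O dual y(2) ijk]
      by (auto simp: f_def)
    then show ?thesis using commuting_locus_iff[OF B c(1,2) y(1)] by simp
  qed
  have f0: "f (snd c x) = 0" using fiff[of "snd c x"] \<rho>(1) x by (simp add: chart_inv_left[OF ch c(3)])
  have sub: "?U \<subseteq> snd c ` fst c" using \<rho>(2) by (auto simp: W_def)
  have hol: "hol_on ?U f"
    using hol_on_subset[OF bivector_holomorphic(2)[OF B c(1,2)] sub] unfolding f_def a_def .
  have "\<exists>y d. regular_point A Jp (commuting_locus A Jp Jm) d y \<and> CARD(3) \<le> d + 1"
    by (rule regular_point_of_zero_set[OF E(1) c(1) E(2) c(2) open_ball sub convex_ball hol _ f0 fiff])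
      (use \<rho>(1) in simp_all)
  then obtain y d where d: "regular_point A Jp (commuting_locus A Jp Jm) d y" "3 \<le> d + 1" by auto
  have "ereal (real d) \<le> complex_dim A Jp (commuting_locus A Jp Jm)"
    unfolding complex_dim_def using d(1) by (intro SUP_upper) blast
  also have "\<dots> \<le> 1" by (rule dim)
  finally show False using d(2) by simp
qed

text \<open>When \<open>Jm\<close> is \<open>- Jp\<close> or \<open>Jp\<close>, one kernel is the
  whole tangent space, of real dimension 6, and the other is the kernel of the invertible map
  \<open>2 Jp\<close>.\<close>

lemma type_locus_eq:
  fixes A :: "('a::{t2_space,second_countable_topology}, 3) chart set"
  assumes B: "bihermitian A g Jp Jm" and x: "x \<in> manifold A"
  shows "x \<in> type_locus A Jp Jm 3 0 \<longleftrightarrow> (\<forall>c\<in>A. x \<in> fst c \<longrightarrow> (\<forall>u. Jm c x u = - Jp c x u))"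
    and "x \<in> type_locus A Jp Jm 0 3 \<longleftrightarrow> (\<forall>c\<in>A. x \<in> fst c \<longrightarrow> (\<forall>u. Jm c x u = Jp c x u))"
proof -
  have J: "linear (Jp c x)" "linear (Jm c x)" "\<And>u. Jp c x (Jp c x u) = - u" if "c \<in> A" "x \<in> fst c" for c
  proof -
    show "linear (Jp c x)" "linear (Jm c x)"
      using bihermitian_endomorphism_fields(2,3)[OF B] that unfolding endomorphism_field_def by blast+
    have "almost_complex_structure A Jp"
      using B unfolding bihermitian_def complex_structure_def by blast
    then show "\<And>u. Jp c x (Jp c x u) = - u"
      using that unfolding almost_complex_structure_def by blast
  qed
  have J0: "u = 0" if "c \<in> A" "x \<in> fst c" "Jp c x u = 0" for c u
    using J(3)[OF that(1,2), of u] that(3) linear_0[OF J(1)[OF that(1,2)]] by simp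
  have dim0: "dim {v. Jp c x v + Jp c x v = 0} = 0" if "c \<in> A" "x \<in> fst c" for c
  proof -
    have "Jp c x v + Jp c x v = 0 \<longleftrightarrow> v = 0" for v
      using J0[OF that, of v] linear_0[OF J(1)[OF that]] by (auto simp flip: scaleR_2)
    then show ?thesis by simp
  qed
  have full: "S = UNIV" if "subspace S" "dim S = 6" for S :: "(complex ^ 3) set"
    using that subspace_dim_equal[OF that(1) subspace_UNIV] by simp
  have sub: "subspace {v. Jp c x v + Jm c x v = 0}" "subspace {v. Jp c x v - Jm c x v = 0}"
    if "c \<in> A" "x \<in> fst c" for c
    using J[OF that] by (auto simp: subspace_def linear_add linear_scale linear_0 algebra_simps
        eq_neg_iff_add_eq_0 simp flip: scaleR_right_distrib)
  have "dim {v. Jp c x v + Jm c x v = 0} = 2 * 3 \<and> dim {v. Jp c x v - Jm c x v = 0} = 2 * 0 \<longleftrightarrow>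
      (\<forall>u. Jm c x u = - Jp c x u)" if c: "c \<in> A" "x \<in> fst c" for c
  proof
    assume "dim {v. Jp c x v + Jm c x v = 0} = 2 * 3 \<and> dim {v. Jp c x v - Jm c x v = 0} = 2 * 0"
    then have "{v. Jp c x v + Jm c x v = 0} = UNIV" using full[OF sub(1)[OF c]] by simp
    then have "Jp c x u + Jm c x u = 0" for u by blast
    then show "\<forall>u. Jm c x u = - Jp c x u" by (metis minus_unique)
  qed (use dim0[OF c] in \<open>simp\<close>)
  with x show "x \<in> type_locus A Jp Jm 3 0 \<longleftrightarrow> (\<forall>c\<in>A. x \<in> fst c \<longrightarrow> (\<forall>u. Jm c x u = - Jp c x u))"
    unfolding type_locus_def by blast
  have "dim {v. Jp c x v + Jm c x v = 0} = 2 * 0 \<and> dim {v. Jp c x v - Jm c x v = 0} = 2 * 3 \<longleftrightarrow>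
      (\<forall>u. Jm c x u = Jp c x u)" if c: "c \<in> A" "x \<in> fst c" for c
  proof
    assume "dim {v. Jp c x v + Jm c x v = 0} = 2 * 0 \<and> dim {v. Jp c x v - Jm c x v = 0} = 2 * 3"
    then have "{v. Jp c x v - Jm c x v = 0} = UNIV" using full[OF sub(2)[OF c]] by simp
    then have "Jp c x u - Jm c x u = 0" for u by blast
    then show "\<forall>u. Jm c x u = Jp c x u" by (metis right_minus_eq)
  qed (use dim0[OF c] in \<open>simp\<close>)
  with x show "x \<in> type_locus A Jp Jm 0 3 \<longleftrightarrow> (\<forall>c\<in>A. x \<in> fst c \<longrightarrow> (\<forall>u. Jm c x u = Jp c x u))"
    unfolding type_locus_def by blast
qed

lemma commuting_locus_types:
  fixes A :: "('a::{t2_space,second_countable_topology}, 3) chart set"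
  assumes B: "bihermitian A g Jp Jm" and dim: "complex_dim A Jp (commuting_locus A Jp Jm) \<le> 1"
    and c: "c \<in> A" "holomorphic_chart Jp c" "x \<in> fst c" and x: "x \<in> commuting_locus A Jp Jm"
  shows "pair_sign (pair_matrix Jm c x) = 1 \<and> x \<in> type_locus A Jp Jm 3 0 \<or>
    pair_sign (pair_matrix Jm c x) = - 1 \<and> x \<in> type_locus A Jp Jm 0 3"
proof -
  note E = bihermitian_endomorphism_fields[OF B]
  have xM: "x \<in> manifold A" using c by (auto simp: manifold_def)
  have J: "Jp c x u = \<i> *s u" for u using c by (simp add: holomorphic_chart_def)
  have K: "pair_commutator (Jm c x) u = 0" for u
    using x commuting_locus_iff[OF B c] by blast
  from orthogonal_complex_structure.kernel_type[OF bihermitian_pointwise[OF B c] K pair_defect_zero[OF B dim c x]]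
  show ?thesis
  proof (elim disjE conjE)
    assume s: "pair_sign (pair_matrix Jm c x) = 1" and m: "\<forall>u. Jm c x u = - (\<i> *s u)"
    have "Jm d x u = (- 1) *\<^sub>R Jp d x u" if "d \<in> A" "x \<in> fst d" for d u
      by (rule endomorphism_field_relation_transport[OF E(1) c(1) that(1) c(3) that(2) E(3,2)])
        (use m J in simp)
    then show ?thesis using s type_locus_eq(1)[OF B xM] by simp
  next
    assume s: "pair_sign (pair_matrix Jm c x) = - 1" and m: "\<forall>u. Jm c x u = \<i> *s u"
    have "Jm d x u = 1 *\<^sub>R Jp d x u" if "d \<in> A" "x \<in> fst d" for d u
      by (rule endomorphism_field_relation_transport[OF E(1) c(1) that(1) c(3) that(2) E(3,2)])
        (use m J in simp)
    then show ?thesis using s type_locus_eq(2)[OF B xM] by simp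
  qed
qed

lemma type_locus_subset_commuting_locus:
  fixes A :: "('a::{t2_space,second_countable_topology}, 3) chart set"
  assumes B: "bihermitian A g Jp Jm"
  shows "type_locus A Jp Jm 3 0 \<subseteq> commuting_locus A Jp Jm"
    and "type_locus A Jp Jm 0 3 \<subseteq> commuting_locus A Jp Jm"
proof -
  have l: "linear (Jp c x)" if "c \<in> A" "x \<in> fst c" for c x
    using bihermitian_endomorphism_fields(2)[OF B] that unfolding endomorphism_field_def by blast
  have M: "x \<in> manifold A" if "x \<in> type_locus A Jp Jm m n" for x m n
    using that by (simp add: type_locus_def)
  show "type_locus A Jp Jm 3 0 \<subseteq> commuting_locus A Jp Jm"
  proof
    fix x assume x: "x \<in> type_locus A Jp Jm 3 0"
    then have "\<forall>c\<in>A. x \<in> fst c \<longrightarrow> (\<forall>u. Jm c x u = - Jp c x u)"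
      using type_locus_eq(1)[OF B M[OF x]] by blast
    then show "x \<in> commuting_locus A Jp Jm"
      using M[OF x] unfolding commuting_locus_def by (simp add: linear_neg[OF l])
  qed
  show "type_locus A Jp Jm 0 3 \<subseteq> commuting_locus A Jp Jm"
  proof
    fix x assume x: "x \<in> type_locus A Jp Jm 0 3"
    then have "\<forall>c\<in>A. x \<in> fst c \<longrightarrow> (\<forall>u. Jm c x u = Jp c x u)"
      using type_locus_eq(2)[OF B M[OF x]] by blast
    then show "x \<in> commuting_locus A Jp Jm"
      using M[OF x] unfolding commuting_locus_def by simp
  qed
qed

theorem theorem8p14:
  fixes A :: "('a::{t2_space,second_countable_topology}, 3) chart set"
    and g :: "('a, 3) cov2_field"
    and Jp Jm :: "('a, 3) endo_field"
  assumes "bihermitian A g Jp Jm"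
    and "connected (manifold A)"
    and "complex_dim A Jp (commuting_locus A Jp Jm) \<le> 1"
  shows "commuting_locus A Jp Jm = type_locus A Jp Jm 0 3 \<or>
    commuting_locus A Jp Jm = type_locus A Jp Jm 3 0"
proof -
  obtain e where e: "\<And>c x. c \<in> A \<Longrightarrow> holomorphic_chart Jp c \<Longrightarrow> x \<in> fst c \<Longrightarrow> pair_sign (pair_matrix Jm c x) = e"
    using pair_sign_constant[OF assms(1,2)] by blast
  have t: "e = 1 \<and> x \<in> type_locus A Jp Jm 3 0 \<or> e = - 1 \<and> x \<in> type_locus A Jp Jm 0 3"
    if x: "x \<in> commuting_locus A Jp Jm" for x
  proof -
    have "x \<in> manifold A" using x by (simp add: commuting_locus_def)
    then obtain c where c: "c \<in> A" "holomorphic_chart Jp c" "x \<in> fst c"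
      using assms(1) unfolding bihermitian_def complex_structure_def by blast
    show ?thesis
      using commuting_locus_types[OF assms(1,3) c x] e[OF c] by simp
  qed
  show ?thesis
  \<comment> \<open>An empty commuting locus is compatible with any \<open>e\<close>; the reverse
    inclusion then makes the chosen type locus empty as well.\<close>
  proof (cases "e = 1")
    case True
    then have "commuting_locus A Jp Jm \<subseteq> type_locus A Jp Jm 3 0" using t by auto
    then show ?thesis using type_locus_subset_commuting_locus[OF assms(1)] by blast
  next
    case False
    then have "commuting_locus A Jp Jm \<subseteq> type_locus A Jp Jm 0 3" using t by auto
    then show ?thesis using type_locus_subset_commuting_locus[OF assms(1)] by blast
  qed
qed

end
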